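(* For a closed oriented smooth $m$-dimensional submanifold $M$ of $\mathbb{R}^k$ of codimension $n=k-m\ge 1$, the function $\frac{\omega_{n-1}}{\omega_{k-1}}K_M$ on $M$ is an intrinsic invariant of the induced Riemannian metric. That is: let $M\subset\mathbb{R}^{k}$ and $M'\subset\mathbb{R}^{k'}$ be closed oriented smooth submanifolds of the same dimension $m$, with codimensions $n=k-m\geq 1$ and $n'=k'-m\geq 1$, each with the Riemannian metric induced from the ambient Euclidean space, and let $\varphi:U\to U'$ be a Riemannian isometry between open subsets $U\subset M$ and $U'\subset M'$. Then for every $p\in U$, \[ \frac{\omega_{n-1}}{\omega_{k-1}}K_M(p)=\frac{\omega_{n'-1}}{\omega_{k'-1}}K_{M'}(\varphi(p)), \] where $K_M$ and $K_{M'}$ denote the generalized Gaussian curvatures and $\omega_d$ is the volume of the $d$-dimensional unit sphere ($\omega_0=2$).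
   Context: Let $M$ be a closed (compact, without boundary) oriented smooth $m$-dimensional submanifold of $\mathbb{R}^k$ with codimension $n=k-m\ge 1$. Let $\langle\cdot,\cdot\rangle$ be the Euclidean inner product on $\mathbb{R}^k$ and $D$ the standard flat connection of $\mathbb{R}^k$. The first fundamental form $\mathrm{I}_M$ is the restriction of $\langle\cdot,\cdot\rangle$ to the tangent spaces of $M$. The second fundamental form is $\mathrm{II}_M(X,Y)=(D_XY)^{\perp}$, the component of $D_XY$ normal to $M$, for $X,Y$ tangent to $M$. For $p\in M$ and a unit vector $\nu\in\mathbb{R}^k$ normal to $M$ at $p$, define the symmetric bilinear form $\mathrm{II}_M^\nu(\cdot,\cdot)=\langle \mathrm{II}_M(\cdot,\cdot),\nu\rangle$ on $T_pM$, and \[ K_M^\nu=\frac{\det(\mathrm{II}_M^\nu)}{\det(\mathrm{I}_M)}, \] where both determinants are computed with respect to the same basis of $T_pM$ (the quotient does not depend on the basis). Let $NS_p\subset S^{k-1}$ be the $(n-1)$-dimensional unit sphere of unit vectors normal to $M$ at $p$, with its standard volume measure $dV_{NS_p}$ (counting measure on the two unit normals when $n=1$). The generalized Gaussian curvature of $M$ at $p$ is \[ K_M(p)=\frac{1}{\omega_{n-1}}\int_{NS_p}K_M^\nu\,dV_{NS_p}, \] where $\omega_d$ is the volume of the unit sphere $S^d$, with the convention $\omega_0=2$. A Riemannian isometry is a diffeomorphism that pulls back the induced metric (first fundamental form) of the target to that of the source. *)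

theory Defs
  imports "Jordan_Normal_Form.Determinant" "HOL-Analysis.Analysis"
begin

text \<open>
  The space \<open>\<real>\<^sup>k\<close> is an arbitrary type of class \<open>euclidean_space\<close>, with \<open>k = DIM('a)\<close>.  Manifold
  dimensions are natural numbers, so matrices of size \<open>m\<close> are those of \<open>Jordan_Normal_Form\<close>
  (\<open>Matrix.mat\<close>, \<open>Determinant.det\<close>).
\<close>

section \<open>Smooth maps\<close>

text \<open>\<open>Ck_on r S f\<close>, for open \<open>S\<close>: all iterated directional derivatives of \<open>f\<close> of order at most \<open>r\<close>
  exist and are continuous on \<open>S\<close>.\<close>

fun Ck_on :: "nat \<Rightarrow> 'a::euclidean_space set \<Rightarrow> ('a \<Rightarrow> 'b::euclidean_space) \<Rightarrow> bool" where
  "Ck_on 0 S f \<longleftrightarrow> continuous_on S f"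
| "Ck_on (Suc r) S f \<longleftrightarrow>
     (\<forall>x\<in>S. f differentiable (at x)) \<and> (\<forall>v. Ck_on r S (\<lambda>x. frechet_derivative f (at x) v))"

definition smooth_on :: "'a::euclidean_space set \<Rightarrow> ('a \<Rightarrow> 'b::euclidean_space) \<Rightarrow> bool" where
  "smooth_on S f \<longleftrightarrow> (\<forall>r. Ck_on r S f)"

section \<open>Submanifolds of Euclidean space\<close>

text \<open>Slice charts: near each of its points, \<open>M\<close> is carried to a piece of an \<open>m\<close>-dimensional linear
  subspace by a diffeomorphism between open subsets of the ambient space.  In particular \<open>M\<close> has
  no boundary.\<close>

definition submanifold :: "nat \<Rightarrow> 'a::euclidean_space set \<Rightarrow> bool" where
  "submanifold m M \<longleftrightarrow>
     (\<forall>p\<in>M. \<exists>U V (\<Phi> :: 'a \<Rightarrow> 'a) \<Psi> L.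
        open U \<and> open V \<and> p \<in> U \<and> smooth_on U \<Phi> \<and> smooth_on V \<Psi> \<and> homeomorphism U V \<Phi> \<Psi> \<and>
        subspace L \<and> dim L = m \<and> \<Phi> ` (U \<inter> M) = V \<inter> L)"

definition tangent_space :: "'a::euclidean_space set \<Rightarrow> 'a \<Rightarrow> 'a set" where
  "tangent_space M p =
     {v. \<exists>\<epsilon>>0. \<exists>\<gamma> :: real \<Rightarrow> 'a. smooth_on {-\<epsilon><..<\<epsilon>} \<gamma> \<and> \<gamma> ` {-\<epsilon><..<\<epsilon>} \<subseteq> M \<and>
          \<gamma> 0 = p \<and> (\<gamma> has_vector_derivative v) (at 0)}"

definition normal_space :: "'a::euclidean_space set \<Rightarrow> 'a \<Rightarrow> 'a set" where
  "normal_space M p = (tangent_space M p)\<^sup>\<bottom>"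

definition normal_component :: "'a::euclidean_space set \<Rightarrow> 'a \<Rightarrow> 'a \<Rightarrow> 'a" where
  "normal_component M p w = (THE z. z \<in> normal_space M p \<and> w - z \<in> tangent_space M p)"

text \<open>Ordered bases of \<open>T\<^sub>pM\<close>, given as sequences of which only the first \<open>m\<close> entries matter.\<close>

definition tangent_basis :: "nat \<Rightarrow> 'a::euclidean_space set \<Rightarrow> 'a \<Rightarrow> (nat \<Rightarrow> 'a) \<Rightarrow> bool" where
  "tangent_basis m M p b \<longleftrightarrow>
     inj_on b {..<m} \<and> independent (b ` {..<m}) \<and> span (b ` {..<m}) = tangent_space M p"

text \<open>An orientation \<open>s\<close> tells whether an ordered basis \<open>b\<close> of \<open>T\<^sub>pM\<close> is positive (\<open>s p b = 1\<close>) or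
  negative (\<open>s p b = -1\<close>).  A change of basis multiplies this by the sign of its determinant, and it
  is locally constant along continuous tangent frames.  For \<open>m = 0\<close> this is a sign at each
  point.\<close>

definition orientation ::
    "nat \<Rightarrow> 'a::euclidean_space set \<Rightarrow> ('a \<Rightarrow> (nat \<Rightarrow> 'a) \<Rightarrow> real) \<Rightarrow> bool" where
  "orientation m M s \<longleftrightarrow>
     (\<forall>p\<in>M. \<forall>b. tangent_basis m M p b \<longrightarrow> s p b \<in> {-1, 1}) \<and>
     (\<forall>p\<in>M. \<forall>b c. \<forall>A\<in>carrier_mat m m.
        tangent_basis m M p b \<and> tangent_basis m M p c \<and>
        (\<forall>j<m. c j = (\<Sum>i<m. A $$ (i, j) *\<^sub>R b i)) \<longrightarrow>
        s p c = sgn (Determinant.det A) * s p b) \<and>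
     (\<forall>W (e :: nat \<Rightarrow> 'a \<Rightarrow> 'a).
        openin (top_of_set M) W \<and> (\<forall>i<m. continuous_on W (e i)) \<and>
        (\<forall>q\<in>W. tangent_basis m M q (\<lambda>i. e i q)) \<longrightarrow>
        continuous_on W (\<lambda>q. s q (\<lambda>i. e i q)))"

definition closed_oriented_submanifold ::
    "nat \<Rightarrow> 'a::euclidean_space set \<Rightarrow> ('a \<Rightarrow> (nat \<Rightarrow> 'a) \<Rightarrow> real) \<Rightarrow> bool" where
  "closed_oriented_submanifold m M s \<longleftrightarrow> submanifold m M \<and> compact M \<and> orientation m M s"

section \<open>Riemannian isometries\<close>

text \<open>A map on \<open>M\<close> is smooth if it extends smoothly to an ambient neighbourhood of each point.\<close>

definition local_smooth_extension ::
    "'a::euclidean_space set \<Rightarrow> ('a \<Rightarrow> 'b::euclidean_space) \<Rightarrow> 'a \<Rightarrow> ('a \<Rightarrow> 'b) \<Rightarrow> bool" where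
  "local_smooth_extension M f p F \<longleftrightarrow>
     (\<exists>W. open W \<and> p \<in> W \<and> smooth_on W F \<and> (\<forall>q\<in>W \<inter> M. F q = f q))"

definition smooth_map :: "'a::euclidean_space set \<Rightarrow> ('a \<Rightarrow> 'b::euclidean_space) \<Rightarrow> bool" where
  "smooth_map M f \<longleftrightarrow> (\<forall>p\<in>M. \<exists>F. local_smooth_extension M f p F)"

definition differential ::
    "'a::euclidean_space set \<Rightarrow> ('a \<Rightarrow> 'b::euclidean_space) \<Rightarrow> 'a \<Rightarrow> 'a \<Rightarrow> 'b" where
  "differential M f p v =
     (THE w. \<exists>F. local_smooth_extension M f p F \<and> w = frechet_derivative F (at p) v)"

definition first_fundamental_form :: "'a::euclidean_space set \<Rightarrow> 'a \<Rightarrow> 'a \<Rightarrow> 'a \<Rightarrow> real" where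
  "first_fundamental_form M p = (\<lambda>u\<in>tangent_space M p. \<lambda>v\<in>tangent_space M p. inner u v)"

definition riemannian_isometry ::
    "'a::euclidean_space set \<Rightarrow> 'b::euclidean_space set \<Rightarrow> ('a \<Rightarrow> 'b) \<Rightarrow> bool" where
  "riemannian_isometry U U' \<phi> \<longleftrightarrow>
     bij_betw \<phi> U U' \<and> smooth_map U \<phi> \<and> smooth_map U' (inv_into U \<phi>) \<and>
     (\<forall>p\<in>U. \<forall>u\<in>tangent_space U p. \<forall>v\<in>tangent_space U p.
        first_fundamental_form U' (\<phi> p) (differential U \<phi> p u) (differential U \<phi> p v) =
        first_fundamental_form U p u v)"

section \<open>Second fundamental form and directional Gauss curvature\<close>

text \<open>\<open>II\<^sub>M(u,v) = (D\<^sub>u Y)\<^sup>\<bottom>\<close> for any smooth local tangent vector field \<open>Y\<close> with \<open>Y(p) = v\<close>, here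
  extended to an ambient neighbourhood of \<open>p\<close>; the value does not depend on \<open>Y\<close>.\<close>

definition second_fundamental_form :: "'a::euclidean_space set \<Rightarrow> 'a \<Rightarrow> 'a \<Rightarrow> 'a \<Rightarrow> 'a" where
  "second_fundamental_form M p u v =
     (THE w. \<exists>W Y. open W \<and> p \<in> W \<and> smooth_on W Y \<and> (\<forall>q\<in>W \<inter> M. Y q \<in> tangent_space M q) \<and>
        Y p = v \<and> w = normal_component M p (frechet_derivative Y (at p) u))"

text \<open>The chosen basis is immaterial: both determinants scale by the squared determinant of a
  change of basis.\<close>

definition directional_gauss_curvature :: "'a::euclidean_space set \<Rightarrow> 'a \<Rightarrow> 'a \<Rightarrow> real" where
  "directional_gauss_curvature M p \<nu> =
     (let m = dim (tangent_space M p); b = (SOME b. tangent_basis m M p b) in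
      Determinant.det (Matrix.mat m m (\<lambda>(i, j). inner (second_fundamental_form M p (b i) (b j)) \<nu>)) /
      Determinant.det (Matrix.mat m m (\<lambda>(i, j). first_fundamental_form M p (b i) (b j))))"

section \<open>Volume of unit spheres and generalized Gaussian curvature\<close>

definition orthonormal_basis_of :: "'a::euclidean_space set \<Rightarrow> 'a set \<Rightarrow> bool" where
  "orthonormal_basis_of V B \<longleftrightarrow>
     pairwise orthogonal B \<and> (\<forall>b\<in>B. norm b = 1) \<and> span B = V"

text \<open>Lebesgue measure of a linear subspace \<open>V\<close> (compare the library definition of \<open>lborel\<close>); it does
  not depend on the orthonormal basis.\<close>

definition subspace_lborel :: "'a::euclidean_space set \<Rightarrow> 'a measure" where
  "subspace_lborel V =
     (let B = (SOME B. orthonormal_basis_of V B) in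
      distr (\<Pi>\<^sub>M b\<in>B. lborel) borel (\<lambda>f. \<Sum>b\<in>B. f b *\<^sub>R b))"

text \<open>The standard volume measure of the unit sphere of \<open>V\<close>, normalised by polar coordinates
  \<open>dx = r\<^bsup>n-1\<^esup> dr d\<sigma>\<close>, \<open>n = dim V\<close>: the volume of \<open>A\<close> is \<open>n\<close> times the Lebesgue measure of the cone
  \<open>{t x | 0 < t \<le> 1, x \<in> A}\<close>.  For \<open>n = 1\<close> it is counting measure on the two unit vectors.\<close>

definition unit_sphere_measure :: "'a::euclidean_space set \<Rightarrow> 'a measure" where
  "unit_sphere_measure V =
     scale_measure (of_nat (dim V))
       (distr (restrict_space (subspace_lborel V) (V \<inter> cball 0 1 - {0}))
              (restrict_space borel (V \<inter> sphere 0 1)) sgn)"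

text \<open>\<open>\<omega>\<^sub>d\<close>, the volume of the \<open>d\<close>-dimensional unit sphere; that it is the total mass of
  \<^const>\<open>unit_sphere_measure\<close> is \<open>emeasure_unit_sphere_measure_total\<close> below.\<close>

definition unit_sphere_vol :: "nat \<Rightarrow> real" where
  "unit_sphere_vol d = real (d + 1) * unit_ball_vol (real (d + 1))"

lemma unit_sphere_vol_0: "unit_sphere_vol 0 = 2"
  by (simp add: unit_sphere_vol_def)

lemma orthonormal_basis_of_some:
  assumes "subspace V"
  shows "orthonormal_basis_of V (SOME B. orthonormal_basis_of V B)"
proof -
  from orthonormal_basis_subspace[OF assms] obtain B where
    "pairwise orthogonal B" "\<And>x. x \<in> B \<Longrightarrow> norm x = 1" "span B = V" by metis
  hence "orthonormal_basis_of V B" by (simp add: orthonormal_basis_of_def)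
  thus ?thesis by (rule someI)
qed

lemma orthonormal_basis_ofD:
  assumes "orthonormal_basis_of V B"
  shows "finite B" "card B = dim V"
    "norm (\<Sum>b\<in>B. f b *\<^sub>R b) = sqrt (\<Sum>b\<in>B. (f b)\<^sup>2)" "(\<Sum>b\<in>B. f b *\<^sub>R b) \<in> V"
proof -
  have orth: "pairwise orthogonal B" and nrm: "\<And>b. b \<in> B \<Longrightarrow> norm b = 1" and sp: "span B = V"
    using assms by (auto simp: orthonormal_basis_of_def)
  have "0 \<notin> B" using nrm by fastforce
  hence ind: "independent B" by (rule pairwise_orthogonal_independent[OF orth])
  thus fin: "finite B" by (rule independent_imp_finite)
  show "card B = dim V" using dim_span_eq_card_independent[OF ind] by (simp add: sp)
  show "(\<Sum>b\<in>B. f b *\<^sub>R b) \<in> V"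
    unfolding sp[symmetric] by (intro span_sum span_scale span_base)
  have "(norm (\<Sum>b\<in>B. f b *\<^sub>R b))\<^sup>2 = (\<Sum>b\<in>B. (norm (f b *\<^sub>R b))\<^sup>2)"
    using orth by (intro norm_sum_Pythagorean[OF fin])
      (auto simp: pairwise_def orthogonal_def)
  also have "\<dots> = (\<Sum>b\<in>B. (f b)\<^sup>2)" by (intro sum.cong refl) (simp add: nrm)
  finally show "norm (\<Sum>b\<in>B. f b *\<^sub>R b) = sqrt (\<Sum>b\<in>B. (f b)\<^sup>2)"
    by (metis norm_ge_zero real_sqrt_unique)
qed

lemma subspace_lborel_measurable [measurable]:
  fixes B :: "'a::euclidean_space set"
  shows "(\<lambda>f. \<Sum>b\<in>B. f b *\<^sub>R b) \<in> borel_measurable (\<Pi>\<^sub>M b\<in>B. (lborel :: real measure))"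
proof (rule borel_measurable_sum)
  fix b assume [measurable]: "b \<in> B"
  have "(\<lambda>f. f b) \<in> (\<Pi>\<^sub>M b\<in>B. (lborel :: real measure)) \<rightarrow>\<^sub>M lborel"
    by measurable
  thus "(\<lambda>f. f b *\<^sub>R b) \<in> borel_measurable (\<Pi>\<^sub>M b\<in>B. (lborel :: real measure))"
    by (intro borel_measurable_scaleR borel_measurable_const) simp
qed

lemma sets_subspace_lborel [simp, measurable_cong]: "sets (subspace_lborel V) = sets borel"
  and space_subspace_lborel [simp]: "space (subspace_lborel V) = UNIV"
  by (simp_all add: subspace_lborel_def Let_def)

lemma emeasure_subspace_lborel_cball:
  fixes V :: "'a::euclidean_space set"
  assumes "subspace V" "r > 0"
  shows "emeasure (subspace_lborel V) (V \<inter> cball 0 r) = ennreal (unit_ball_vol (dim V) * r ^ dim V)"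
proof -
  define B where "B = (SOME B. orthonormal_basis_of V B)"
  have B: "orthonormal_basis_of V B"
    unfolding B_def by (rule orthonormal_basis_of_some[OF assms(1)])
  have [measurable]: "V \<inter> cball 0 r \<in> sets borel"
    using closed_subspace[OF assms(1)] by (auto intro!: borel_closed closed_Int)
  have "emeasure (subspace_lborel V) (V \<inter> cball 0 r) =
        emeasure (\<Pi>\<^sub>M b\<in>B. lborel)
          ((\<lambda>f. \<Sum>b\<in>B. f b *\<^sub>R b) -` (V \<inter> cball 0 r) \<inter> space (\<Pi>\<^sub>M b\<in>B. lborel))"
    unfolding subspace_lborel_def Let_def B_def[symmetric] by (subst emeasure_distr) auto
  also have "(\<lambda>f. \<Sum>b\<in>B. f b *\<^sub>R b) -` (V \<inter> cball 0 r) = {f. sqrt (\<Sum>b\<in>B. (f b)\<^sup>2) \<le> r}"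
    using orthonormal_basis_ofD[OF B] by auto
  also have "emeasure (\<Pi>\<^sub>M b\<in>B. lborel) (\<dots> \<inter> space (\<Pi>\<^sub>M b\<in>B. lborel)) =
      ennreal (unit_ball_vol (dim V) * r ^ dim V)"
    using emeasure_cball_aux[OF orthonormal_basis_ofD(1)[OF B] assms(2)] orthonormal_basis_ofD(2)[OF B]
    by simp
  finally show ?thesis .
qed

lemma emeasure_unit_sphere_measure:
  fixes V :: "'a::euclidean_space set"
  assumes "subspace V" "A \<in> sets borel" "A \<subseteq> V \<inter> sphere 0 1"
  shows "emeasure (unit_sphere_measure V) A =
    of_nat (dim V) * emeasure (subspace_lborel V) {t *\<^sub>R x | t x. 0 < t \<and> t \<le> 1 \<and> x \<in> A}"
proof -
  have V: "V \<in> sets borel" using closed_subspace[OF assms(1)] by (rule borel_closed)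
  hence [measurable]: "V \<inter> cball 0 1 - {0} \<in> sets borel" "V \<inter> sphere 0 1 \<in> sets borel"
    by (simp_all add: borel_closed sets.Int sets.Diff)
  have sgn: "sgn \<in> restrict_space (subspace_lborel V) (V \<inter> cball 0 1 - {0}) \<rightarrow>\<^sub>M
      restrict_space borel (V \<inter> sphere 0 1)"
  proof (rule measurable_restrict_space2)
    show "sgn \<in> space (restrict_space (subspace_lborel V) (V \<inter> cball 0 1 - {0})) \<rightarrow> V \<inter> sphere 0 1"
      using assms(1) by (simp add: space_restrict_space sgn_div_norm subspace_mul)
    have "(sgn :: 'a \<Rightarrow> 'a) \<in> borel_measurable borel"
      unfolding sgn_div_norm[abs_def] by measurable
    thus "sgn \<in> borel_measurable (restrict_space (subspace_lborel V) (V \<inter> cball 0 1 - {0}))"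
      by (intro measurable_restrict_space1) (simp cong: measurable_cong_sets)
  qed
  have A: "A \<in> sets (restrict_space borel (V \<inter> sphere 0 1))"
    using assms(2,3) by (subst sets_restrict_space_iff) auto
  have eq: "sgn -` A \<inter> (V \<inter> cball 0 1 - {0}) = {t *\<^sub>R x | t x. 0 < t \<and> t \<le> 1 \<and> x \<in> A}"
  proof (intro equalityI subsetI)
    fix y assume y: "y \<in> sgn -` A \<inter> (V \<inter> cball 0 1 - {0})"
    hence "0 < norm y" "norm y \<le> 1" "sgn y \<in> A" by simp_all
    moreover from this have "norm y *\<^sub>R sgn y = y" by (simp add: sgn_div_norm)
    ultimately show "y \<in> {t *\<^sub>R x | t x. 0 < t \<and> t \<le> 1 \<and> x \<in> A}"
      by (intro CollectI exI[of _ "norm y"] exI[of _ "sgn y"]) simp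
  next
    fix y assume "y \<in> {t *\<^sub>R x | t x. 0 < t \<and> t \<le> 1 \<and> x \<in> A}"
    then obtain t x where t: "y = t *\<^sub>R x" "0 < t" "t \<le> 1" "x \<in> A" by blast
    with assms(3) have "x \<in> V" "norm x = 1" by auto
    moreover from this t have "sgn y = x" "norm y = t" "y \<noteq> 0" by (auto simp: sgn_div_norm)
    moreover have "y \<in> V" unfolding t(1) using assms(1) \<open>x \<in> V\<close> by (rule subspace_mul)
    ultimately show "y \<in> sgn -` A \<inter> (V \<inter> cball 0 1 - {0})" using t by simp
  qed
  have sub: "{t *\<^sub>R x | t x. 0 < t \<and> t \<le> 1 \<and> x \<in> A} \<subseteq> V \<inter> cball 0 1 - {0}"
    unfolding eq[symmetric] by (rule Int_lower2)
  have sp: "space (restrict_space (subspace_lborel V) (V \<inter> cball 0 1 - {0})) = V \<inter> cball 0 1 - {0}"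
    by (simp only: space_restrict_space space_subspace_lborel Int_UNIV_right)
  have "emeasure (restrict_space (subspace_lborel V) (V \<inter> cball 0 1 - {0}))
          {t *\<^sub>R x | t x. 0 < t \<and> t \<le> 1 \<and> x \<in> A} =
        emeasure (subspace_lborel V) {t *\<^sub>R x | t x. 0 < t \<and> t \<le> 1 \<and> x \<in> A}"
    using sub by (rule emeasure_restrict_space[rotated]) measurable
  thus ?thesis
    unfolding unit_sphere_measure_def emeasure_scale_measure emeasure_distr[OF sgn A] sp eq
    by (rule arg_cong)
qed

lemma emeasure_unit_sphere_measure_total:
  fixes V :: "'a::euclidean_space set"
  assumes "subspace V" "dim V = d + 1"
  shows "emeasure (unit_sphere_measure V) (V \<inter> sphere 0 1) = ennreal (unit_sphere_vol d)"
proof -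
  let ?L = "subspace_lborel V"
  have V: "V \<in> sets borel" using closed_subspace[OF assms(1)] by (rule borel_closed)
  have fin: "emeasure ?L (V \<inter> cball 0 1) = ennreal (unit_ball_vol (dim V))"
    using emeasure_subspace_lborel_cball[OF assms(1), of 1] by simp
  have cone: "{t *\<^sub>R x | t x. 0 < t \<and> t \<le> 1 \<and> x \<in> V \<inter> sphere 0 1} = V \<inter> cball 0 1 - {0}"
  proof (intro equalityI subsetI)
    fix y assume y: "y \<in> V \<inter> cball 0 1 - {0}"
    hence "y = norm y *\<^sub>R sgn y" "sgn y \<in> V \<inter> sphere 0 1"
      using assms(1) by (auto simp: sgn_div_norm subspace_mul)
    with y show "y \<in> {t *\<^sub>R x | t x. 0 < t \<and> t \<le> 1 \<and> x \<in> V \<inter> sphere 0 1}" by fastforce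
  qed (use assms(1) in \<open>auto simp: subspace_mul\<close>)
  have zero: "emeasure ?L {0} = 0"
  proof -
    have le: "emeasure ?L {0} \<le> ennreal (unit_ball_vol (dim V) * r)" if "0 < r" "r < 1" for r
    proof -
      have "emeasure ?L {0} \<le> emeasure ?L (V \<inter> cball 0 r)"
        using that V assms(1) by (intro emeasure_mono) (auto simp: subspace_0)
      also have "\<dots> = ennreal (unit_ball_vol (dim V) * r ^ dim V)"
        using emeasure_subspace_lborel_cball[OF assms(1) that(1)] .
      also have "\<dots> \<le> ennreal (unit_ball_vol (dim V) * r)"
        using that assms(2) power_decreasing[of 1 "dim V" r]
        by (intro ennreal_leI mult_left_mono) auto
      finally show ?thesis .
    qed
    have "((\<lambda>r. ennreal (unit_ball_vol (dim V) * r)) \<longlongrightarrow> ennreal (unit_ball_vol (dim V) * 0)) (at_right 0)"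
      by (intro tendsto_intros tendsto_ennrealI)
    moreover have "eventually (\<lambda>r. emeasure ?L {0} \<le> ennreal (unit_ball_vol (dim V) * r)) (at_right 0)"
      unfolding eventually_at_right_field using le by (intro exI[of _ 1]) auto
    ultimately have "emeasure ?L {0} \<le> ennreal (unit_ball_vol (dim V) * 0)"
      by (intro tendsto_lowerbound[where F = "at_right (0::real)"]) auto
    thus ?thesis by simp
  qed
  have "emeasure (unit_sphere_measure V) (V \<inter> sphere 0 1) =
      of_nat (dim V) * emeasure ?L (V \<inter> cball 0 1 - {0})"
    using V by (subst emeasure_unit_sphere_measure[OF assms(1)]) (auto simp: cone[symmetric])
  also have "emeasure ?L (V \<inter> cball 0 1 - {0}) = emeasure ?L (V \<inter> cball 0 1)"
    using zero V by (intro emeasure_Diff_null_set) (auto simp: null_sets_def)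
  finally show ?thesis
    unfolding fin assms(2) unit_sphere_vol_def
    by (simp add: ennreal_mult ennreal_of_nat_eq_real_of_nat del: of_nat_Suc of_nat_add)
qed

definition generalized_gauss_curvature :: "'a::euclidean_space set \<Rightarrow> 'a \<Rightarrow> real" where
  "generalized_gauss_curvature M p =
     1 / unit_sphere_vol (DIM('a) - dim (tangent_space M p) - 1) *
     (\<integral>\<nu>. directional_gauss_curvature M p \<nu> \<partial>unit_sphere_measure (normal_space M p))"

end

theory Submission
  imports Defs "HOL-Probability.Distributions"
begin

text \<open>
  For homogeneous \<open>F\<close> of degree \<open>m\<close> on the \<open>n\<close>-dimensional normal space, polar coordinates turn
  \<open>1/\<omega>\<^bsub>k-1\<^esub> \<integral> F d\<sigma>\<close>, \<open>k = m + n\<close>, into \<open>(2\<pi>)\<^bsup>-m/2\<^esup> E F(X)\<close> with \<open>X\<close> a standard Gaussian normal vector, so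
  that the codimension disappears from the constants.  For \<open>F(\<nu>) = det \<langle>II(b\<^sub>i,b\<^sub>j),\<nu>\<rangle>\<close>, expand the
  determinant over permutations and integrate by parts (Wick's formula): every term is a product of
  inner products \<open>\<langle>II(b\<^sub>i,b\<^sub>j),II(b\<^sub>k,b\<^sub>l)\<rangle>\<close>, and by the signs of the permutations only the differences
  \<open>\<langle>II(b\<^sub>i,b\<^sub>j),II(b\<^sub>k,b\<^sub>l)\<rangle> - \<langle>II(b\<^sub>i,b\<^sub>l),II(b\<^sub>k,b\<^sub>j)\<rangle>\<close> contribute.  These are intrinsic by the Gauss equation: for
  a parametrization \<open>r\<close> the expression \<open>\<langle>r\<^sub>i\<^sub>k,r\<^sub>j\<^sub>l\<rangle> - \<langle>r\<^sub>j\<^sub>k,r\<^sub>i\<^sub>l\<rangle>\<close> equals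
  \<open>\<partial>\<^sub>j\<langle>r\<^sub>i\<^sub>k,r\<^sub>l\<rangle> - \<partial>\<^sub>i\<langle>r\<^sub>j\<^sub>k,r\<^sub>l\<rangle>\<close>, and \<open>\<langle>r\<^sub>i\<^sub>k,r\<^sub>l\<rangle>\<close> as well as the tangential parts of the \<open>r\<^sub>i\<^sub>k\<close> are determined by
  the metric.
\<close>

text \<open>The ambient constant \<open>unit_sphere_vol (DIM('a) - 1)\<close> enters through
  homogeneity: in the radial integrals of a function of degree m on an n-dimensional space only the
  exponent n + m occurs, and this is the dimension k of the ambient space. The Gaussian radial
  integral with exponent k is therefore the one that belongs to the constant function 1 on the whole
  ambient space, where it can be read off from the total Gaussian mass (2 pi)^(k/2) and the volume
  of the unit ball. The obstacle on the geometric side is that the isometry gives information only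
  at points of a slice \<open>V \<inter> L\<close> and in directions of \<open>L\<close>, whereas
  smoothness and derivatives live on open subsets of the ambient space. Metric identities may thus
  be differentiated along \<open>L\<close> only, which suffices because the Christoffel symbols and
  the curvature involve no other derivatives. Moreover the two normal spaces may have different
  dimensions, so directional curvatures cannot be matched normal by normal; only averages are
  compared.\<close>

no_notation Matrix.scalar_prod (infix "\<bullet>" 70)

section \<open>Iterated directional derivatives and isometric parametrizations\<close>

abbreviation dirderiv :: "'a::euclidean_space \<Rightarrow> ('a \<Rightarrow> 'b::euclidean_space) \<Rightarrow> 'a \<Rightarrow> 'b" where
  "dirderiv v f \<equiv> (\<lambda>x. frechet_derivative f (at x) v)"

lemma dirderiv_eqI: "(f has_derivative f') (at x) \<Longrightarrow> dirderiv v f x = f' v"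
  by (simp add: frechet_derivative_at[symmetric])

section \<open>Closure properties of iterated differentiability\<close>

lemma Ck_on_subset: "Ck_on r T f \<Longrightarrow> S \<subseteq> T \<Longrightarrow> Ck_on r S f"
  by (induction r arbitrary: f) (auto intro: continuous_on_subset)

lemma Ck_on_Suc_imp: "Ck_on (Suc r) S f \<Longrightarrow> Ck_on r S f"
proof (induction r arbitrary: f)
  case 0
  thus ?case
    by (auto intro!: continuous_at_imp_continuous_on differentiable_imp_continuous_within)
next
  case (Suc r)
  thus ?case by (metis Ck_on.simps(2))
qed

lemma frechet_derivative_cong_open:
  assumes "open S" "x \<in> S" "\<And>y. y \<in> S \<Longrightarrow> f y = g y"
  shows "frechet_derivative f (at x) = frechet_derivative g (at x)"
proof -
  have "(f has_derivative F) (at x) \<longleftrightarrow> (g has_derivative F) (at x)" for F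
    using assms by (metis has_derivative_transform_within_open)
  thus ?thesis by (simp add: frechet_derivative_def)
qed

text \<open>Derivative formulas such as the product rule are available only at points of
  \<open>S\<close>. Since \<open>S\<close> is open, Frechet derivatives there depend only on the
  values in \<open>S\<close>, so such formulas may be substituted under the recursion of
  \<open>Ck_on\<close>.\<close>

lemma Ck_on_cong:
  assumes "open S" "\<And>x. x \<in> S \<Longrightarrow> f x = g x" "Ck_on r S f"
  shows "Ck_on r S g"
  using assms(2,3)
proof (induction r arbitrary: f g)
  case 0
  thus ?case using continuous_on_cong by (metis Ck_on.simps(1))
next
  case (Suc r)
  have "g differentiable (at x)" if "x \<in> S" for x
  proof -
    have "(f has_derivative frechet_derivative f (at x)) (at x)"
      using Suc.prems(2) that by (simp add: frechet_derivative_works[symmetric])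
    hence "(g has_derivative frechet_derivative f (at x)) (at x)"
      using assms(1) that Suc.prems(1) by (rule has_derivative_transform_within_open)
    thus ?thesis by (auto simp: differentiable_def)
  qed
  moreover have "Ck_on r S (dirderiv v g)" for v
  proof (rule Suc.IH[of "dirderiv v f"])
    show "dirderiv v f x = dirderiv v g x" if "x \<in> S" for x
      by (rule fun_cong[OF frechet_derivative_cong_open[OF assms(1) that Suc.prems(1)]])
    show "Ck_on r S (dirderiv v f)" using Suc.prems(2) by simp
  qed
  ultimately show ?case by simp
qed

lemma Ck_on_const: "Ck_on r S (\<lambda>x. c)"
  by (induction r arbitrary: c) (auto simp: frechet_derivative_const)

lemma Ck_on_bounded_linear: "bounded_linear f \<Longrightarrow> Ck_on r S f"
proof (cases r)
  case 0
  assume "bounded_linear f" thus ?thesis using 0 by (simp add: linear_continuous_on)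
next
  case (Suc r')
  assume f: "bounded_linear f"
  have "frechet_derivative f (at x) = f" for x
    using f by (metis frechet_derivative_at bounded_linear_imp_has_derivative)
  thus ?thesis using f Suc bounded_linear_imp_differentiable by (auto simp: Ck_on_const)
qed

lemma Ck_on_add:
  assumes "open S" "Ck_on r S f" "Ck_on r S g"
  shows "Ck_on r S (\<lambda>x. f x + g x)"
  using assms(2,3)
proof (induction r arbitrary: f g)
  case (Suc r)
  have "Ck_on r S (dirderiv v (\<lambda>x. f x + g x))" for v
  proof (rule Ck_on_cong[OF assms(1) _ Suc.IH])
    show "dirderiv v f x + dirderiv v g x = dirderiv v (\<lambda>x. f x + g x) x" if "x \<in> S" for x
      using Suc.prems that by (intro dirderiv_eqI[symmetric] has_derivative_add)
        (auto simp: frechet_derivative_works[symmetric])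
  qed (use Suc.prems in auto)
  thus ?case using Suc.prems by auto
qed (auto intro: continuous_intros)

lemma Ck_on_scaleR:
  fixes f :: "'a::euclidean_space \<Rightarrow> real" and g :: "'a \<Rightarrow> 'b::euclidean_space"
  assumes "open S" "Ck_on r S f" "Ck_on r S g"
  shows "Ck_on r S (\<lambda>x. f x *\<^sub>R g x)"
  using assms(2,3)
proof (induction r arbitrary: f g)
  case (Suc r)
  have "Ck_on r S (dirderiv v (\<lambda>x. f x *\<^sub>R g x))" for v
  proof (rule Ck_on_cong[OF assms(1) _ Ck_on_add[OF assms(1) Suc.IH Suc.IH]])
    show "f x *\<^sub>R dirderiv v g x + dirderiv v f x *\<^sub>R g x = dirderiv v (\<lambda>x. f x *\<^sub>R g x) x"
      if "x \<in> S" for x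
      using Suc.prems that by (intro dirderiv_eqI[symmetric] has_derivative_scaleR)
        (auto simp: frechet_derivative_works[symmetric])
  qed (use Suc.prems Ck_on_Suc_imp in auto)
  thus ?case using Suc.prems by auto
qed (auto intro: continuous_intros)

lemma Ck_on_sum:
  assumes "open S" "\<And>i. i \<in> I \<Longrightarrow> Ck_on r S (f i)"
  shows "Ck_on r S (\<lambda>x. \<Sum>i\<in>I. f i x)"
  using assms(2)
proof (induction I rule: infinite_finite_induct)
  case (insert i I)
  have "Ck_on r S (\<lambda>x. f i x + (\<Sum>i\<in>I. f i x))"
    using insert.prems by (intro Ck_on_add[OF assms(1)] insert.IH) auto
  thus ?case using insert.hyps by simp
qed (simp_all add: Ck_on_const)

lemma Ck_on_linear_comp:
  assumes "open S" "bounded_linear l" "Ck_on r S f"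
  shows "Ck_on r S (\<lambda>x. l (f x))"
  using assms(3)
proof (induction r arbitrary: f)
  case 0
  thus ?case using bounded_linear.continuous_on[OF assms(2)] by simp
next
  case (Suc r)
  have der: "((\<lambda>x. l (f x)) has_derivative (\<lambda>v. l (dirderiv v f x))) (at x)" if "x \<in> S" for x
    using Suc.prems that
    by (intro bounded_linear.has_derivative[OF assms(2)]) (auto simp: frechet_derivative_works[symmetric])
  have "Ck_on r S (dirderiv v (\<lambda>x. l (f x)))" for v
    by (rule Ck_on_cong[OF assms(1) _ Suc.IH[of "dirderiv v f"]])
       (use Suc.prems in \<open>auto simp: dirderiv_eqI[OF der]\<close>)
  thus ?case using der by (auto simp: differentiable_def)
qed

text \<open>\<open>Ck_on\<close> controls derivatives in fixed directions. A derivative in a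
  direction that varies with the point is reduced to these by this expansion, the coordinates of the
  direction becoming scalar factors.\<close>

lemma dirderiv_sum_Basis:
  fixes f :: "'a::euclidean_space \<Rightarrow> 'b::euclidean_space"
  assumes "f differentiable (at x)"
  shows "dirderiv v f x = (\<Sum>i\<in>Basis. (v \<bullet> i) *\<^sub>R dirderiv i f x)"
proof -
  have l: "linear (frechet_derivative f (at x))"
    using assms by (rule linear_frechet_derivative)
  have "dirderiv v f x = frechet_derivative f (at x) (\<Sum>i\<in>Basis. (v \<bullet> i) *\<^sub>R i)"
    by (simp add: euclidean_representation)
  also have "\<dots> = (\<Sum>i\<in>Basis. (v \<bullet> i) *\<^sub>R dirderiv i f x)"
    by (simp add: linear_sum[OF l] linear_scale[OF l])
  finally show ?thesis .
qed

lemma dirderiv_compose: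
  assumes "f differentiable (at (g x))" "g differentiable (at x)"
  shows "dirderiv v (\<lambda>x. f (g x)) x = frechet_derivative f (at (g x)) (dirderiv v g x)"
  using frechet_derivative_compose[OF assms(2,1)] by (simp add: o_def)

text \<open>By the chain rule the derivative of the composite is that of \<open>f\<close> in the
  moving direction \<open>dirderiv v g x\<close>. Its basis expansion is a sum of products of a
  derivative of \<open>g\<close> with a composite of \<open>g\<close> and a derivative of
  \<open>f\<close>, both covered at order \<open>r\<close>, so closure under sums and products
  completes the induction.\<close>

lemma Ck_on_compose:
  fixes g :: "'a::euclidean_space \<Rightarrow> 'b::euclidean_space" and f :: "'b \<Rightarrow> 'c::euclidean_space"
  assumes "open S" "open T" "g ` S \<subseteq> T" "Ck_on r S g" "Ck_on r T f"
  shows "Ck_on r S (\<lambda>x. f (g x))"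
  using assms(4,5)
proof (induction r arbitrary: f)
  case 0
  thus ?case using assms(3) by (auto intro: continuous_on_compose2)
next
  case (Suc r)
  have diff: "f differentiable (at (g x))" "g differentiable (at x)" if "x \<in> S" for x
    using Suc.prems assms(3) that by auto
  have "Ck_on r S (dirderiv v (\<lambda>x. f (g x)))" for v
  proof (rule Ck_on_cong[OF assms(1)])
    show "(\<Sum>i\<in>Basis. (dirderiv v g x \<bullet> i) *\<^sub>R dirderiv i f (g x)) = dirderiv v (\<lambda>x. f (g x)) x"
      if "x \<in> S" for x
      using diff[OF that] by (simp add: dirderiv_compose dirderiv_sum_Basis[symmetric])
    show "Ck_on r S (\<lambda>x. \<Sum>i\<in>Basis. (dirderiv v g x \<bullet> i) *\<^sub>R dirderiv i f (g x))"
    proof (rule Ck_on_sum[OF assms(1)], rule Ck_on_scaleR[OF assms(1)])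
      show "Ck_on r S (\<lambda>x. dirderiv v g x \<bullet> i)" for i
        using Suc.prems(1) by (intro Ck_on_linear_comp[OF assms(1) bounded_linear_inner_left]) simp
      show "Ck_on r S (\<lambda>x. dirderiv i f (g x))" for i
        using Suc.prems(2) by (intro Suc.IH Ck_on_Suc_imp[OF Suc.prems(1)]) simp
    qed
  qed
  moreover have "(\<lambda>x. f (g x)) differentiable (at x)" if "x \<in> S" for x
    using differentiable_chain_at[OF diff(2,1)] that by (simp add: o_def)
  ultimately show ?case by simp
qed

lemma smooth_on_subset: "smooth_on T f \<Longrightarrow> S \<subseteq> T \<Longrightarrow> smooth_on S f"
  unfolding smooth_on_def by (blast intro: Ck_on_subset)

lemma smooth_on_dirderiv: "smooth_on S f \<Longrightarrow> smooth_on S (dirderiv v f)"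
  unfolding smooth_on_def by (metis Ck_on.simps(2))

lemma smooth_on_imp_differentiable: "smooth_on S f \<Longrightarrow> x \<in> S \<Longrightarrow> f differentiable (at x)"
  unfolding smooth_on_def by (metis Ck_on.simps(2))

lemma smooth_on_imp_has_derivative:
  "smooth_on S f \<Longrightarrow> x \<in> S \<Longrightarrow> (f has_derivative frechet_derivative f (at x)) (at x)"
  using smooth_on_imp_differentiable frechet_derivative_works by blast

lemma smooth_on_imp_continuous_on: "smooth_on S f \<Longrightarrow> continuous_on S f"
  unfolding smooth_on_def by (metis Ck_on.simps(1))

lemma smooth_on_bounded_linear: "bounded_linear f \<Longrightarrow> smooth_on S f"
  unfolding smooth_on_def by (blast intro: Ck_on_bounded_linear)

lemma smooth_on_const: "smooth_on S (\<lambda>x. c)"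
  unfolding smooth_on_def by (blast intro: Ck_on_const)

lemma smooth_on_add:
  "open S \<Longrightarrow> smooth_on S f \<Longrightarrow> smooth_on S g \<Longrightarrow> smooth_on S (\<lambda>x. f x + g x)"
  unfolding smooth_on_def by (blast intro: Ck_on_add)

lemma smooth_on_compose:
  "open S \<Longrightarrow> open T \<Longrightarrow> g ` S \<subseteq> T \<Longrightarrow> smooth_on S g \<Longrightarrow> smooth_on T f \<Longrightarrow> smooth_on S (\<lambda>x. f (g x))"
  unfolding smooth_on_def by (blast intro: Ck_on_compose)

lemma smooth_on_inner_left: "open S \<Longrightarrow> smooth_on S f \<Longrightarrow> smooth_on S (\<lambda>x. f x \<bullet> c)"
  unfolding smooth_on_def by (blast intro: Ck_on_linear_comp[OF _ bounded_linear_inner_left])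

lemma linear_dirderiv:
  assumes "smooth_on S f" "x \<in> S"
  shows "linear (\<lambda>v. dirderiv v f x)"
  using smooth_on_imp_differentiable[OF assms] by (rule linear_frechet_derivative)

text \<open>Linearity in the inner direction concerns functions that are differentiated once more,
  so it is used on a neighbourhood of \<open>x\<close>. It later yields linearity of the second
  fundamental form in its second argument.\<close>

lemma linear_dirderiv_direction:
  assumes "smooth_on S f" "open S" "x \<in> S"
  shows "linear (\<lambda>v. dirderiv u (dirderiv v f) x)"
proof (rule linearI)
  fix v w c
  have lin: "linear (\<lambda>v. dirderiv v f y)" if "y \<in> S" for y
    using assms(1) that by (rule linear_dirderiv)
  have 1: "((\<lambda>x. dirderiv v f x + dirderiv w f x) has_derivative
      (\<lambda>u. dirderiv u (dirderiv v f) x + dirderiv u (dirderiv w f) x)) (at x)"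
    by (intro has_derivative_add smooth_on_imp_has_derivative[OF smooth_on_dirderiv[OF assms(1)] assms(3)])
  have "dirderiv u (dirderiv (v + w) f) x = dirderiv u (\<lambda>x. dirderiv v f x + dirderiv w f x) x"
    by (intro fun_cong[OF frechet_derivative_cong_open[OF assms(2,3)]]) (simp add: linear_add[OF lin])
  thus "dirderiv u (dirderiv (v + w) f) x = dirderiv u (dirderiv v f) x + dirderiv u (dirderiv w f) x"
    using dirderiv_eqI[OF 1] by simp
  have 2: "((\<lambda>x. c *\<^sub>R dirderiv v f x) has_derivative (\<lambda>u. c *\<^sub>R dirderiv u (dirderiv v f) x)) (at x)"
    by (intro has_derivative_scaleR_right smooth_on_imp_has_derivative[OF smooth_on_dirderiv[OF assms(1)] assms(3)])
  have "dirderiv u (dirderiv (c *\<^sub>R v) f) x = dirderiv u (\<lambda>x. c *\<^sub>R dirderiv v f x) x"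
    by (intro fun_cong[OF frechet_derivative_cong_open[OF assms(2,3)]]) (simp add: linear_scale[OF lin])
  thus "dirderiv u (dirderiv (c *\<^sub>R v) f) x = c *\<^sub>R dirderiv u (dirderiv v f) x"
    using dirderiv_eqI[OF 2] by simp
qed

section \<open>Symmetry of second derivatives\<close>

lemma has_real_derivative_along_line:
  fixes f :: "'a::euclidean_space \<Rightarrow> real"
  assumes "f differentiable (at (x + t *\<^sub>R v))"
  shows "((\<lambda>t. f (x + t *\<^sub>R v)) has_real_derivative dirderiv v f (x + t *\<^sub>R v)) (at t)"
proof -
  have "((\<lambda>t. x + t *\<^sub>R v) has_derivative (\<lambda>s. s *\<^sub>R v)) (at t)"
    by (auto intro!: derivative_eq_intros)
  from has_derivative_compose[OF this assms[unfolded frechet_derivative_works]]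
  have "((\<lambda>t. f (x + t *\<^sub>R v)) has_derivative (\<lambda>s. frechet_derivative f (at (x + t *\<^sub>R v)) (s *\<^sub>R v))) (at t)" .
  moreover have "(\<lambda>s. frechet_derivative f (at (x + t *\<^sub>R v)) (s *\<^sub>R v)) = (*) (dirderiv v f (x + t *\<^sub>R v))"
    by (auto simp: linear_scale[OF linear_frechet_derivative[OF assms]])
  ultimately show ?thesis by (simp add: has_field_derivative_def)
qed

text \<open>Two applications of the mean value theorem: in direction \<open>u\<close> to the
  difference of \<open>f\<close> across the side \<open>s *\<^sub>R v\<close>, then in direction
  \<open>v\<close> to the resulting derivative. The left-hand side is symmetric in \<open>u\<close>
  and \<open>v\<close>, while the right-hand side carries an order of differentiation.\<close>

lemma second_difference_mean_value:
  fixes f :: "'a::euclidean_space \<Rightarrow> real"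
  assumes f: "smooth_on S f" and s: "s > 0"
    and S: "\<And>a b. 0 \<le> a \<Longrightarrow> a \<le> s \<Longrightarrow> 0 \<le> b \<Longrightarrow> b \<le> s \<Longrightarrow> x + a *\<^sub>R u + b *\<^sub>R v \<in> S"
  obtains a b where "0 \<le> a" "a \<le> s" "0 \<le> b" "b \<le> s"
    "f (x + s *\<^sub>R u + s *\<^sub>R v) - f (x + s *\<^sub>R u) - f (x + s *\<^sub>R v) + f x =
       s\<^sup>2 * dirderiv v (dirderiv u f) (x + a *\<^sub>R u + b *\<^sub>R v)"
proof -
  define g where "g a = f ((x + s *\<^sub>R v) + a *\<^sub>R u) - f (x + a *\<^sub>R u)" for a
  have eq: "(x + b *\<^sub>R v) + a *\<^sub>R u = x + a *\<^sub>R u + b *\<^sub>R v" for a b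
    by (simp add: algebra_simps)
  have S0: "x + a *\<^sub>R u \<in> S" if "0 \<le> a" "a \<le> s" for a
    using S[of a 0] that s by simp
  have dg: "(g has_real_derivative (dirderiv u f ((x + s *\<^sub>R v) + a *\<^sub>R u) - dirderiv u f (x + a *\<^sub>R u))) (at a)"
    if "0 \<le> a" "a \<le> s" for a
    unfolding g_def using that s S[of a s] S0[of a]
    by (intro DERIV_diff has_real_derivative_along_line smooth_on_imp_differentiable[OF f])
      (auto simp: eq)
  obtain a where a: "0 < a" "a < s"
    "g s - g 0 = (s - 0) * (dirderiv u f ((x + s *\<^sub>R v) + a *\<^sub>R u) - dirderiv u f (x + a *\<^sub>R u))"
    using MVT2[OF s dg] by blast
  have dh: "((\<lambda>b. dirderiv u f (x + a *\<^sub>R u + b *\<^sub>R v)) has_real_derivative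
      dirderiv v (dirderiv u f) (x + a *\<^sub>R u + b *\<^sub>R v)) (at b)" if "0 \<le> b" "b \<le> s" for b
    using a that S[of a b]
    by (intro has_real_derivative_along_line smooth_on_imp_differentiable[OF smooth_on_dirderiv[OF f]]) auto
  obtain b where b: "0 < b" "b < s"
    "dirderiv u f (x + a *\<^sub>R u + s *\<^sub>R v) - dirderiv u f (x + a *\<^sub>R u + 0 *\<^sub>R v) =
      (s - 0) * dirderiv v (dirderiv u f) (x + a *\<^sub>R u + b *\<^sub>R v)"
    using MVT2[OF s dh] by blast
  show thesis
    by (rule that[of a b]) (use a b in \<open>auto simp: g_def eq power2_eq_square\<close>)
qed

text \<open>Schwarz's theorem: one and the same second difference over a small parallelogram equals
  \<open>s\<^sup>2\<close> times either mixed derivative at some point of it, and both mixed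
  derivatives are continuous.\<close>

lemma dirderiv_commute_real:
  fixes f :: "'a::euclidean_space \<Rightarrow> real"
  assumes f: "smooth_on S f" and S: "open S" "x \<in> S"
  shows "dirderiv u (dirderiv v f) x = dirderiv v (dirderiv u f) x"
proof (rule ccontr)
  assume ne: "\<not> ?thesis"
  define e where "e = \<bar>dirderiv u (dirderiv v f) x - dirderiv v (dirderiv u f) x\<bar> / 2"
  have e: "e > 0" using ne by (simp add: e_def)
  have cont: "\<exists>d>0. \<forall>y. dist y x < d \<longrightarrow> \<bar>dirderiv a (dirderiv b f) y - dirderiv a (dirderiv b f) x\<bar> < e" for a b
  proof -
    have "isCont (dirderiv a (dirderiv b f)) x"
      using S smooth_on_imp_continuous_on[OF smooth_on_dirderiv[OF smooth_on_dirderiv[OF f]]]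
      by (metis continuous_on_eq_continuous_at)
    thus ?thesis using e unfolding continuous_at_eps_delta dist_real_def by blast
  qed
  obtain d1 where d1: "d1 > 0" "\<And>y. dist y x < d1 \<Longrightarrow> \<bar>dirderiv u (dirderiv v f) y - dirderiv u (dirderiv v f) x\<bar> < e"
    using cont by blast
  obtain d2 where d2: "d2 > 0" "\<And>y. dist y x < d2 \<Longrightarrow> \<bar>dirderiv v (dirderiv u f) y - dirderiv v (dirderiv u f) x\<bar> < e"
    using cont by blast
  obtain d3 where d3: "d3 > 0" "ball x d3 \<subseteq> S" using S open_contains_ball by blast
  define d where "d = min d1 (min d2 d3)"
  \<comment> \<open>The side length keeps the whole parallelogram within distance \<open>d\<close>
    of \<open>x\<close>; the summand 1 covers the case that both directions vanish.\<close>
  define s where "s = d / (2 * (norm u + norm v + 1))"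
  have d: "d > 0" using d1 d2 d3 by (simp add: d_def)
  hence s: "s > 0" using d by (auto simp: s_def intro!: divide_pos_pos add_nonneg_pos)
  have near: "dist (x + a *\<^sub>R u + b *\<^sub>R v) x < d" if "0 \<le> a" "a \<le> s" "0 \<le> b" "b \<le> s" for a b
  proof -
    have "dist (x + a *\<^sub>R u + b *\<^sub>R v) x = norm (a *\<^sub>R u + b *\<^sub>R v)"
      by (simp add: dist_norm algebra_simps)
    also have "\<dots> \<le> a * norm u + b * norm v"
      using norm_triangle_ineq[of "a *\<^sub>R u" "b *\<^sub>R v"] that by simp
    also have "\<dots> \<le> s * norm u + s * norm v"
      using that by (intro add_mono mult_right_mono) auto
    also have "\<dots> < s * (2 * (norm u + norm v + 1))"
      using s by (simp add: algebra_simps add_nonneg_pos add_pos_nonneg)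
    also have "\<dots> = d" using d
      by (simp add: s_def add_nonneg_pos less_imp_neq[THEN not_sym])
    finally show ?thesis .
  qed
  have inS: "x + a *\<^sub>R u + b *\<^sub>R v \<in> S" if "0 \<le> a" "a \<le> s" "0 \<le> b" "b \<le> s" for a b
    using near[OF that] d3 by (auto simp: d_def dist_commute)
  have inS': "x + a *\<^sub>R v + b *\<^sub>R u \<in> S" if "0 \<le> a" "a \<le> s" "0 \<le> b" "b \<le> s" for a b
    using inS[of b a] that by (simp add: algebra_simps)
  obtain a b where ab: "0 \<le> a" "a \<le> s" "0 \<le> b" "b \<le> s"
    "f (x + s *\<^sub>R u + s *\<^sub>R v) - f (x + s *\<^sub>R u) - f (x + s *\<^sub>R v) + f x =
       s\<^sup>2 * dirderiv v (dirderiv u f) (x + a *\<^sub>R u + b *\<^sub>R v)"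
    using second_difference_mean_value[OF f s inS] by blast
  obtain a' b' where ab': "0 \<le> a'" "a' \<le> s" "0 \<le> b'" "b' \<le> s"
    "f (x + s *\<^sub>R v + s *\<^sub>R u) - f (x + s *\<^sub>R v) - f (x + s *\<^sub>R u) + f x =
       s\<^sup>2 * dirderiv u (dirderiv v f) (x + a' *\<^sub>R v + b' *\<^sub>R u)"
    using second_difference_mean_value[OF f s inS'] by blast
  have sw: "x + s *\<^sub>R v + s *\<^sub>R u = x + s *\<^sub>R u + s *\<^sub>R v" "x + a' *\<^sub>R v + b' *\<^sub>R u = x + b' *\<^sub>R u + a' *\<^sub>R v"
    by (simp_all add: algebra_simps)
  have "s\<^sup>2 * dirderiv v (dirderiv u f) (x + a *\<^sub>R u + b *\<^sub>R v) = s\<^sup>2 * dirderiv u (dirderiv v f) (x + b' *\<^sub>R u + a' *\<^sub>R v)"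
    using ab(5) ab'(5) unfolding sw by linarith
  hence "dirderiv v (dirderiv u f) (x + a *\<^sub>R u + b *\<^sub>R v) = dirderiv u (dirderiv v f) (x + b' *\<^sub>R u + a' *\<^sub>R v)"
    using s by simp
  moreover have "\<bar>dirderiv v (dirderiv u f) (x + a *\<^sub>R u + b *\<^sub>R v) - dirderiv v (dirderiv u f) x\<bar> < e"
    using near ab by (intro d2(2)) (auto simp: d_def)
  moreover have "\<bar>dirderiv u (dirderiv v f) (x + b' *\<^sub>R u + a' *\<^sub>R v) - dirderiv u (dirderiv v f) x\<bar> < e"
    using near ab' by (intro d1(2)) (auto simp: d_def)
  ultimately show False unfolding e_def by (auto simp: abs_if field_simps split: if_splits)
qed

lemma dirderiv_inner_left:
  assumes "f differentiable (at x)"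
  shows "dirderiv v (\<lambda>x. f x \<bullet> c) x = dirderiv v f x \<bullet> c"
  using assms by (intro dirderiv_eqI has_derivative_inner_left) (simp add: frechet_derivative_works[symmetric])

lemma dirderiv_commute:
  fixes f :: "'a::euclidean_space \<Rightarrow> 'b::euclidean_space"
  assumes f: "smooth_on S f" and S: "open S" "x \<in> S"
  shows "dirderiv u (dirderiv v f) x = dirderiv v (dirderiv u f) x"
proof (rule euclidean_eqI)
  fix c :: 'b
  have "dirderiv u (dirderiv v f) x \<bullet> c = dirderiv u (dirderiv v (\<lambda>x. f x \<bullet> c)) x" for u v
  proof -
    have "dirderiv u (dirderiv v (\<lambda>x. f x \<bullet> c)) x = dirderiv u (\<lambda>x. dirderiv v f x \<bullet> c) x"
      using dirderiv_inner_left[OF smooth_on_imp_differentiable[OF f]]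
      by (intro fun_cong[OF frechet_derivative_cong_open[OF S]])
    also have "\<dots> = dirderiv u (dirderiv v f) x \<bullet> c"
      using S(2) by (intro dirderiv_inner_left smooth_on_imp_differentiable[OF smooth_on_dirderiv[OF f]])
    finally show ?thesis by simp
  qed
  thus "dirderiv u (dirderiv v f) x \<bullet> c = dirderiv v (dirderiv u f) x \<bullet> c"
    using dirderiv_commute_real[OF smooth_on_inner_left[OF S(1) f] S] by metis
qed

section \<open>Derivatives of the metric coefficients\<close>

lemma dirderiv_inner:
  fixes f g :: "'a::euclidean_space \<Rightarrow> 'b::euclidean_space"
  assumes "f differentiable (at x)" "g differentiable (at x)"
  shows "dirderiv v (\<lambda>x. f x \<bullet> g x) x = dirderiv v f x \<bullet> g x + f x \<bullet> dirderiv v g x"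
    and "(\<lambda>x. f x \<bullet> g x) differentiable (at x)"
proof -
  have "((\<lambda>x. f x \<bullet> g x) has_derivative (\<lambda>v. f x \<bullet> dirderiv v g x + dirderiv v f x \<bullet> g x)) (at x)"
    using assms by (intro has_derivative_inner) (simp_all add: frechet_derivative_works[symmetric])
  thus "dirderiv v (\<lambda>x. f x \<bullet> g x) x = dirderiv v f x \<bullet> g x + f x \<bullet> dirderiv v g x"
    "(\<lambda>x. f x \<bullet> g x) differentiable (at x)"
    using dirderiv_eqI by (fastforce, auto simp: differentiable_def)
qed

text \<open>Agreement on the slice says nothing about transversal derivatives. The line
  \<open>x + t *\<^sub>R w\<close>, however, stays in \<open>L\<close>, and in \<open>S\<close> for
  small t, so the derivatives along it coincide.\<close>

lemma dirderiv_eq_on_subspace: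
  fixes f g :: "'a::euclidean_space \<Rightarrow> real"
  assumes "subspace L" "open S" "x \<in> S \<inter> L" "w \<in> L"
    and "f differentiable (at x)" "g differentiable (at x)"
    and eq: "\<And>y. y \<in> S \<inter> L \<Longrightarrow> f y = g y"
  shows "dirderiv w f x = dirderiv w g x"
proof -
  have f: "((\<lambda>t. f (x + t *\<^sub>R w)) has_real_derivative dirderiv w f x) (at 0)"
    and g: "((\<lambda>t. g (x + t *\<^sub>R w)) has_real_derivative dirderiv w g x) (at 0)"
    using has_real_derivative_along_line[of f x 0 w] has_real_derivative_along_line[of g x 0 w] assms by simp_all
  have op: "open ((\<lambda>t::real. x + t *\<^sub>R w) -` S)"
    using assms(2) by (intro continuous_open_vimage continuous_intros) auto
  have z: "0 \<in> (\<lambda>t::real. x + t *\<^sub>R w) -` S" using assms by simp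
  have e: "f (x + t *\<^sub>R w) = g (x + t *\<^sub>R w)" if "t \<in> (\<lambda>t::real. x + t *\<^sub>R w) -` S" for t
    using that assms(3,4) by (intro eq IntI subspace_add[OF assms(1)] subspace_scale[OF assms(1)]) simp_all
  have "((\<lambda>t. g (x + t *\<^sub>R w)) has_real_derivative dirderiv w f x) (at 0)"
    unfolding has_field_derivative_def
    by (rule has_derivative_transform_within_open[OF f[unfolded has_field_derivative_def] op z e])
  thus ?thesis using g by (rule DERIV_unique)
qed

text \<open>The parametrizations proper are the restrictions to \<open>V \<inter> L\<close>. Keeping
  the maps on an open set \<open>V\<close> of the surrounding space makes the ordinary Frechet
  calculus available, at the price that the metric equality is confined to the slice and to
  directions of \<open>L\<close>.\<close>

locale isometric_parametrizations =
  fixes V L :: "'c::euclidean_space set" and r :: "'c \<Rightarrow> 'a::euclidean_space" and r' :: "'c \<Rightarrow> 'b::euclidean_space"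
  assumes open_V: "open V" and subspace_L: "subspace L"
    and smooth_r: "smooth_on V r" and smooth_r': "smooth_on V r'"
    and metric_eq: "\<And>x u v. x \<in> V \<inter> L \<Longrightarrow> u \<in> L \<Longrightarrow> v \<in> L \<Longrightarrow>
      dirderiv u r x \<bullet> dirderiv v r x = dirderiv u r' x \<bullet> dirderiv v r' x"
begin

text \<open>Expand each term on the right by the product rule; by symmetry of second derivatives all
  terms cancel except two equal ones. The formula expresses the Christoffel symbols of the first
  kind by derivatives of the metric coefficients.\<close>

lemma Koszul:
  fixes f :: "'c \<Rightarrow> 'd::euclidean_space"
  assumes "smooth_on V f" "x \<in> V"
  shows "dirderiv u (dirderiv v f) x \<bullet> dirderiv w f x =
    (dirderiv u (\<lambda>x. dirderiv v f x \<bullet> dirderiv w f x) x + dirderiv v (\<lambda>x. dirderiv u f x \<bullet> dirderiv w f x) x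
     - dirderiv w (\<lambda>x. dirderiv u f x \<bullet> dirderiv v f x) x) / 2"
proof -
  have d: "dirderiv v f differentiable (at x)" for v
    using assms smooth_on_dirderiv smooth_on_imp_differentiable by blast
  have c: "dirderiv u (dirderiv v f) x = dirderiv v (dirderiv u f) x" for u v
    using dirderiv_commute[OF assms(1) open_V assms(2)] .
  show ?thesis
    unfolding dirderiv_inner(1)[OF d d] c[of v u] c[of w u] c[of w v]
    by (simp add: inner_commute algebra_simps)
qed

lemma christoffel_eq:
  assumes x: "x \<in> V \<inter> L" and uvw: "u \<in> L" "v \<in> L" "w \<in> L"
  shows "dirderiv u (dirderiv v r) x \<bullet> dirderiv w r x = dirderiv u (dirderiv v r') x \<bullet> dirderiv w r' x"
proof -
  have d: "dirderiv v r differentiable (at x)" "dirderiv v r' differentiable (at x)" for v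
    using x smooth_r smooth_r' smooth_on_dirderiv smooth_on_imp_differentiable by blast+
  have D: "dirderiv w (\<lambda>x. dirderiv u r x \<bullet> dirderiv v r x) x = dirderiv w (\<lambda>x. dirderiv u r' x \<bullet> dirderiv v r' x) x"
    if "u \<in> L" "v \<in> L" "w \<in> L" for u v w
    by (rule dirderiv_eq_on_subspace[OF subspace_L open_V x that(3)])
      (use that metric_eq dirderiv_inner(2)[OF d(1) d(1)] dirderiv_inner(2)[OF d(2) d(2)] in auto)
  show ?thesis
    unfolding Koszul[OF smooth_r IntD1[OF x]] Koszul[OF smooth_r' IntD1[OF x]] using D uvw by simp
qed

text \<open>The product rule on the right produces two third-order terms, which cancel because
  derivatives commute.\<close>

lemma curvature_identity:
  fixes f :: "'c \<Rightarrow> 'd::euclidean_space"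
  assumes "smooth_on V f" "x \<in> V"
  shows "dirderiv i (dirderiv k f) x \<bullet> dirderiv j (dirderiv l f) x
      - dirderiv j (dirderiv k f) x \<bullet> dirderiv i (dirderiv l f) x =
    dirderiv j (\<lambda>x. dirderiv i (dirderiv k f) x \<bullet> dirderiv l f x) x
      - dirderiv i (\<lambda>x. dirderiv j (dirderiv k f) x \<bullet> dirderiv l f x) x"
proof -
  have d: "dirderiv v f differentiable (at x)" "dirderiv u (dirderiv v f) differentiable (at x)" for u v
    using assms smooth_on_dirderiv smooth_on_imp_differentiable by blast+
  have "dirderiv j (dirderiv i (dirderiv k f)) x = dirderiv i (dirderiv j (dirderiv k f)) x"
    using dirderiv_commute[OF smooth_on_dirderiv[OF assms(1)] open_V assms(2)] .
  thus ?thesis unfolding dirderiv_inner(1)[OF d(2) d(1)] by simp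
qed

text \<open>The right-hand side of \<open>curvature_identity\<close> differentiates Christoffel
  symbols in directions of \<open>L\<close>, where \<open>christoffel_eq\<close> makes them agree.
  The products still contain the tangential parts of the second derivatives, which the Gauss
  equation removes.\<close>

lemma curvature_eq:
  assumes x: "x \<in> V \<inter> L" and ijkl: "i \<in> L" "j \<in> L" "k \<in> L" "l \<in> L"
  shows "dirderiv i (dirderiv k r) x \<bullet> dirderiv j (dirderiv l r) x
      - dirderiv j (dirderiv k r) x \<bullet> dirderiv i (dirderiv l r) x =
    dirderiv i (dirderiv k r') x \<bullet> dirderiv j (dirderiv l r') x
      - dirderiv j (dirderiv k r') x \<bullet> dirderiv i (dirderiv l r') x"
proof -
  have d: "(\<lambda>x. dirderiv u (dirderiv v r) x \<bullet> dirderiv w r x) differentiable (at x)"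
     "(\<lambda>x. dirderiv u (dirderiv v r') x \<bullet> dirderiv w r' x) differentiable (at x)" for u v w
    using x smooth_r smooth_r' by (intro dirderiv_inner smooth_on_imp_differentiable[of V] smooth_on_dirderiv; simp)+
  have D: "dirderiv w (\<lambda>x. dirderiv u (dirderiv v r) x \<bullet> dirderiv y r x) x =
      dirderiv w (\<lambda>x. dirderiv u (dirderiv v r') x \<bullet> dirderiv y r' x) x"
    if "u \<in> L" "v \<in> L" "w \<in> L" "y \<in> L" for u v w y
    by (rule dirderiv_eq_on_subspace[OF subspace_L open_V x that(3) d]) (use that christoffel_eq in auto)
  show ?thesis
    unfolding curvature_identity[OF smooth_r IntD1[OF x]] curvature_identity[OF smooth_r' IntD1[OF x]]
    using D ijkl by simp
qed

end

section \<open>Tangent spaces and second fundamental forms in slice charts\<close>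

text \<open>A vector orthogonal to \<open>L\<close> annihilates the curve and hence its derivative.
  So the derivative lies in the double orthogonal complement, which is \<open>L\<close>
  again.\<close>

lemma vector_derivative_in_subspace:
  fixes c :: "real \<Rightarrow> 'a::euclidean_space"
  assumes "subspace L" "(c has_vector_derivative v) (at t)" "open T" "t \<in> T" "\<And>s. s \<in> T \<Longrightarrow> c s \<in> L"
  shows "v \<in> L"
proof -
  have "v \<bullet> w = 0" if w: "w \<in> L\<^sup>\<bottom>" for w
  proof -
    have "((\<lambda>s. c s \<bullet> w) has_vector_derivative v \<bullet> w) (at t)"
      using assms(2) by (rule bounded_linear.has_vector_derivative[OF bounded_linear_inner_left])
    moreover have "((\<lambda>s. c s \<bullet> w) has_vector_derivative 0) (at t)"
      by (rule has_vector_derivative_transform_within_open[OF has_vector_derivative_const[of 0] assms(3,4)])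
         (use w assms(5) in \<open>auto simp: orthogonal_comp_def orthogonal_def\<close>)
    ultimately show ?thesis by (rule vector_derivative_unique_at)
  qed
  hence "v \<in> L\<^sup>\<bottom>\<^sup>\<bottom>" by (auto simp: orthogonal_comp_def orthogonal_def inner_commute)
  thus ?thesis using assms(1) by (simp add: orthogonal_comp_self)
qed

lemma has_vector_derivative_compose:
  assumes "(f has_derivative f') (at (c t))" "(c has_vector_derivative v) (at t)"
  shows "((\<lambda>t. f (c t)) has_vector_derivative f' v) (at t)"
proof -
  have "((f \<circ> c) has_vector_derivative f' v) (at t)"
    by (rule vector_derivative_diff_chain_within[OF assms(2)]) (use assms(1) has_derivative_at_withinI in blast)
  thus ?thesis by (simp add: o_def)
qed

lemma tangent_spaceI:
  fixes \<gamma> :: "real \<Rightarrow> 'a::euclidean_space"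
  assumes "open T" "0 \<in> T" "smooth_on T \<gamma>" "\<gamma> ` T \<subseteq> M" "(\<gamma> has_vector_derivative v) (at 0)"
  shows "v \<in> tangent_space M (\<gamma> 0)"
proof -
  obtain e where e: "e > 0" "ball 0 e \<subseteq> T" using assms(1,2) open_contains_ball by blast
  hence sub: "{-e<..<e} \<subseteq> T" by (auto simp: subset_iff dist_real_def)
  show ?thesis unfolding tangent_space_def
    using e(1) smooth_on_subset[OF assms(3) sub] sub assms(4,5) by blast
qed

lemma has_vector_derivative_line: "((\<lambda>t. x + t *\<^sub>R a) has_vector_derivative a) (at t)"
  by (auto intro!: derivative_eq_intros)

lemma open_vimage_line:
  fixes V :: "'a::real_normed_vector set"
  shows "open V \<Longrightarrow> open {t::real. x + t *\<^sub>R a \<in> V}"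
  by (intro continuous_open_vimage[of V "\<lambda>t::real. x + t *\<^sub>R a", unfolded vimage_def]) (auto intro!: continuous_intros)

lemma smooth_on_line: "smooth_on T (\<lambda>t::real. x + t *\<^sub>R a)" if "open T" for T
  by (intro smooth_on_add that smooth_on_const smooth_on_bounded_linear bounded_linear_scaleR_left)

lemma dirderiv_in_tangent_space:
  assumes r: "smooth_on V r" and V: "open V" and L: "subspace L" and x: "x \<in> V \<inter> L" and a: "a \<in> L"
    and M: "r ` (V \<inter> L) \<subseteq> M"
  shows "dirderiv a r x \<in> tangent_space M (r x)"
proof -
  let ?T = "{t::real. x + t *\<^sub>R a \<in> V}"
  have T: "open ?T" using V by (rule open_vimage_line)
  have "dirderiv a r x \<in> tangent_space M (r (x + 0 *\<^sub>R a))"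
  proof (rule tangent_spaceI[OF T])
    show "smooth_on ?T (\<lambda>t. r (x + t *\<^sub>R a))"
      by (rule smooth_on_compose[OF T V _ smooth_on_line[OF T] r]) auto
    show "(\<lambda>t. r (x + t *\<^sub>R a)) ` ?T \<subseteq> M"
      using M x a L by (auto intro!: subspace_add subspace_scale subsetD[OF M] imageI)
    show "((\<lambda>t. r (x + t *\<^sub>R a)) has_vector_derivative dirderiv a r x) (at 0)"
      by (rule has_vector_derivative_compose[OF _ has_vector_derivative_line])
         (use smooth_on_imp_has_derivative[OF r] x in simp)
  qed (use x in simp)
  thus ?thesis by simp
qed

section \<open>Tangent spaces in a slice chart\<close>

locale slice_chart =
  fixes M U V L :: "'a::euclidean_space set" and \<Phi> \<Psi> :: "'a \<Rightarrow> 'a"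
  assumes open_U: "open U" and open_V: "open V" and smooth_\<Phi>: "smooth_on U \<Phi>" and smooth_\<Psi>: "smooth_on V \<Psi>"
    and homeo: "homeomorphism U V \<Phi> \<Psi>" and subspace_L: "subspace L" and image_slice: "\<Phi> ` (U \<inter> M) = V \<inter> L"
begin

lemma chart_simps:
  "x \<in> U \<Longrightarrow> \<Phi> x \<in> V" "x \<in> U \<Longrightarrow> \<Psi> (\<Phi> x) = x" "y \<in> V \<Longrightarrow> \<Psi> y \<in> U" "y \<in> V \<Longrightarrow> \<Phi> (\<Psi> y) = y"
  using homeo unfolding homeomorphism_def by blast+

lemma \<Psi>_in_M: "y \<in> V \<inter> L \<Longrightarrow> \<Psi> y \<in> U \<inter> M"
  using image_slice chart_simps by (metis (no_types, lifting) Int_iff imageE)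

lemma \<Phi>_in_L: "x \<in> U \<inter> M \<Longrightarrow> \<Phi> x \<in> V \<inter> L"
  using image_slice by blast

lemma dirderiv_\<Psi>_\<Phi>:
  assumes "x \<in> U"
  shows "dirderiv (dirderiv v \<Phi> x) \<Psi> (\<Phi> x) = v"
proof -
  have "dirderiv v (\<lambda>x. \<Psi> (\<Phi> x)) x = dirderiv (dirderiv v \<Phi> x) \<Psi> (\<Phi> x)"
    by (intro dirderiv_compose smooth_on_imp_differentiable[OF smooth_\<Psi>] smooth_on_imp_differentiable[OF smooth_\<Phi>]
        chart_simps(1) assms)
  moreover have "frechet_derivative (\<lambda>x. \<Psi> (\<Phi> x)) (at x) = frechet_derivative (\<lambda>x. x) (at x)"
    using assms chart_simps by (intro frechet_derivative_cong_open[OF open_U])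
  ultimately show ?thesis by simp
qed

lemma dirderiv_\<Phi>_\<Psi>:
  assumes "y \<in> V"
  shows "dirderiv (dirderiv v \<Psi> y) \<Phi> (\<Psi> y) = v"
proof -
  have "dirderiv v (\<lambda>x. \<Phi> (\<Psi> x)) y = dirderiv (dirderiv v \<Psi> y) \<Phi> (\<Psi> y)"
    by (intro dirderiv_compose smooth_on_imp_differentiable[OF smooth_\<Psi>] smooth_on_imp_differentiable[OF smooth_\<Phi>]
        chart_simps(3) assms)
  moreover have "frechet_derivative (\<lambda>x. \<Phi> (\<Psi> x)) (at y) = frechet_derivative (\<lambda>x. x) (at y)"
    using assms chart_simps by (intro frechet_derivative_cong_open[OF open_V])
  ultimately show ?thesis by simp
qed

lemma dirderiv_\<Psi>_tangent: "y \<in> V \<inter> L \<Longrightarrow> a \<in> L \<Longrightarrow> dirderiv a \<Psi> y \<in> tangent_space M (\<Psi> y)"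
  using \<Psi>_in_M by (intro dirderiv_in_tangent_space[OF smooth_\<Psi> open_V subspace_L]) auto

text \<open>The chart turns a curve in \<open>M\<close> into a curve in \<open>L\<close>, whose
  velocity stays in \<open>L\<close>. Conversely a vector of \<open>L\<close> is carried back by
  \<open>\<Psi>\<close>, which maps straight lines of the slice to curves in
  \<open>M\<close>.\<close>

lemma tangent_space_iff:
  assumes q: "q \<in> U \<inter> M"
  shows "v \<in> tangent_space M q \<longleftrightarrow> dirderiv v \<Phi> q \<in> L"
proof
  assume "v \<in> tangent_space M q"
  then obtain e \<gamma> where e: "e > 0" "smooth_on {-e<..<e} \<gamma>" "\<gamma> ` {-e<..<e} \<subseteq> M" "\<gamma> 0 = q"
    "(\<gamma> has_vector_derivative v) (at 0)" unfolding tangent_space_def by blast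
  let ?T = "{-e<..<e} \<inter> \<gamma> -` U"
  have "open ?T"
    using continuous_on_open_vimage[of "{-e<..<e}" \<gamma>] smooth_on_imp_continuous_on[OF e(2)] open_U
    by (simp add: Int_commute)
  moreover have "((\<lambda>t. \<Phi> (\<gamma> t)) has_vector_derivative dirderiv v \<Phi> q) (at 0)"
    by (rule has_vector_derivative_compose[OF _ e(5)]) (use smooth_on_imp_has_derivative[OF smooth_\<Phi>] q e(4) in simp)
  ultimately show "dirderiv v \<Phi> q \<in> L"
    using subspace_L by (rule_tac vector_derivative_in_subspace[where T = ?T]) (use e q \<Phi>_in_L in \<open>auto simp: image_subset_iff\<close>)
next
  assume "dirderiv v \<Phi> q \<in> L"
  thus "v \<in> tangent_space M q"
    using dirderiv_\<Psi>_tangent[OF \<Phi>_in_L[OF q]] dirderiv_\<Psi>_\<Phi> chart_simps q by (metis IntD1)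
qed

lemma tangent_space_eq_image:
  assumes y: "y \<in> V \<inter> L"
  shows "tangent_space M (\<Psi> y) = (\<lambda>a. dirderiv a \<Psi> y) ` L"
proof
  show "tangent_space M (\<Psi> y) \<subseteq> (\<lambda>a. dirderiv a \<Psi> y) ` L"
  proof
    fix v assume v: "v \<in> tangent_space M (\<Psi> y)"
    have "v = dirderiv (dirderiv v \<Phi> (\<Psi> y)) \<Psi> y"
      using dirderiv_\<Psi>_\<Phi>[of "\<Psi> y"] chart_simps y by simp
    thus "v \<in> (\<lambda>a. dirderiv a \<Psi> y) ` L" using v tangent_space_iff[OF \<Psi>_in_M[OF y]] by blast
  qed
qed (use dirderiv_\<Psi>_tangent[OF y] in blast)

lemma inj_dirderiv_\<Psi>: "y \<in> V \<Longrightarrow> inj (\<lambda>a. dirderiv a \<Psi> y)"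
  using dirderiv_\<Phi>_\<Psi> by (metis injI)

lemma tangent_space_subspace_dim:
  assumes q: "q \<in> U \<inter> M"
  shows "subspace (tangent_space M q)" "dim (tangent_space M q) = dim L"
proof -
  have y: "\<Phi> q \<in> V \<inter> L" "\<Psi> (\<Phi> q) = q" using q \<Phi>_in_L chart_simps by auto
  have lin: "linear (\<lambda>a. dirderiv a \<Psi> (\<Phi> q))" using y by (intro linear_dirderiv[OF smooth_\<Psi>]) auto
  show "subspace (tangent_space M q)"
    using linear_subspace_image[OF lin subspace_L] tangent_space_eq_image[OF y(1)] y(2) by simp
  have "dim ((\<lambda>a. dirderiv a \<Psi> (\<Phi> q)) ` L) = dim L"
    using lin inj_dirderiv_\<Psi> y by (intro dim_image_eq) (auto intro: inj_on_subset)
  thus "dim (tangent_space M q) = dim L"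
    using tangent_space_eq_image[OF y(1)] y(2) by simp
qed

text \<open>In general the derivative of a tangent field along a curve leaves the tangent space,
  through the term in which the moving differential of the chart is differentiated. That term
  carries the factor \<open>Z 0\<close>, so it drops out for a field that vanishes at parameter
  0.\<close>

lemma tangent_field_derivative:
  fixes \<gamma> Z :: "real \<Rightarrow> 'a"
  assumes T: "open T" "0 \<in> T" "\<gamma> ` T \<subseteq> U \<inter> M" and tan: "\<And>t. t \<in> T \<Longrightarrow> Z t \<in> tangent_space M (\<gamma> t)"
    and 0: "Z 0 = 0" and Z: "(Z has_vector_derivative z) (at 0)" and \<gamma>: "(\<gamma> has_vector_derivative w) (at 0)"
  shows "z \<in> tangent_space M (\<gamma> 0)"
proof -
  \<comment> \<open>This is the image of the field in the chart, hence a curve in \<open>L\<close>.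
    The basis coordinates let the product rule separate the field from the moving
    differential.\<close>
  define c where "c t = (\<Sum>i\<in>Basis. (Z t \<bullet> i) *\<^sub>R dirderiv i \<Phi> (\<gamma> t))" for t
  have c: "c t = dirderiv (Z t) \<Phi> (\<gamma> t)" if "t \<in> T" for t
    unfolding c_def using T that by (intro dirderiv_sum_Basis[symmetric] smooth_on_imp_differentiable[OF smooth_\<Phi>]) auto
  have \<gamma>0: "\<gamma> 0 \<in> U \<inter> M" using T by auto
  have "((\<lambda>t. (Z t \<bullet> i) *\<^sub>R dirderiv i \<Phi> (\<gamma> t)) has_vector_derivative (z \<bullet> i) *\<^sub>R dirderiv i \<Phi> (\<gamma> 0)) (at 0)" for i
  proof -
    have 1: "((\<lambda>t. Z t \<bullet> i) has_vector_derivative z \<bullet> i) (at 0)"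
      using Z by (rule bounded_linear.has_vector_derivative[OF bounded_linear_inner_left])
    have 2: "((\<lambda>t. dirderiv i \<Phi> (\<gamma> t)) has_vector_derivative dirderiv w (dirderiv i \<Phi>) (\<gamma> 0)) (at 0)"
      using \<gamma>0 smooth_on_imp_has_derivative[OF smooth_on_dirderiv[OF smooth_\<Phi>]]
      by (intro has_vector_derivative_compose[OF _ \<gamma>]) auto
    show ?thesis
      using has_vector_derivative_scaleR[OF 1[unfolded has_real_derivative_iff_has_vector_derivative[symmetric]] 2] 0
      by simp
  qed
  hence "(c has_vector_derivative (\<Sum>i\<in>Basis. (z \<bullet> i) *\<^sub>R dirderiv i \<Phi> (\<gamma> 0))) (at 0)"
    unfolding c_def by (intro has_vector_derivative_sum)
  also have "(\<Sum>i\<in>Basis. (z \<bullet> i) *\<^sub>R dirderiv i \<Phi> (\<gamma> 0)) = dirderiv z \<Phi> (\<gamma> 0)"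
    using \<gamma>0 by (intro dirderiv_sum_Basis[symmetric] smooth_on_imp_differentiable[OF smooth_\<Phi>]) auto
  finally have "dirderiv z \<Phi> (\<gamma> 0) \<in> L"
    using subspace_L T c tan tangent_space_iff
    by (rule_tac vector_derivative_in_subspace[where T = T and c = c]) (auto simp: image_subset_iff)
  thus ?thesis using tangent_space_iff[OF \<gamma>0] by simp
qed

end

section \<open>Normal components and the second fundamental form\<close>

lemma submanifold_chart:
  assumes "submanifold m M" "p \<in> M"
  obtains U V \<Phi> \<Psi> L where "slice_chart M U V L \<Phi> \<Psi>" "p \<in> U" "dim L = m"
  using assms unfolding submanifold_def slice_chart_def by metis

lemma tangent_space_submanifold:
  assumes "submanifold m M" "p \<in> M"
  shows "subspace (tangent_space M p)" "dim (tangent_space M p) = m"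
  using submanifold_chart[OF assms] slice_chart.tangent_space_subspace_dim assms(2) by (metis IntI)+

text \<open>Orthogonal decomposition provides a candidate, and two candidates differ by a vector
  that is both tangent and normal, hence zero. This justifies the definite description.\<close>

lemma normal_component_unique:
  assumes "subspace (tangent_space M p)"
  shows "normal_component M p w \<in> normal_space M p" "w - normal_component M p w \<in> tangent_space M p"
    and "z \<in> normal_space M p \<Longrightarrow> w - z \<in> tangent_space M p \<Longrightarrow> normal_component M p w = z"
proof -
  let ?T = "tangent_space M p"
  have uniq: "z = z'" if "z \<in> normal_space M p" "w - z \<in> ?T" "z' \<in> normal_space M p" "w - z' \<in> ?T" for z z'
  proof -
    have "z' - z \<in> normal_space M p"
      using that unfolding normal_space_def by (intro subspace_diff subspace_orthogonal_comp)
    moreover have "z' - z \<in> ?T" using subspace_diff[OF assms that(2,4)] by simp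
    ultimately have "(z' - z) \<bullet> (z' - z) = 0" by (simp add: normal_space_def orthogonal_comp_def orthogonal_def)
    thus ?thesis by simp
  qed
  obtain y z\<^sub>0 where "y \<in> span ?T" "\<And>w. w \<in> span ?T \<Longrightarrow> orthogonal z\<^sub>0 w" "w = y + z\<^sub>0"
    using orthogonal_subspace_decomp_exists[of ?T w] by metis
  hence "z\<^sub>0 \<in> normal_space M p \<and> w - z\<^sub>0 \<in> ?T"
    using assms by (auto simp: normal_space_def orthogonal_comp_def orthogonal_commute span_eq_iff[THEN iffD2])
  hence ex: "\<exists>!z. z \<in> normal_space M p \<and> w - z \<in> ?T" using uniq by blast
  show "normal_component M p w \<in> normal_space M p" "w - normal_component M p w \<in> ?T"
    using theI'[OF ex] unfolding normal_component_def by blast+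
  thus "z \<in> normal_space M p \<Longrightarrow> w - z \<in> ?T \<Longrightarrow> normal_component M p w = z" using uniq by blast
qed

lemma subspace_normal_space: "subspace (normal_space M p)"
  unfolding normal_space_def by (rule subspace_orthogonal_comp)

lemma normal_component_cong:
  assumes T: "subspace (tangent_space M p)" and "w - w' \<in> tangent_space M p"
  shows "normal_component M p w = normal_component M p w'"
proof (rule normal_component_unique(3)[OF T normal_component_unique(1)[OF T]])
  show "w - normal_component M p w' \<in> tangent_space M p"
    using subspace_add[OF T assms(2) normal_component_unique(2)[OF T, of w']] by simp
qed

lemma linear_normal_component:
  assumes T: "subspace (tangent_space M p)"
  shows "linear (normal_component M p)"
proof (rule linearI)
  fix u v c
  note n = normal_component_unique(1,2)[OF T]
  show "normal_component M p (u + v) = normal_component M p u + normal_component M p v"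
  proof (rule normal_component_unique(3)[OF T subspace_add[OF subspace_normal_space n(1) n(1)]])
    show "u + v - (normal_component M p u + normal_component M p v) \<in> tangent_space M p"
      using subspace_add[OF T n(2)[of u] n(2)[of v]] by (simp add: algebra_simps)
  qed
  show "normal_component M p (c *\<^sub>R v) = c *\<^sub>R normal_component M p v"
  proof (rule normal_component_unique(3)[OF T subspace_scale[OF subspace_normal_space n(1)]])
    show "c *\<^sub>R v - c *\<^sub>R normal_component M p v \<in> tangent_space M p"
      using subspace_scale[OF T n(2)[of v], of c] by (simp add: algebra_simps)
  qed
qed

text \<open>The second identity is Pythagoras in polarized form. It splits products of second
  fundamental forms into products of full second derivatives and products of tangential parts, which
  can be compared separately.\<close>

lemma normal_component_inner:
  assumes "subspace (tangent_space N p)"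
  shows "v \<in> tangent_space N p \<Longrightarrow> (w - normal_component N p w) \<bullet> v = w \<bullet> v"
    and "normal_component N p w \<bullet> normal_component N p w' = w \<bullet> w' - (w - normal_component N p w) \<bullet> (w' - normal_component N p w')"
proof -
  have orth: "normal_component N p w \<bullet> v = 0" "v \<bullet> normal_component N p w = 0" if "v \<in> tangent_space N p" for v w
    using normal_component_unique(1)[OF assms, of w] that
    by (auto simp: normal_space_def orthogonal_comp_def orthogonal_def inner_commute)
  show "v \<in> tangent_space N p \<Longrightarrow> (w - normal_component N p w) \<bullet> v = w \<bullet> v"
    using orth by (simp add: inner_diff_left)
  show "normal_component N p w \<bullet> normal_component N p w' = w \<bullet> w' - (w - normal_component N p w) \<bullet> (w' - normal_component N p w')"
    using orth(1)[OF normal_component_unique(2)[OF assms, of w'], of w]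
      orth(2)[OF normal_component_unique(2)[OF assms, of w], of w']
    by (simp add: inner_diff_left inner_diff_right)
qed

text \<open>Two tangent fields along the same curve in \<open>M\<close> that agree at one point have derivatives there
  that differ by a tangent vector, so a tangent field can be replaced by the partial derivative
  \<open>D\<^sub>b r\<close> of any map \<open>r\<close> into \<open>M\<close>.\<close>

lemma second_fundamental_form_dirderiv:
  fixes r :: "'c::euclidean_space \<Rightarrow> 'a::euclidean_space"
  assumes M: "submanifold m M" and r: "smooth_on V r" and V: "open V" and L: "subspace L"
    and x: "x \<in> V \<inter> L" and ab: "a \<in> L" "b \<in> L" and rM: "r ` (V \<inter> L) \<subseteq> M"
  shows "second_fundamental_form M (r x) (dirderiv a r x) (dirderiv b r x) =
    normal_component M (r x) (dirderiv a (dirderiv b r) x)"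
proof -
  let ?p = "r x"
  have p: "?p \<in> M" using rM x by auto
  obtain U' V' \<Phi> \<Psi> L' where chart: "slice_chart M U' V' L' \<Phi> \<Psi>" and pU: "?p \<in> U'"
    using submanifold_chart[OF M p] by metis
  interpret slice_chart M U' V' L' \<Phi> \<Psi> by fact
  note T = tangent_space_submanifold(1)[OF M p]
  have tan: "dirderiv b r y \<in> tangent_space M (r y)" if "y \<in> V \<inter> L" "b \<in> L" for y b
    by (rule dirderiv_in_tangent_space[OF r V L that rM])
  have indep: "normal_component M ?p (frechet_derivative Y (at ?p) (dirderiv a r x)) =
      normal_component M ?p (dirderiv a (dirderiv b r) x)"
    if W: "open W" "?p \<in> W" and Y: "smooth_on W Y" "\<forall>q\<in>W \<inter> M. Y q \<in> tangent_space M q" "Y ?p = dirderiv b r x" for W Y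
  proof (rule normal_component_cong[OF T])
    let ?l = "\<lambda>t::real. x + t *\<^sub>R a"
    let ?T = "{t. ?l t \<in> V \<inter> r -` (U' \<inter> W)}"
    have oT: "open ?T"
      using smooth_on_imp_continuous_on[OF r] V W(1) open_U
      by (intro open_vimage_line continuous_open_preimage) auto
    have lL: "?l t \<in> L" for t using x ab L by (intro subspace_add subspace_scale) auto
    have d: "((\<lambda>t. f (?l t)) has_vector_derivative dirderiv a f x) (at 0)" if "smooth_on V f" for f :: "'c \<Rightarrow> 'a"
      by (rule has_vector_derivative_compose[OF _ has_vector_derivative_line])
        (use smooth_on_imp_has_derivative[OF that] x in simp)
    have "frechet_derivative Y (at ?p) (dirderiv a r x) - dirderiv a (dirderiv b r) x
        \<in> tangent_space M (r (?l 0))"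
    proof (rule tangent_field_derivative[OF oT, where Z = "\<lambda>t. Y (r (?l t)) - dirderiv b r (?l t)"])
      show "((\<lambda>t. r (?l t)) has_vector_derivative dirderiv a r x) (at 0)" by (rule d[OF r])
      show "((\<lambda>t. Y (r (?l t)) - dirderiv b r (?l t)) has_vector_derivative
          frechet_derivative Y (at ?p) (dirderiv a r x) - dirderiv a (dirderiv b r) x) (at 0)"
        using smooth_on_imp_has_derivative[OF Y(1) W(2)]
        by (intro has_vector_derivative_diff d smooth_on_dirderiv r has_vector_derivative_compose[OF _ d[OF r]]) simp
      show "(\<lambda>t. r (?l t)) ` ?T \<subseteq> U' \<inter> M" using lL rM by auto
      show "Y (r (?l t)) - dirderiv b r (?l t) \<in> tangent_space M (r (?l t))" if "t \<in> ?T" for t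
      proof -
        have "r (?l t) \<in> M" using lL rM that by auto
        thus ?thesis using that Y(2) tan[of "?l t" b] lL ab
          by (intro subspace_diff tangent_space_submanifold(1)[OF M]) auto
      qed
    qed (use x pU W Y in auto)
    thus "frechet_derivative Y (at ?p) (dirderiv a r x) - dirderiv a (dirderiv b r) x \<in> tangent_space M ?p" by simp
  qed
  \<comment> \<open>The definite description also needs one admissible field. The vector
    \<open>dirderiv b r x\<close> is transported to chart coordinates and frozen there; the
    corresponding coordinate field is smooth, tangent to \<open>M\<close> and has the prescribed
    value.\<close>
  define b' where "b' = dirderiv (dirderiv b r x) \<Phi> ?p"
  have b': "b' \<in> L'" unfolding b'_def using tan[OF x ab(2)] tangent_space_iff pU p by simp
  have Y: "open U'" "?p \<in> U'" "smooth_on U' (\<lambda>q. dirderiv b' \<Psi> (\<Phi> q))"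
    "\<forall>q\<in>U' \<inter> M. dirderiv b' \<Psi> (\<Phi> q) \<in> tangent_space M q" "dirderiv b' \<Psi> (\<Phi> ?p) = dirderiv b r x"
  proof -
    show "smooth_on U' (\<lambda>q. dirderiv b' \<Psi> (\<Phi> q))"
      using chart_simps by (intro smooth_on_compose[OF open_U open_V _ smooth_\<Phi>] smooth_on_dirderiv smooth_\<Psi>) auto
    show "\<forall>q\<in>U' \<inter> M. dirderiv b' \<Psi> (\<Phi> q) \<in> tangent_space M q"
    proof
      fix q assume q: "q \<in> U' \<inter> M"
      thus "dirderiv b' \<Psi> (\<Phi> q) \<in> tangent_space M q"
        using dirderiv_\<Psi>_tangent[OF \<Phi>_in_L[OF q] b'] chart_simps(2) by simp
    qed
    show "dirderiv b' \<Psi> (\<Phi> ?p) = dirderiv b r x" unfolding b'_def using pU by (rule dirderiv_\<Psi>_\<Phi>)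
  qed (use open_U pU in auto)
  show ?thesis unfolding second_fundamental_form_def
  proof (rule the_equality)
    show "\<exists>W Y. open W \<and> ?p \<in> W \<and> smooth_on W Y \<and> (\<forall>q\<in>W \<inter> M. Y q \<in> tangent_space M q) \<and>
        Y ?p = dirderiv b r x \<and>
        normal_component M ?p (dirderiv a (dirderiv b r) x) = normal_component M ?p (frechet_derivative Y (at ?p) (dirderiv a r x))"
      using Y indep[OF Y] by metis
  qed (use indep in metis)
qed

section \<open>The Gauss equation for isometric submanifolds\<close>

text \<open>Differentiation along a curve in \<open>S\<close> with velocity \<open>v\<close> sees
  only the values of an extension on \<open>S\<close>. Hence all extensions give the same
  vector.\<close>

lemma differential_eq:
  assumes F: "local_smooth_extension S f q F" and v: "v \<in> tangent_space S q"
  shows "differential S f q v = frechet_derivative F (at q) v"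
  unfolding differential_def
proof (rule the_equality)
  fix w assume "\<exists>F. local_smooth_extension S f q F \<and> w = frechet_derivative F (at q) v"
  then obtain G where G: "local_smooth_extension S f q G" "w = frechet_derivative G (at q) v" by blast
  obtain e \<gamma> where e: "e > 0" "smooth_on {-e<..<e} \<gamma>" "\<gamma> ` {-e<..<e} \<subseteq> S" "\<gamma> 0 = q"
    "(\<gamma> has_vector_derivative v) (at 0)" using v unfolding tangent_space_def by blast
  obtain W where W: "open W" "q \<in> W" "smooth_on W F" "\<And>x. x \<in> W \<inter> S \<Longrightarrow> F x = f x"
    using F unfolding local_smooth_extension_def by blast
  obtain W' where W': "open W'" "q \<in> W'" "smooth_on W' G" "\<And>x. x \<in> W' \<inter> S \<Longrightarrow> G x = f x"
    using G(1) unfolding local_smooth_extension_def by blast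
  let ?T = "{-e<..<e} \<inter> \<gamma> -` (W \<inter> W')"
  have T: "open ?T"
    using smooth_on_imp_continuous_on[OF e(2)] W(1) W'(1) by (intro continuous_open_preimage) auto
  have F': "((\<lambda>t. F (\<gamma> t)) has_vector_derivative frechet_derivative F (at q) v) (at 0)"
    by (rule has_vector_derivative_compose[OF _ e(5)]) (use smooth_on_imp_has_derivative[OF W(3,2)] e(4) in simp)
  have G': "((\<lambda>t. G (\<gamma> t)) has_vector_derivative frechet_derivative G (at q) v) (at 0)"
    by (rule has_vector_derivative_compose[OF _ e(5)]) (use smooth_on_imp_has_derivative[OF W'(3,2)] e(4) in simp)
  have "((\<lambda>t. G (\<gamma> t)) has_vector_derivative frechet_derivative F (at q) v) (at 0)"
    by (rule has_vector_derivative_transform_within_open[OF F' T])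
      (use e W(2) W'(2) W(4) W'(4) in \<open>auto simp: image_subset_iff\<close>)
  thus "w = frechet_derivative F (at q) v"
    unfolding G(2) using G' by (metis vector_derivative_unique_at)
qed (use F in blast)

locale immersed_parametrization =
  fixes V L :: "'c::euclidean_space set" and r :: "'c \<Rightarrow> 'a::euclidean_space" and M :: "'a set" and m :: nat and x :: 'c
  assumes V: "open V" and L: "subspace L" and r: "smooth_on V r" and x: "x \<in> V \<inter> L" and dimL: "dim L = m"
    and rM: "r ` (V \<inter> L) \<subseteq> M" and M: "submanifold m M" and inj: "inj_on (\<lambda>a. dirderiv a r x) L"
begin

lemma linear_D: "linear (\<lambda>a. dirderiv a r x)"
  using x by (intro linear_dirderiv[OF r]) auto

lemma rx: "r x \<in> M" using x rM by auto

text \<open>The image of \<open>L\<close> consists of tangent vectors, and injectivity gives it the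
  full dimension \<open>m\<close>, so the inclusion is an equality.\<close>

lemma tangent_eq: "tangent_space M (r x) = (\<lambda>a. dirderiv a r x) ` L"
proof (rule sym, rule subspace_dim_equal)
  show "subspace ((\<lambda>a. dirderiv a r x) ` L)" using linear_D L by (rule linear_subspace_image)
  show "subspace (tangent_space M (r x))" by (rule tangent_space_submanifold(1)[OF M rx])
  show "(\<lambda>a. dirderiv a r x) ` L \<subseteq> tangent_space M (r x)"
    using dirderiv_in_tangent_space[OF r V L x _ rM] by blast
  have "dim ((\<lambda>a. dirderiv a r x) ` L) = dim L"
    using linear_D inj by (intro dim_image_eq) (simp_all add: span_eq_iff[THEN iffD2, OF L])
  thus "dim (tangent_space M (r x)) \<le> dim ((\<lambda>a. dirderiv a r x) ` L)"
    using tangent_space_submanifold(2)[OF M rx] dimL by simp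
qed

lemmas tangent_subspace = tangent_space_submanifold(1)[OF M rx]
lemmas tangent_dim = tangent_space_submanifold(2)[OF M rx]

lemmas second_fundamental_form_eq = second_fundamental_form_dirderiv[OF M r V L x _ _ rM]

lemma sum_in_L: "(\<And>i. i \<in> I \<Longrightarrow> a i \<in> L) \<Longrightarrow> (\<Sum>i\<in>I. c i *\<^sub>R a i) \<in> L"
  using L by (intro subspace_sum subspace_scale)

text \<open>Linearity cannot be read off the definition by tangent fields. Tangent vectors are
  pulled back to directions in \<open>L\<close>, where the form is the normal part of a second
  derivative, which is linear in each direction.\<close>

lemma second_fundamental_form_sum_left:
  assumes u: "\<And>i. i \<in> I \<Longrightarrow> u i \<in> tangent_space M (r x)" and v: "v \<in> tangent_space M (r x)"
  shows "second_fundamental_form M (r x) (\<Sum>i\<in>I. c i *\<^sub>R u i) v =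
    (\<Sum>i\<in>I. c i *\<^sub>R second_fundamental_form M (r x) (u i) v)"
proof -
  have "\<forall>i\<in>I. \<exists>a\<in>L. u i = dirderiv a r x" using u unfolding tangent_eq by blast
  then obtain a where a: "\<And>i. i \<in> I \<Longrightarrow> a i \<in> L" "\<And>i. i \<in> I \<Longrightarrow> u i = dirderiv (a i) r x" by metis
  obtain b where b: "b \<in> L" "v = dirderiv b r x" using v unfolding tangent_eq by blast
  note n = linear_normal_component[OF tangent_subspace]
  have l: "linear (\<lambda>a. dirderiv a (dirderiv b r) x)" using x by (intro linear_dirderiv[OF smooth_on_dirderiv[OF r]]) auto
  have "(\<Sum>i\<in>I. c i *\<^sub>R u i) = dirderiv (\<Sum>i\<in>I. c i *\<^sub>R a i) r x"
    using a(2) by (simp add: linear_sum[OF linear_D] linear_scale[OF linear_D])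
  hence "second_fundamental_form M (r x) (\<Sum>i\<in>I. c i *\<^sub>R u i) v =
      normal_component M (r x) (dirderiv (\<Sum>i\<in>I. c i *\<^sub>R a i) (dirderiv b r) x)"
    using second_fundamental_form_eq[OF sum_in_L[OF a(1)] b(1)] b(2) by simp
  also have "\<dots> = (\<Sum>i\<in>I. c i *\<^sub>R normal_component M (r x) (dirderiv (a i) (dirderiv b r) x))"
    by (simp only: linear_sum[OF l] linear_scale[OF l] linear_sum[OF n] linear_scale[OF n])
  also have "\<dots> = (\<Sum>i\<in>I. c i *\<^sub>R second_fundamental_form M (r x) (u i) v)"
    by (intro sum.cong refl) (simp only: a(2) b(2) second_fundamental_form_eq[OF a(1) b(1)])
  finally show ?thesis .
qed

lemma second_fundamental_form_sum_right:
  assumes u: "\<And>i. i \<in> I \<Longrightarrow> u i \<in> tangent_space M (r x)" and v: "v \<in> tangent_space M (r x)"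
  shows "second_fundamental_form M (r x) v (\<Sum>i\<in>I. c i *\<^sub>R u i) =
    (\<Sum>i\<in>I. c i *\<^sub>R second_fundamental_form M (r x) v (u i))"
proof -
  have "\<forall>i\<in>I. \<exists>a\<in>L. u i = dirderiv a r x" using u unfolding tangent_eq by blast
  then obtain a where a: "\<And>i. i \<in> I \<Longrightarrow> a i \<in> L" "\<And>i. i \<in> I \<Longrightarrow> u i = dirderiv (a i) r x" by metis
  obtain b where b: "b \<in> L" "v = dirderiv b r x" using v unfolding tangent_eq by blast
  note n = linear_normal_component[OF tangent_subspace]
  have l: "linear (\<lambda>a. dirderiv b (dirderiv a r) x)" using x by (intro linear_dirderiv_direction[OF r V]) auto
  have "(\<Sum>i\<in>I. c i *\<^sub>R u i) = dirderiv (\<Sum>i\<in>I. c i *\<^sub>R a i) r x"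
    using a(2) by (simp add: linear_sum[OF linear_D] linear_scale[OF linear_D])
  hence "second_fundamental_form M (r x) v (\<Sum>i\<in>I. c i *\<^sub>R u i) =
      normal_component M (r x) (dirderiv b (dirderiv (\<Sum>i\<in>I. c i *\<^sub>R a i) r) x)"
    using second_fundamental_form_eq[OF b(1) sum_in_L[OF a(1)]] b(2) by simp
  also have "\<dots> = (\<Sum>i\<in>I. c i *\<^sub>R normal_component M (r x) (dirderiv b (dirderiv (a i) r) x))"
    by (simp only: linear_sum[OF l] linear_scale[OF l] linear_sum[OF n] linear_scale[OF n])
  also have "\<dots> = (\<Sum>i\<in>I. c i *\<^sub>R second_fundamental_form M (r x) v (u i))"
    by (intro sum.cong refl) (simp only: a(2) b(2) second_fundamental_form_eq[OF b(1) a(1)])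
  finally show ?thesis .
qed

lemma tangent_basis_image:
  assumes h: "inj_on h {..<m}" "independent (h ` {..<m})" "span (h ` {..<m}) = L"
  shows "tangent_basis m M (r x) (\<lambda>i. dirderiv (h i) r x)"
proof -
  have im: "(\<lambda>i. dirderiv (h i) r x) ` {..<m} = (\<lambda>a. dirderiv a r x) ` h ` {..<m}" by (simp add: image_image)
  have hL: "h ` {..<m} \<subseteq> L" using span_superset[of "h ` {..<m}"] h(3) by simp
  have "inj_on ((\<lambda>a. dirderiv a r x) \<circ> h) {..<m}"
    using comp_inj_on[OF h(1) inj_on_subset[OF inj hL]] .
  moreover have "independent ((\<lambda>a. dirderiv a r x) ` h ` {..<m})"
    using linear_dependent_inj_imageD[OF linear_D, of "h ` {..<m}"] h(2) inj unfolding h(3) by blast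
  ultimately show ?thesis
    unfolding tangent_basis_def im tangent_eq linear_span_image[OF linear_D] h(3) by (simp add: o_def)
qed

end

section \<open>Change of basis and the directional curvature\<close>

lemma span_indexed:
  fixes b :: "nat \<Rightarrow> 'a::euclidean_space"
  assumes "inj_on b {..<m}" "v \<in> span (b ` {..<m})"
  shows "\<exists>c. v = (\<Sum>i<m. c i *\<^sub>R b i)"
proof -
  obtain u where "v = (\<Sum>w\<in>b ` {..<m}. u w *\<^sub>R w)" using assms(2) unfolding span_finite[OF finite_imageI[OF finite_lessThan]] by blast
  also have "\<dots> = (\<Sum>i<m. u (b i) *\<^sub>R b i)" by (simp add: sum.reindex[OF assms(1)])
  finally show ?thesis by (intro exI[of _ "\<lambda>i. u (b i)"])
qed

lemma independent_indexed:
  fixes b :: "nat \<Rightarrow> 'a::euclidean_space"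
  assumes "inj_on b {..<m}" "independent (b ` {..<m})" "(\<Sum>i<m. c i *\<^sub>R b i) = (\<Sum>i<m. d i *\<^sub>R b i)" "i < m"
  shows "c i = d i"
proof -
  define u where "u w = c (inv_into {..<m} b w) - d (inv_into {..<m} b w)" for w
  have u: "u (b i) = c i - d i" if "i < m" for i
    using that inv_into_f_f[OF assms(1)] by (simp add: u_def)
  have "(\<Sum>w\<in>b ` {..<m}. u w *\<^sub>R w) = (\<Sum>i<m. (c i - d i) *\<^sub>R b i)"
    by (simp add: sum.reindex[OF assms(1)] u)
  also have "\<dots> = 0" using assms(3) by (simp add: scaleR_left_diff_distrib sum_subtractf)
  finally have "u (b i) = 0" using assms(4) by (intro independentD[OF assms(2)]) auto
  thus ?thesis using u[OF assms(4)] by simp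
qed

text \<open>The matrices expressing each basis by the other have the identity as product, because
  coordinates with respect to \<open>c\<close> are unique; so neither determinant vanishes.\<close>

lemma change_of_basis:
  assumes b: "tangent_basis m M p b" and c: "tangent_basis m M p c"
  obtains A where "A \<in> carrier_mat m m" "\<And>j. j < m \<Longrightarrow> c j = (\<Sum>i<m. A $$ (i, j) *\<^sub>R b i)" "Determinant.det A \<noteq> 0"
proof -
  have ex: "\<exists>A \<in> carrier_mat m m. \<forall>j<m. c j = (\<Sum>i<m. A $$ (i, j) *\<^sub>R b i)"
    if b: "tangent_basis m M p b" and c: "tangent_basis m M p c" for b c
  proof -
    have "\<forall>j<m. \<exists>f. c j = (\<Sum>i<m. f i *\<^sub>R b i)"
    proof (intro allI impI span_indexed)
      fix j assume j: "j < m"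
      show "inj_on b {..<m}" using b by (simp add: tangent_basis_def)
      have "c j \<in> span (c ` {..<m})" using j by (intro span_base) simp
      thus "c j \<in> span (b ` {..<m})" using b c by (simp add: tangent_basis_def)
    qed
    then obtain f where "\<forall>j<m. c j = (\<Sum>i<m. f j i *\<^sub>R b i)" by metis
    thus ?thesis by (intro bexI[of _ "Matrix.mat m m (\<lambda>(i, j). f j i)"]) auto
  qed
  obtain A where A: "A \<in> carrier_mat m m" "\<And>j. j < m \<Longrightarrow> c j = (\<Sum>i<m. A $$ (i, j) *\<^sub>R b i)" using ex[OF b c] by blast
  obtain A' where A': "A' \<in> carrier_mat m m" "\<And>j. j < m \<Longrightarrow> b j = (\<Sum>i<m. A' $$ (i, j) *\<^sub>R c i)" using ex[OF c b] by blast
  have "A' * A = 1\<^sub>m m"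
  proof (rule eq_matI)
    fix k j assume kj: "k < dim_row (1\<^sub>m m)" "j < dim_col (1\<^sub>m m)"
    have "(\<Sum>k<m. (if k = j then 1 else 0) *\<^sub>R c k) = (\<Sum>k<m. if k = j then c k else 0)"
      by (intro sum.cong) auto
    also have "\<dots> = c j" using kj by simp
    also have "\<dots> = (\<Sum>i<m. A $$ (i, j) *\<^sub>R (\<Sum>k<m. A' $$ (k, i) *\<^sub>R c k))"
      using kj A(2)[of j] A'(2) by simp
    also have "\<dots> = (\<Sum>k<m. (\<Sum>i<m. A' $$ (k, i) * A $$ (i, j)) *\<^sub>R c k)"
      by (simp add: scaleR_sum_right scaleR_sum_left mult.commute) (rule sum.swap)
    finally have "(\<Sum>i<m. A' $$ (k, i) * A $$ (i, j)) = (if k = j then 1 else 0)"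
      using c kj by (intro independent_indexed[of c m, symmetric]) (auto simp: tangent_basis_def)
    thus "(A' * A) $$ (k, j) = 1\<^sub>m m $$ (k, j)"
      using kj A A' by (simp add: scalar_prod_def lessThan_atLeast0)
  qed (use A A' in auto)
  hence "Determinant.det A' * Determinant.det A = 1" using det_mult[OF A'(1) A(1)] by simp
  hence "Determinant.det A \<noteq> 0" by auto
  thus thesis using A that by blast
qed

text \<open>The two matrices are congruent through \<open>A\<close>. Linearity of
  \<open>\<beta>\<close> is asked for only on the combinations that occur, because the second
  fundamental form is controlled on tangent vectors only.\<close>

lemma det_change_of_basis:
  fixes b c :: "nat \<Rightarrow> 'a::euclidean_space" and \<beta> :: "'a \<Rightarrow> 'a \<Rightarrow> real"
  assumes A: "A \<in> carrier_mat m m" "\<And>j. j < m \<Longrightarrow> c j = (\<Sum>i<m. A $$ (i, j) *\<^sub>R b i)"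
    and left: "\<And>f j. j < m \<Longrightarrow> \<beta> (\<Sum>i<m. f i *\<^sub>R b i) (b j) = (\<Sum>i<m. f i * \<beta> (b i) (b j))"
    and right: "\<And>f j. j < m \<Longrightarrow> \<beta> (c j) (\<Sum>i<m. f i *\<^sub>R b i) = (\<Sum>i<m. f i * \<beta> (c j) (b i))"
  shows "Determinant.det (Matrix.mat m m (\<lambda>(i, j). \<beta> (c i) (c j))) =
    (Determinant.det A)\<^sup>2 * Determinant.det (Matrix.mat m m (\<lambda>(i, j). \<beta> (b i) (b j)))"
proof -
  let ?B = "Matrix.mat m m (\<lambda>(i, j). \<beta> (b i) (b j))"
  have "Matrix.mat m m (\<lambda>(i, j). \<beta> (c i) (c j)) = A\<^sup>T * ?B * A"
  proof (rule eq_matI)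
    fix i j assume "i < dim_row (A\<^sup>T * ?B * A)" "j < dim_col (A\<^sup>T * ?B * A)"
    hence ij: "i < m" "j < m" using A(1) by auto
    have cb: "\<beta> (c i) (b l) = (\<Sum>k<m. A $$ (k, i) * \<beta> (b k) (b l))" if "l < m" for l
      using A(2)[OF ij(1)] left[OF that] by simp
    have "\<beta> (c i) (c j) = (\<Sum>l<m. A $$ (l, j) * \<beta> (c i) (b l))"
      using right[OF ij(1), of "\<lambda>l. A $$ (l, j)"] A(2)[OF ij(2)] by simp
    also have "\<dots> = (\<Sum>l<m. (\<Sum>k<m. A $$ (k, i) * \<beta> (b k) (b l)) * A $$ (l, j))"
      by (intro sum.cong) (simp_all add: cb mult.commute)
    also have "\<dots> = (A\<^sup>T * ?B * A) $$ (i, j)"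
      using ij A(1) by (simp add: scalar_prod_def lessThan_atLeast0)
    finally show "Matrix.mat m m (\<lambda>(i, j). \<beta> (c i) (c j)) $$ (i, j) = (A\<^sup>T * ?B * A) $$ (i, j)"
      using ij by simp
  qed (use A(1) in auto)
  moreover have "Determinant.det (A\<^sup>T * ?B * A) = (Determinant.det A)\<^sup>2 * Determinant.det ?B"
  proof -
    have "Determinant.det (A\<^sup>T * ?B * A) = Determinant.det (A\<^sup>T * ?B) * Determinant.det A"
      using A(1) by (intro det_mult[of _ m]) auto
    also have "Determinant.det (A\<^sup>T * ?B) = Determinant.det A\<^sup>T * Determinant.det ?B"
      using A(1) by (intro det_mult[of _ m]) auto
    finally show ?thesis using Determinant.det_transpose[OF A(1)] by (simp add: power2_eq_square)
  qed
  ultimately show ?thesis by simp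
qed

context immersed_parametrization
begin

text \<open>Numerator and denominator pick up the same nonzero factor
  \<open>(Determinant.det A)\<^sup>2\<close>, so the basis selected in the definition may be
  replaced by any other.\<close>

lemma directional_gauss_curvature_eq:
  assumes c: "tangent_basis m M (r x) c"
  shows "directional_gauss_curvature M (r x) \<nu> =
    Determinant.det (Matrix.mat m m (\<lambda>(i, j). inner (second_fundamental_form M (r x) (c i) (c j)) \<nu>)) /
    Determinant.det (Matrix.mat m m (\<lambda>(i, j). inner (c i) (c j)))"
proof -
  define b where "b = (SOME b. tangent_basis m M (r x) b)"
  have b: "tangent_basis m M (r x) b" unfolding b_def using c by (rule someI[of "tangent_basis m M (r x)"])
  have T: "d i \<in> tangent_space M (r x)" if "tangent_basis m M (r x) d" "i < m" for d i
  proof -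
    have "d i \<in> span (d ` {..<m})" using that(2) by (intro span_base) simp
    thus ?thesis using that(1) by (simp add: tangent_basis_def)
  qed
  obtain A where A: "A \<in> carrier_mat m m" "\<And>j. j < m \<Longrightarrow> c j = (\<Sum>i<m. A $$ (i, j) *\<^sub>R b i)"
    "Determinant.det A \<noteq> 0" using change_of_basis[OF b c] by blast
  have "Determinant.det (Matrix.mat m m (\<lambda>(i, j). inner (second_fundamental_form M (r x) (c i) (c j)) \<nu>)) =
    (Determinant.det A)\<^sup>2 * Determinant.det (Matrix.mat m m (\<lambda>(i, j). inner (second_fundamental_form M (r x) (b i) (b j)) \<nu>))"
  proof (rule det_change_of_basis[OF A(1,2), where \<beta> = "\<lambda>u v. inner (second_fundamental_form M (r x) u v) \<nu>"])
    fix f j assume "j < m"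
    thus "inner (second_fundamental_form M (r x) (\<Sum>i<m. f i *\<^sub>R b i) (b j)) \<nu> =
        (\<Sum>i<m. f i * inner (second_fundamental_form M (r x) (b i) (b j)) \<nu>)"
      using second_fundamental_form_sum_left[of "{..<m}" b "b j" f] T[OF b] by (simp add: inner_sum_left)
  next
    fix f j assume "j < m"
    thus "inner (second_fundamental_form M (r x) (c j) (\<Sum>i<m. f i *\<^sub>R b i)) \<nu> =
        (\<Sum>i<m. f i * inner (second_fundamental_form M (r x) (c j) (b i)) \<nu>)"
      using second_fundamental_form_sum_right[of "{..<m}" b "c j" f] T[OF b] T[OF c] by (simp add: inner_sum_left)
  qed auto
  moreover have "Determinant.det (Matrix.mat m m (\<lambda>(i, j). inner (c i) (c j))) =
    (Determinant.det A)\<^sup>2 * Determinant.det (Matrix.mat m m (\<lambda>(i, j). inner (b i) (b j)))"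
    by (rule det_change_of_basis[OF A(1,2)]) (simp_all add: inner_sum_left inner_sum_right)
  moreover have "Matrix.mat m m (\<lambda>(i, j). first_fundamental_form M (r x) (b i) (b j)) = Matrix.mat m m (\<lambda>(i, j). inner (b i) (b j))"
    using T[OF b] by (intro eq_matI) (auto simp: first_fundamental_form_def)
  ultimately show ?thesis
    unfolding directional_gauss_curvature_def tangent_dim Let_def b_def[symmetric] using A(3) by simp
qed

end

section \<open>Comparison of two isometric immersions\<close>

locale isometric_immersions =
  isometric_parametrizations V L r r' + immersed_parametrization V L r M m x
  for V L :: "'c::euclidean_space set" and r :: "'c \<Rightarrow> 'a::euclidean_space" and r' :: "'c \<Rightarrow> 'b::euclidean_space"
    and M :: "'a set" and M' :: "'b set" and m x +
  assumes rM': "r' ` (V \<inter> L) \<subseteq> M'" and M': "submanifold m M'"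
begin

text \<open>Injectivity passes from \<open>r\<close> to \<open>r'\<close>: if the second
  differential kills a direction of \<open>L\<close>, its image under the first has length zero by
  equality of the metrics.\<close>

sublocale second: immersed_parametrization V L r' M' m x
proof
  have lin: "linear (\<lambda>a. dirderiv a r' x)" using x by (intro linear_dirderiv[OF smooth_r']) auto
  show "inj_on (\<lambda>a. dirderiv a r' x) L"
  proof (rule inj_onI)
    fix a b assume ab: "a \<in> L" "b \<in> L" "dirderiv a r' x = dirderiv b r' x"
    have d: "a - b \<in> L" using ab L by (intro subspace_diff)
    have "dirderiv (a - b) r' x = 0" using ab(3) by (simp add: linear_diff[OF lin])
    hence "dirderiv (a - b) r x = 0" using metric_eq[OF x d d] by simp
    hence "dirderiv a r x = dirderiv b r x" by (simp add: linear_diff[OF linear_D])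
    thus "a = b" using inj ab by (auto dest: inj_onD)
  qed
qed (use V L smooth_r' x dimL rM' M' in auto)

text \<open>A tangential part is determined by its inner products with tangent vectors, and those
  are Christoffel symbols. Instead of inverting the metric, one part is represented by a direction
  \<open>e\<close> through \<open>r\<close> and the other by \<open>e'\<close> through
  \<open>r'\<close>; \<open>christoffel_eq\<close> and \<open>metric_eq\<close> then carry the
  product across in turn.\<close>

lemma tangential_part_inner_eq:
  fixes u v s t
  defines "\<tau> \<equiv> \<lambda>w. w - normal_component M (r x) w" and "\<tau>' \<equiv> \<lambda>w. w - normal_component M' (r' x) w"
  assumes L: "u \<in> L" "v \<in> L" "s \<in> L" "t \<in> L"
  shows "\<tau> (dirderiv u (dirderiv v r) x) \<bullet> \<tau> (dirderiv s (dirderiv t r) x) =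
    \<tau>' (dirderiv u (dirderiv v r') x) \<bullet> \<tau>' (dirderiv s (dirderiv t r') x)"
proof -
  have 1: "\<tau> w \<bullet> dirderiv e r x = w \<bullet> dirderiv e r x" "dirderiv e r x \<bullet> \<tau> w = w \<bullet> dirderiv e r x" if "e \<in> L" for e w
    using normal_component_inner(1)[OF tangent_subspace] that tangent_eq by (auto simp: \<tau>_def inner_commute)
  have 2: "\<tau>' w \<bullet> dirderiv e r' x = w \<bullet> dirderiv e r' x" "dirderiv e r' x \<bullet> \<tau>' w = w \<bullet> dirderiv e r' x" if "e \<in> L" for e w
    using normal_component_inner(1)[OF second.tangent_subspace] that second.tangent_eq by (auto simp: \<tau>'_def inner_commute)
  obtain e where e: "e \<in> L" "\<tau> (dirderiv s (dirderiv t r) x) = dirderiv e r x"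
    using normal_component_unique(2)[OF tangent_subspace] tangent_eq by (auto simp: \<tau>_def)
  obtain e' where e': "e' \<in> L" "\<tau>' (dirderiv u (dirderiv v r') x) = dirderiv e' r' x"
    using normal_component_unique(2)[OF second.tangent_subspace] second.tangent_eq by (auto simp: \<tau>'_def)
  have "\<tau> (dirderiv u (dirderiv v r) x) \<bullet> \<tau> (dirderiv s (dirderiv t r) x) = dirderiv u (dirderiv v r') x \<bullet> dirderiv e r' x"
    using 1(1)[OF e(1)] e christoffel_eq[OF x] L by simp
  also have "\<dots> = dirderiv e' r' x \<bullet> dirderiv e r' x"
    using 2(1)[OF e(1), of "dirderiv u (dirderiv v r') x"] e'(2) by simp
  also have "\<dots> = dirderiv e' r x \<bullet> \<tau> (dirderiv s (dirderiv t r) x)"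
    using metric_eq[OF x e'(1) e(1)] e(2) by simp
  also have "\<dots> = dirderiv s (dirderiv t r') x \<bullet> dirderiv e' r' x"
    using 1(2)[OF e'(1)] e'(1) christoffel_eq[OF x] L by simp
  also have "\<dots> = \<tau>' (dirderiv u (dirderiv v r') x) \<bullet> \<tau>' (dirderiv s (dirderiv t r') x)"
    using 2(2)[OF e'(1)] e'(2) by simp
  finally show ?thesis .
qed

text \<open>Products of normal components differ from products of full second derivatives by
  products of tangential parts. The latter agree term by term, the full ones agree after
  antisymmetrization by \<open>curvature_eq\<close>.\<close>

lemma gauss_equation:
  assumes ijkl: "i \<in> L" "j \<in> L" "k \<in> L" "l \<in> L"
  shows "second_fundamental_form M (r x) (dirderiv i r x) (dirderiv k r x) \<bullet>
        second_fundamental_form M (r x) (dirderiv j r x) (dirderiv l r x)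
      - second_fundamental_form M (r x) (dirderiv j r x) (dirderiv k r x) \<bullet>
        second_fundamental_form M (r x) (dirderiv i r x) (dirderiv l r x) =
    second_fundamental_form M' (r' x) (dirderiv i r' x) (dirderiv k r' x) \<bullet>
        second_fundamental_form M' (r' x) (dirderiv j r' x) (dirderiv l r' x)
      - second_fundamental_form M' (r' x) (dirderiv j r' x) (dirderiv k r' x) \<bullet>
        second_fundamental_form M' (r' x) (dirderiv i r' x) (dirderiv l r' x)"
  unfolding second_fundamental_form_eq[OF ijkl(1,3)] second_fundamental_form_eq[OF ijkl(1,4)]
    second_fundamental_form_eq[OF ijkl(2,3)] second_fundamental_form_eq[OF ijkl(2,4)]
    second.second_fundamental_form_eq[OF ijkl(1,3)] second.second_fundamental_form_eq[OF ijkl(1,4)]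
    second.second_fundamental_form_eq[OF ijkl(2,3)] second.second_fundamental_form_eq[OF ijkl(2,4)]
    normal_component_inner(2)[OF tangent_subspace] normal_component_inner(2)[OF second.tangent_subspace]
    tangential_part_inner_eq[OF ijkl(1,3,2,4)] tangential_part_inner_eq[OF ijkl(2,3,1,4)]
  using curvature_eq[OF x ijkl] by linarith

end

text \<open>Both parametrizations come from one slice chart of \<open>M\<close>: \<open>r\<close> is
  its inverse \<open>\<Psi>\<close>, and \<open>r'\<close> is \<open>\<Psi>\<close> followed by an
  ambient extension \<open>F\<close> of the isometry. On the slice \<open>r'\<close> is the isometry
  after \<open>r\<close>, so it lands in \<open>M'\<close> and induces the same metric.\<close>

lemma isometry_immersions:
  fixes M U :: "'a::euclidean_space set" and M' U' :: "'b::euclidean_space set"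
  assumes M: "submanifold m M" and M': "submanifold m M'"
    and U: "openin (top_of_set M) U" and U': "openin (top_of_set M') U'"
    and iso: "riemannian_isometry U U' \<phi>" and p: "p \<in> U"
  obtains V L :: "'a set" and r :: "'a \<Rightarrow> 'a" and r' :: "'a \<Rightarrow> 'b" and x
  where "isometric_immersions V L r r' M M' m x" "r x = p" "r' x = \<phi> p"
proof -
  have UM: "U \<subseteq> M" "U' \<subseteq> M'" using U U' openin_imp_subset by blast+
  obtain O1 where O1: "open O1" "U = O1 \<inter> M" using U unfolding openin_open by blast
  have pM: "p \<in> M" using p UM by blast
  obtain U0 V0 \<Phi> \<Psi> L where chart: "slice_chart M U0 V0 L \<Phi> \<Psi>" and pU: "p \<in> U0" and dimL: "dim L = m"
    using submanifold_chart[OF M pM] by metis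
  interpret slice_chart M U0 V0 L \<Phi> \<Psi> by fact
  have "smooth_map U \<phi>" using iso by (simp add: riemannian_isometry_def)
  then obtain F W where W: "open W" "p \<in> W" "smooth_on W F" "\<forall>q\<in>W \<inter> U. F q = \<phi> q"
    using p unfolding smooth_map_def local_smooth_extension_def by blast
  \<comment> \<open>Restricting to points sent into \<open>W \<inter> O1\<close> makes
    \<open>F\<close> smooth at the image and keeps the image of the slice inside \<open>U\<close>,
    the domain of the isometry.\<close>
  define V where "V = V0 \<inter> \<Psi> -` (W \<inter> O1)"
  have V: "open V" unfolding V_def
    using smooth_on_imp_continuous_on[OF smooth_\<Psi>] open_V W(1) O1(1) by (intro continuous_open_preimage) auto
  have \<Psi>V: "smooth_on V \<Psi>" using smooth_\<Psi> by (rule smooth_on_subset) (auto simp: V_def)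
  have r': "smooth_on V (\<lambda>y. F (\<Psi> y))"
    by (rule smooth_on_compose[OF V W(1) _ \<Psi>V W(3)]) (auto simp: V_def)
  have \<Psi>U: "\<Psi> y \<in> U \<inter> W" if "y \<in> V \<inter> L" for y
    using that \<Psi>_in_M[of y] O1(2) by (auto simp: V_def)
  have FU: "F (\<Psi> y) = \<phi> (\<Psi> y)" "F (\<Psi> y) \<in> U'" if "y \<in> V \<inter> L" for y
  proof -
    show "F (\<Psi> y) = \<phi> (\<Psi> y)" using W(4) \<Psi>U[OF that] by blast
    moreover have "\<phi> (\<Psi> y) \<in> U'" using iso \<Psi>U[OF that] by (auto simp: riemannian_isometry_def bij_betw_def)
    ultimately show "F (\<Psi> y) \<in> U'" by simp
  qed
  have x: "\<Phi> p \<in> V \<inter> L" using \<Phi>_in_L[of p] chart_simps(2)[of p] pU pM p W(2) O1(2) by (auto simp: V_def)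
  have metric: "dirderiv u \<Psi> y \<bullet> dirderiv v \<Psi> y = dirderiv u (\<lambda>y. F (\<Psi> y)) y \<bullet> dirderiv v (\<lambda>y. F (\<Psi> y)) y"
    if y: "y \<in> V \<inter> L" and uv: "u \<in> L" "v \<in> L" for y u v
  proof -
    let ?q = "\<Psi> y"
    have q: "?q \<in> U" "?q \<in> W" using \<Psi>U[OF y] by auto
    have tan: "dirderiv w \<Psi> y \<in> tangent_space U ?q" if "w \<in> L" for w
      using \<Psi>U by (intro dirderiv_in_tangent_space[OF \<Psi>V V subspace_L y that]) auto
    have tan': "dirderiv w (\<lambda>y. F (\<Psi> y)) y \<in> tangent_space U' (\<phi> ?q)" if "w \<in> L" for w
    proof -
      have "dirderiv w (\<lambda>y. F (\<Psi> y)) y \<in> tangent_space U' (F ?q)"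
        using FU(2) by (intro dirderiv_in_tangent_space[OF r' V subspace_L y that]) auto
      thus ?thesis using FU(1)[OF y] by simp
    qed
    have ext: "local_smooth_extension U \<phi> ?q F"
      unfolding local_smooth_extension_def using W q by blast
    have diff: "differential U \<phi> ?q (dirderiv w \<Psi> y) = dirderiv w (\<lambda>y. F (\<Psi> y)) y" if "w \<in> L" for w
      unfolding differential_eq[OF ext tan[OF that]]
      using y q by (intro dirderiv_compose[symmetric] smooth_on_imp_differentiable[OF W(3)] smooth_on_imp_differentiable[OF \<Psi>V]) auto
    have "first_fundamental_form U' (\<phi> ?q) (differential U \<phi> ?q (dirderiv u \<Psi> y)) (differential U \<phi> ?q (dirderiv v \<Psi> y)) =
        first_fundamental_form U ?q (dirderiv u \<Psi> y) (dirderiv v \<Psi> y)"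
      using iso q(1) tan uv unfolding riemannian_isometry_def by blast
    thus ?thesis using tan tan' uv by (simp add: diff first_fundamental_form_def)
  qed
  have "isometric_immersions V L \<Psi> (\<lambda>y. F (\<Psi> y)) M M' m (\<Phi> p)"
  proof
    show "inj_on (\<lambda>a. dirderiv a \<Psi> (\<Phi> p)) L"
      using inj_dirderiv_\<Psi>[of "\<Phi> p"] x by (auto simp: V_def intro: inj_on_subset)
    show "\<Psi> ` (V \<inter> L) \<subseteq> M" using \<Psi>U UM by auto
    show "(\<lambda>y. F (\<Psi> y)) ` (V \<inter> L) \<subseteq> M'" using FU(2) UM by auto
  qed (use V subspace_L \<Psi>V r' x dimL M M' metric in auto)
  moreover have "\<Psi> (\<Phi> p) = p" using pU by (rule chart_simps)
  moreover have "F (\<Psi> (\<Phi> p)) = \<phi> p" using FU(1)[OF x] calculation(2) by simp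
  ultimately show thesis by (rule that)
qed

section \<open>Gaussian expectations of determinants of linear forms\<close>

definition gauss_moment :: "nat \<Rightarrow> real" where
  "gauss_moment k = (\<integral>t. std_normal_density t * t ^ k \<partial>lborel)"

lemma gauss_moment_0: "gauss_moment 0 = 1"
  using integral_std_normal_moment_even[of 0] by (simp add: gauss_moment_def)

text \<open>One-dimensional integration by parts, obtained from the closed forms of the even and odd
  moments. At \<open>k = 0\<close> the truncated subtraction is harmless because of the factor
  \<open>real k\<close>.\<close>

lemma gauss_moment_Suc: "gauss_moment (Suc k) = real k * gauss_moment (k - 1)"
proof (cases "even k")
  case True
  then obtain j where j: "k = 2 * j" by (elim evenE)
  have "real k * gauss_moment (k - 1) = 0"
  proof (cases j)
    case (Suc i)
    hence "k - 1 = 2 * i + 1" using j by simp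
    thus ?thesis using integral_std_normal_moment_odd[of i] by (simp add: gauss_moment_def)
  qed (simp add: j)
  thus ?thesis using integral_std_normal_moment_odd[of j] j by (simp add: gauss_moment_def)
next
  case False
  then obtain j where j: "k = 2 * j + 1" by (elim oddE)
  have "gauss_moment (2 * Suc j) = real (2 * j + 1) * gauss_moment (2 * j)"
  proof -
    have "fact (2 * Suc j) / (2 ^ Suc j * fact (Suc j)) =
        (2 * (1 + real j)) * (real (2 * j + 1) * fact (2 * j)) / ((2 * (1 + real j)) * (2 ^ j * fact j))"
      by (simp add: algebra_simps)
    also have "\<dots> = real (2 * j + 1) * fact (2 * j) / (2 ^ j * fact j)"
      by (rule mult_divide_mult_cancel_left) simp
    finally show ?thesis unfolding gauss_moment_def integral_std_normal_moment_even by simp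
  qed
  thus ?thesis using j by simp
qed

definition std_gauss :: "'i set \<Rightarrow> ('i \<Rightarrow> real) \<Rightarrow> real" where
  "std_gauss B f = (\<Prod>c\<in>B. std_normal_density (f c))"

definition gauss_integrable :: "'i set \<Rightarrow> (('i \<Rightarrow> real) \<Rightarrow> real) \<Rightarrow> bool" where
  "gauss_integrable B P \<longleftrightarrow> integrable (\<Pi>\<^sub>M c\<in>B. lborel) (\<lambda>f. std_gauss B f * P f)"

definition gauss_expectation :: "'i set \<Rightarrow> (('i \<Rightarrow> real) \<Rightarrow> real) \<Rightarrow> real" where
  "gauss_expectation B P = (\<integral>f. std_gauss B f * P f \<partial>(\<Pi>\<^sub>M c\<in>B. lborel))"

lemma gauss_integrable_sum:
  assumes "\<And>i. i \<in> I \<Longrightarrow> gauss_integrable B (P i)"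
  shows "gauss_integrable B (\<lambda>f. \<Sum>i\<in>I. a i * P i f)"
proof -
  have "integrable (\<Pi>\<^sub>M c\<in>B. lborel) (\<lambda>f. \<Sum>i\<in>I. a i * (std_gauss B f * P i f))"
    using assms unfolding gauss_integrable_def by (intro Bochner_Integration.integrable_sum integrable_mult_right)
  thus ?thesis unfolding gauss_integrable_def by (simp add: sum_distrib_left mult_ac)
qed

lemma gauss_expectation_sum:
  assumes "\<And>i. i \<in> I \<Longrightarrow> gauss_integrable B (P i)"
  shows "gauss_expectation B (\<lambda>f. \<Sum>i\<in>I. a i * P i f) = (\<Sum>i\<in>I. a i * gauss_expectation B (P i))"
proof -
  have "gauss_expectation B (\<lambda>f. \<Sum>i\<in>I. a i * P i f) =
      (\<integral>f. (\<Sum>i\<in>I. a i * (std_gauss B f * P i f)) \<partial>(\<Pi>\<^sub>M c\<in>B. lborel))"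
    unfolding gauss_expectation_def by (simp add: sum_distrib_left mult_ac)
  also have "\<dots> = (\<Sum>i\<in>I. a i * gauss_expectation B (P i))"
    using assms unfolding gauss_integrable_def gauss_expectation_def
    by (subst Bochner_Integration.integral_sum) auto
  finally show ?thesis .
qed

lemma gauss_add:
  assumes "gauss_integrable B P" "gauss_integrable B Q"
  shows "gauss_integrable B (\<lambda>f. P f + Q f)"
    "gauss_expectation B (\<lambda>f. P f + Q f) = gauss_expectation B P + gauss_expectation B Q"
  using gauss_integrable_sum[of "{False, True}" B "\<lambda>i. if i then P else Q" "\<lambda>_. 1"]
    gauss_expectation_sum[of "{False, True}" B "\<lambda>i. if i then P else Q" "\<lambda>_. 1"] assms
  by (simp_all add: add.commute)

definition monomial_fun :: "'i set \<Rightarrow> ('i \<Rightarrow> nat) \<Rightarrow> ('i \<Rightarrow> real) \<Rightarrow> real" where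
  "monomial_fun B e f = (\<Prod>c\<in>B. f c ^ e c)"

lemma gauss_monomial:
  fixes e :: "'i \<Rightarrow> nat"
  assumes "finite B"
  shows "gauss_integrable B (monomial_fun B e)"
    "gauss_expectation B (monomial_fun B e) = (\<Prod>c\<in>B. gauss_moment (e c))"
proof -
  interpret product_sigma_finite "\<lambda>_ :: 'i. lborel :: real measure" by standard
  have eq: "(\<lambda>f. std_gauss B f * monomial_fun B e f) = (\<lambda>f. \<Prod>c\<in>B. std_normal_density (f c) * f c ^ e c)"
    by (simp add: std_gauss_def monomial_fun_def prod.distrib)
  show "gauss_integrable B (monomial_fun B e)"
    unfolding gauss_integrable_def eq
    by (rule product_integrable_prod[OF assms]) (rule integrable_std_normal_moment)
  show "gauss_expectation B (monomial_fun B e) = (\<Prod>c\<in>B. gauss_moment (e c))"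
    unfolding gauss_expectation_def eq gauss_moment_def
    by (rule product_integral_prod[OF assms]) (rule integrable_std_normal_moment)
qed

lemma monomial_fun_Suc:
  assumes "finite B" "b \<in> B"
  shows "monomial_fun B (e(b := Suc (e b))) f = f b * monomial_fun B e f"
  unfolding monomial_fun_def prod.remove[OF assms]
  by (simp cong: prod.cong_simp)

text \<open>Gaussian integration by parts in the coordinate \<open>b\<close>, with \<open>Q\<close> in the role of
  \<open>\<partial>P/\<partial>x\<^sub>b\<close>; carrying an arbitrary monomial factor makes it stable under multiplication by
  coordinates.\<close>

definition stein :: "'i set \<Rightarrow> 'i \<Rightarrow> (('i \<Rightarrow> real) \<Rightarrow> real) \<Rightarrow> (('i \<Rightarrow> real) \<Rightarrow> real) \<Rightarrow> bool" where
  "stein B b P Q \<longleftrightarrow> (\<forall>e.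
     gauss_integrable B (\<lambda>f. monomial_fun B e f * P f) \<and>
     gauss_integrable B (\<lambda>f. monomial_fun B e f * Q f) \<and>
     gauss_expectation B (\<lambda>f. f b * monomial_fun B e f * P f) =
       real (e b) * gauss_expectation B (\<lambda>f. monomial_fun B (e(b := e b - 1)) f * P f) +
       gauss_expectation B (\<lambda>f. monomial_fun B e f * Q f))"

text \<open>The coordinate \<open>f b\<close> raises the exponent of \<open>b\<close> by one, the
  expectation factors over the coordinates, and the moment recursion applies to the factor belonging
  to \<open>b\<close>.\<close>

lemma stein_1:
  assumes B: "finite B" "b \<in> B"
  shows "stein B b (\<lambda>_. 1) (\<lambda>_. 0)"
  unfolding stein_def
proof (intro allI conjI)
  fix e
  show "gauss_integrable B (\<lambda>f. monomial_fun B e f * 1)" using gauss_monomial(1)[OF B(1), of e] by simp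
  show "gauss_integrable B (\<lambda>f. monomial_fun B e f * 0)" by (simp add: gauss_integrable_def)
  have rest: "(\<Prod>c\<in>B - {b}. gauss_moment ((e(b := k)) c)) = (\<Prod>c\<in>B - {b}. gauss_moment (e c))" for k
    by (intro prod.cong) auto
  have "gauss_expectation B (\<lambda>f. f b * monomial_fun B e f * 1) = gauss_expectation B (monomial_fun B (e(b := Suc (e b))))"
    by (simp add: monomial_fun_Suc[OF B, abs_def])
  also have "\<dots> = real (e b) * gauss_expectation B (monomial_fun B (e(b := e b - 1)))"
    unfolding gauss_monomial(2)[OF B(1)] prod.remove[OF B] rest by (simp add: gauss_moment_Suc)
  finally show "gauss_expectation B (\<lambda>f. f b * monomial_fun B e f * 1) =
      real (e b) * gauss_expectation B (\<lambda>f. monomial_fun B (e(b := e b - 1)) f * 1) +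
      gauss_expectation B (\<lambda>f. monomial_fun B e f * 0)"
    by (simp add: gauss_expectation_def)
qed

text \<open>The new coordinate is absorbed into the monomial, where the assumption applies. If
  \<open>c = b\<close>, the exponent has grown to \<open>e b + 1\<close>: the share
  \<open>e b\<close> is the old term, and the share 1 is the product rule term for the new
  factor.\<close>

lemma stein_coordinate:
  assumes B: "finite B" "b \<in> B" "c \<in> B" and s: "stein B b P Q"
  shows "stein B b (\<lambda>f. f c * P f) (\<lambda>f. (if c = b then 1 else 0) * P f + f c * Q f)"
  unfolding stein_def
proof (intro allI conjI)
  fix e
  let ?e = "e(c := Suc (e c))"
  have eq: "monomial_fun B e f * (f c * R f) = monomial_fun B ?e f * R f" for R f
    by (simp add: monomial_fun_Suc[OF B(1,3)])
  have int: "gauss_integrable B (\<lambda>f. monomial_fun B e f * P f)" "gauss_integrable B (\<lambda>f. monomial_fun B e f * Q f)" for e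
    using s by (auto simp: stein_def)
  show "gauss_integrable B (\<lambda>f. monomial_fun B e f * (f c * P f))"
    unfolding eq by (rule int)
  have eqQ: "monomial_fun B e f * ((if c = b then 1 else 0) * P f + f c * Q f) =
      (if c = b then 1 else 0) * (monomial_fun B e f * P f) + monomial_fun B ?e f * Q f" for f
    by (simp only: monomial_fun_Suc[OF B(1,3)]) (simp add: algebra_simps)
  have delta: "gauss_integrable B (\<lambda>f. (if c = b then 1 else 0) * (monomial_fun B e f * P f))"
    using int(1)[of e] by (cases "c = b") (simp_all add: gauss_integrable_def)
  show "gauss_integrable B (\<lambda>f. monomial_fun B e f * ((if c = b then 1 else 0) * P f + f c * Q f))"
    unfolding eqQ by (intro gauss_add delta int)
  have "gauss_expectation B (\<lambda>f. f b * monomial_fun B e f * (f c * P f)) =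
      gauss_expectation B (\<lambda>f. f b * monomial_fun B ?e f * P f)"
    by (simp only: mult.assoc eq)
  also have "\<dots> = real (?e b) * gauss_expectation B (\<lambda>f. monomial_fun B (?e(b := ?e b - 1)) f * P f) +
      gauss_expectation B (\<lambda>f. monomial_fun B ?e f * Q f)"
    using s unfolding stein_def by blast
  also have "real (?e b) * gauss_expectation B (\<lambda>f. monomial_fun B (?e(b := ?e b - 1)) f * P f) =
      real (e b) * gauss_expectation B (\<lambda>f. monomial_fun B (e(b := e b - 1)) f * (f c * P f)) +
      gauss_expectation B (\<lambda>f. (if c = b then 1 else 0) * (monomial_fun B e f * P f))"
  proof (cases "c = b")
    case True
    \<comment> \<open>The truncated exponent \<open>e b - 1\<close> at \<open>e b = 0\<close> occurs
      only with the factor 0; otherwise multiplication by the coordinate restores the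
      exponent.\<close>
    have *: "real (e b) * gauss_expectation B (\<lambda>f. monomial_fun B (e(b := e b - 1)) f * (f c * P f)) =
        real (e b) * gauss_expectation B (\<lambda>f. monomial_fun B e f * P f)"
    proof (cases "e b")
      case (Suc k)
      have "(e(b := k))(b := Suc ((e(b := k)) b)) = e" using Suc by auto
      hence "monomial_fun B (e(b := e b - 1)) f * (f c * P f) = monomial_fun B e f * P f" for f
        using monomial_fun_Suc[OF B(1,2), of "e(b := k)" f] Suc True by simp
      thus ?thesis by (simp only:)
    qed simp
    have l: "real (?e b) * gauss_expectation B (\<lambda>f. monomial_fun B (?e(b := ?e b - 1)) f * P f) =
        real (e b) * gauss_expectation B (\<lambda>f. monomial_fun B e f * P f) + gauss_expectation B (\<lambda>f. monomial_fun B e f * P f)"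
      using True by (simp add: distrib_right)
    have r: "gauss_expectation B (\<lambda>f. (if c = b then 1 else 0) * (monomial_fun B e f * P f)) =
        gauss_expectation B (\<lambda>f. monomial_fun B e f * P f)" using True by simp
    show ?thesis unfolding l r * ..
  next
    case False
    have "e(c := Suc (e c), b := e b - 1) = (e(b := e b - 1))(c := Suc ((e(b := e b - 1)) c))"
      using False by auto
    hence shift: "monomial_fun B (?e(b := ?e b - 1)) f * P f = monomial_fun B (e(b := e b - 1)) f * (f c * P f)" for f
      using monomial_fun_Suc[OF B(1,3), of "e(b := e b - 1)" f] False by simp
    have zero: "gauss_expectation B (\<lambda>f. (if c = b then 1 else 0) * (monomial_fun B e f * P f)) = 0"
      using False by (simp add: gauss_expectation_def)
    show ?thesis unfolding shift zero using False by simp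
  qed
  finally show "gauss_expectation B (\<lambda>f. f b * monomial_fun B e f * (f c * P f)) =
      real (e b) * gauss_expectation B (\<lambda>f. monomial_fun B (e(b := e b - 1)) f * (f c * P f)) +
      gauss_expectation B (\<lambda>f. monomial_fun B e f * ((if c = b then 1 else 0) * P f + f c * Q f))"
    unfolding eqQ gauss_add(2)[OF delta int(2)] by (simp only: add.assoc)
qed

lemma stein_sum:
  assumes B: "finite B" "b \<in> B" and s: "\<And>i. i \<in> I \<Longrightarrow> stein B b (P i) (Q i)"
  shows "stein B b (\<lambda>f. \<Sum>i\<in>I. a i * P i f) (\<lambda>f. \<Sum>i\<in>I. a i * Q i f)"
proof -
  have eq: "y * (\<Sum>i\<in>I. a i * R i) = (\<Sum>i\<in>I. a i * (y * R i))" for y and R :: "'b \<Rightarrow> real"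
    by (simp add: sum_distrib_left mult_ac)
  have int: "gauss_integrable B (\<lambda>f. monomial_fun B e f * P i f)" "gauss_integrable B (\<lambda>f. monomial_fun B e f * Q i f)"
    if "i \<in> I" for e i using s[OF that] by (auto simp: stein_def)
  have int': "gauss_integrable B (\<lambda>f. f b * monomial_fun B e f * P i f)" if "i \<in> I" for e i
    using int(1)[OF that, of "e(b := Suc (e b))"] by (simp add: monomial_fun_Suc[OF B])
  show ?thesis
    unfolding stein_def eq
  proof (intro allI conjI gauss_integrable_sum int)
    fix e
    show "gauss_expectation B (\<lambda>f. \<Sum>i\<in>I. a i * (f b * monomial_fun B e f * P i f)) =
      real (e b) * gauss_expectation B (\<lambda>f. \<Sum>i\<in>I. a i * (monomial_fun B (e(b := e b - 1)) f * P i f)) +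
      gauss_expectation B (\<lambda>f. \<Sum>i\<in>I. a i * (monomial_fun B e f * Q i f))"
    proof -
      have "gauss_expectation B (\<lambda>f. \<Sum>i\<in>I. a i * (f b * monomial_fun B e f * P i f)) =
          (\<Sum>i\<in>I. a i * gauss_expectation B (\<lambda>f. f b * monomial_fun B e f * P i f))"
        by (rule gauss_expectation_sum[OF int'])
      also have "\<dots> = (\<Sum>i\<in>I. a i * (real (e b) * gauss_expectation B (\<lambda>f. monomial_fun B (e(b := e b - 1)) f * P i f) +
          gauss_expectation B (\<lambda>f. monomial_fun B e f * Q i f)))"
        using s unfolding stein_def by (intro sum.cong refl arg_cong2[where f = "(*)"]) blast
      also have "\<dots> = real (e b) * (\<Sum>i\<in>I. a i * gauss_expectation B (\<lambda>f. monomial_fun B (e(b := e b - 1)) f * P i f)) +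
          (\<Sum>i\<in>I. a i * gauss_expectation B (\<lambda>f. monomial_fun B e f * Q i f))"
        unfolding sum_distrib_left sum.distrib[symmetric] by (intro sum.cong refl) (simp only: distrib_left mult.left_commute)
      finally show ?thesis by (simp only: gauss_expectation_sum[OF int(1)] gauss_expectation_sum[OF int(2)])
    qed
  qed
qed

text \<open>The second function is the partial derivative by \<open>b\<close> according to the
  product rule. The induction writes the new linear factor in coordinates, each covered by
  \<open>stein_coordinate\<close>.\<close>

lemma stein_linear_prod:
  fixes a :: "'k \<Rightarrow> 'i \<Rightarrow> real"
  assumes B: "finite B" "b \<in> B" and I: "finite I"
  shows "stein B b (\<lambda>f. \<Prod>i\<in>I. \<Sum>c\<in>B. a i c * f c)
    (\<lambda>f. \<Sum>k\<in>I. a k b * (\<Prod>i\<in>I - {k}. \<Sum>c\<in>B. a i c * f c))"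
  using I
proof induction
  case empty
  show ?case using stein_1[OF B] by simp
next
  case (insert j I)
  let ?l = "\<lambda>i f. \<Sum>c\<in>B. a i c * f c"
  let ?P = "\<lambda>f. \<Prod>i\<in>I. ?l i f" and ?Q = "\<lambda>f. \<Sum>k\<in>I. a k b * (\<Prod>i\<in>I - {k}. ?l i f)"
  have "stein B b (\<lambda>f. \<Sum>c\<in>B. a j c * (f c * ?P f))
      (\<lambda>f. \<Sum>c\<in>B. a j c * ((if c = b then 1 else 0) * ?P f + f c * ?Q f))"
    using insert.IH by (intro stein_sum[OF B] stein_coordinate[OF B])
  moreover have "(\<Sum>c\<in>B. a j c * (f c * ?P f)) = (\<Prod>i\<in>insert j I. ?l i f)" for f
    using insert.hyps by (simp add: sum_distrib_right mult.assoc)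
  moreover have "(\<Sum>c\<in>B. a j c * ((if c = b then 1 else 0) * ?P f + f c * ?Q f)) =
      (\<Sum>k\<in>insert j I. a k b * (\<Prod>i\<in>insert j I - {k}. ?l i f))" for f
  proof -
    have "(\<Sum>c\<in>B. a j c * ((if c = b then 1 else 0) * ?P f + f c * ?Q f)) =
        (\<Sum>c\<in>B. (if c = b then a j b * ?P f else 0)) + (\<Sum>c\<in>B. a j c * f c * ?Q f)"
      unfolding sum.distrib[symmetric] by (intro sum.cong) (auto simp: algebra_simps)
    also have "\<dots> = a j b * ?P f + ?l j f * ?Q f"
      using B by (simp add: sum_distrib_right)
    also have "?l j f * ?Q f = (\<Sum>k\<in>I. a k b * (\<Prod>i\<in>insert j I - {k}. ?l i f))"
      unfolding sum_distrib_left
    proof (intro sum.cong refl)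
      fix k assume "k \<in> I"
      hence "insert j I - {k} = insert j (I - {k})" "j \<notin> I - {k}" using insert.hyps by auto
      thus "?l j f * (a k b * (\<Prod>i\<in>I - {k}. ?l i f)) = a k b * (\<Prod>i\<in>insert j I - {k}. ?l i f)"
        using insert.hyps by simp
    qed
    also have "a j b * ?P f + \<dots> = (\<Sum>k\<in>insert j I. a k b * (\<Prod>i\<in>insert j I - {k}. ?l i f))"
      using insert.hyps by simp
    finally show ?thesis .
  qed
  ultimately show ?case by simp
qed

text \<open>Wick's recursion, also known as Isserlis' theorem: the factor \<open>j\<close> is
  expanded in coordinates and integrated by parts in each of them. The sum of the
  \<open>a j c * a k c\<close> is the covariance of the linear forms \<open>j\<close> and
  \<open>k\<close>.\<close>

lemma gauss_linear_prod:
  fixes a :: "'k \<Rightarrow> 'i \<Rightarrow> real"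
  assumes B: "finite B" and I: "finite I"
  shows "gauss_integrable B (\<lambda>f. \<Prod>i\<in>I. \<Sum>c\<in>B. a i c * f c)"
    and "j \<in> I \<Longrightarrow> gauss_expectation B (\<lambda>f. \<Prod>i\<in>I. \<Sum>c\<in>B. a i c * f c) =
      (\<Sum>k\<in>I - {j}. (\<Sum>c\<in>B. a j c * a k c) * gauss_expectation B (\<lambda>f. \<Prod>i\<in>I - {j, k}. \<Sum>c\<in>B. a i c * f c))"
proof -
  have int: "gauss_integrable B (\<lambda>f. \<Prod>i\<in>J. \<Sum>c\<in>B. a i c * f c)" if J: "finite J" for J
  proof (cases "B = {}")
    \<comment> \<open>Integration by parts needs a coordinate. Without any, the product measure is a
      point mass, where every function is integrable.\<close>
    case True
    thus ?thesis unfolding gauss_integrable_def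
      by (simp add: True PiM_empty std_gauss_def integrable_count_space)
  next
    case False
    then obtain b where "b \<in> B" by blast
    from stein_linear_prod[OF B this J, of a] have
      "gauss_integrable B (\<lambda>f. monomial_fun B (\<lambda>_. 0) f * (\<Prod>i\<in>J. \<Sum>c\<in>B. a i c * f c))"
      unfolding stein_def by blast
    thus ?thesis by (simp add: monomial_fun_def)
  qed
  show "gauss_integrable B (\<lambda>f. \<Prod>i\<in>I. \<Sum>c\<in>B. a i c * f c)" by (rule int[OF I])
  assume j: "j \<in> I"
  let ?P = "\<lambda>J f. \<Prod>i\<in>J. \<Sum>c\<in>B. a i c * f c"
  have J: "finite (I - {j})" using I by simp
  have parts: "gauss_integrable B (\<lambda>f. f b * ?P (I - {j}) f)"
    "gauss_expectation B (\<lambda>f. f b * ?P (I - {j}) f) = (\<Sum>k\<in>I - {j}. a k b * gauss_expectation B (?P (I - {j, k})))"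
    if b: "b \<in> B" for b
  proof -
    have 0: "monomial_fun B (\<lambda>_. 0) f = 1" "monomial_fun B ((\<lambda>_. 0)(b := Suc 0)) f = f b" for f
      using monomial_fun_Suc[OF B b, of "\<lambda>_. 0" f] by (simp_all add: monomial_fun_def)
    note s = stein_linear_prod[OF B b J, of a, unfolded stein_def]
    show "gauss_integrable B (\<lambda>f. f b * ?P (I - {j}) f)"
      using s[THEN spec[of _ "(\<lambda>_. 0)(b := Suc 0)"]] by (simp add: 0)
    have "gauss_expectation B (\<lambda>f. f b * ?P (I - {j}) f) =
        gauss_expectation B (\<lambda>f. \<Sum>k\<in>I - {j}. a k b * ?P (I - {j} - {k}) f)"
      using s[THEN spec[of _ "\<lambda>_. 0"]] by (simp add: 0)
    also have "\<dots> = (\<Sum>k\<in>I - {j}. a k b * gauss_expectation B (?P (I - {j} - {k})))"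
      using I by (intro gauss_expectation_sum int) auto
    also have "\<dots> = (\<Sum>k\<in>I - {j}. a k b * gauss_expectation B (?P (I - {j, k})))"
      by (intro sum.cong refl) (simp add: Diff_insert2[symmetric] Diff_insert[symmetric] insert_commute)
    finally show "gauss_expectation B (\<lambda>f. f b * ?P (I - {j}) f) =
        (\<Sum>k\<in>I - {j}. a k b * gauss_expectation B (?P (I - {j, k})))" .
  qed
  have "gauss_expectation B (?P I) = gauss_expectation B (\<lambda>f. \<Sum>b\<in>B. a j b * (f b * ?P (I - {j}) f))"
    by (simp add: prod.remove[OF I j] sum_distrib_right mult.assoc)
  also have "\<dots> = (\<Sum>b\<in>B. a j b * (\<Sum>k\<in>I - {j}. a k b * gauss_expectation B (?P (I - {j, k}))))"
    by (simp add: gauss_expectation_sum parts)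
  also have "\<dots> = (\<Sum>k\<in>I - {j}. (\<Sum>c\<in>B. a j c * a k c) * gauss_expectation B (?P (I - {j, k})))"
    unfolding sum_distrib_left sum_distrib_right by (subst sum.swap) (simp add: mult.assoc)
  finally show "gauss_expectation B (?P I) =
      (\<Sum>k\<in>I - {j}. (\<Sum>c\<in>B. a j c * a k c) * gauss_expectation B (?P (I - {j, k})))" .
qed

text \<open>By the recursion \<open>step\<close>, \<open>X I \<sigma>\<close> is the sum over all perfect matchings of \<open>I\<close> of the products
  of the \<open>g i (\<sigma> i) k (\<sigma> k)\<close>, times \<open>X {} \<sigma>\<close>.  Composing \<open>\<sigma>\<close> with the transposition of a matched pair changes its
  sign, so only the antisymmetrization of \<open>g\<close> contributes to the signed sum.\<close>

lemma signed_matching_sum_eq: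
  fixes X X' :: "nat set \<Rightarrow> (nat \<Rightarrow> nat) \<Rightarrow> real" and g g' :: "nat \<Rightarrow> nat \<Rightarrow> nat \<Rightarrow> nat \<Rightarrow> real"
  assumes emp: "\<And>\<sigma>. X {} \<sigma> = X' {} \<sigma>"
    and step: "\<And>I \<sigma> j. finite I \<Longrightarrow> j \<in> I \<Longrightarrow> X I \<sigma> = (\<Sum>k\<in>I - {j}. g j (\<sigma> j) k (\<sigma> k) * X (I - {j, k}) \<sigma>)"
    and step': "\<And>I \<sigma> j. finite I \<Longrightarrow> j \<in> I \<Longrightarrow> X' I \<sigma> = (\<Sum>k\<in>I - {j}. g' j (\<sigma> j) k (\<sigma> k) * X' (I - {j, k}) \<sigma>)"
    and dep: "\<And>I \<sigma> \<tau>. (\<And>i. i \<in> I \<Longrightarrow> \<sigma> i = \<tau> i) \<Longrightarrow> X I \<sigma> = X I \<tau>"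
    and dep': "\<And>I \<sigma> \<tau>. (\<And>i. i \<in> I \<Longrightarrow> \<sigma> i = \<tau> i) \<Longrightarrow> X' I \<sigma> = X' I \<tau>"
    and gauss: "\<And>i j k l. i < m \<Longrightarrow> j < m \<Longrightarrow> k < m \<Longrightarrow> l < m \<Longrightarrow> g i j k l - g i l k j = g' i j k l - g' i l k j"
  shows "I \<subseteq> {0..<m} \<Longrightarrow> (\<And>\<sigma> a b. a \<in> I \<Longrightarrow> b \<in> I \<Longrightarrow> c (\<sigma> \<circ> Transposition.transpose a b) = c \<sigma>) \<Longrightarrow>
    (\<Sum>\<sigma> | \<sigma> permutes {0..<m}. of_int (sign \<sigma>) * c \<sigma> * X I \<sigma>) =
    (\<Sum>\<sigma> | \<sigma> permutes {0..<m}. of_int (sign \<sigma>) * c \<sigma> * X' I \<sigma>)"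
\<comment> \<open>The weight \<open>c\<close> varies in the induction because each contraction moves
  the antisymmetrized factor of the pair \<open>j\<close>, \<open>k\<close> into it. This factor
  depends only on the values of the permutation at \<open>j\<close> and \<open>k\<close>, so
  invariance under transpositions of the remaining indices persists.\<close>
proof (induction "card I" arbitrary: I c rule: less_induct)
  case less
  let ?P = "{\<sigma>. \<sigma> permutes {0..<m}}"
  have fin: "finite I" using less.prems(1) finite_subset by blast
  show ?case
  proof (cases "I = {}")
    case True
    thus ?thesis using emp by simp
  next
    case False
    then obtain j where j: "j \<in> I" by blast
    have antisym: "(\<Sum>\<sigma>\<in>?P. of_int (sign \<sigma>) * c \<sigma> * (h j (\<sigma> j) k (\<sigma> k) * Y (I - {j, k}) \<sigma>)) =
        (\<Sum>\<sigma>\<in>?P. of_int (sign \<sigma>) * (c \<sigma> * (h j (\<sigma> j) k (\<sigma> k) - h j (\<sigma> k) k (\<sigma> j))) * Y (I - {j, k}) \<sigma>) / 2"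
      if k: "k \<in> I - {j}" and Y: "\<And>I \<sigma> \<tau>. (\<And>i. i \<in> I \<Longrightarrow> \<sigma> i = \<tau> i) \<Longrightarrow> Y I \<sigma> = Y I \<tau>"
      for k and Y :: "nat set \<Rightarrow> (nat \<Rightarrow> nat) \<Rightarrow> real" and h :: "nat \<Rightarrow> nat \<Rightarrow> nat \<Rightarrow> nat \<Rightarrow> real"
    proof -
      let ?t = "Transposition.transpose j k"
      have t: "?t permutes {0..<m}" using j k less.prems(1) by (intro permutes_swap_id) auto
      let ?S = "\<lambda>\<sigma>. of_int (sign \<sigma>) * c \<sigma> * (h j (\<sigma> j) k (\<sigma> k) * Y (I - {j, k}) \<sigma>)"
      have "?S (\<sigma> \<circ> ?t) = - (of_int (sign \<sigma>) * c \<sigma> * (h j (\<sigma> k) k (\<sigma> j) * Y (I - {j, k}) \<sigma>))"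
        if "\<sigma> \<in> ?P" for \<sigma>
      proof -
        have "sign (\<sigma> \<circ> ?t) = - sign \<sigma>"
          using that k permutes_imp_permutation[OF _ t] permutes_imp_permutation[of "{0..<m}" \<sigma>]
          by (subst sign_compose) (auto simp: sign_swap_id)
        moreover have "Y (I - {j, k}) (\<sigma> \<circ> ?t) = Y (I - {j, k}) \<sigma>"
          by (rule Y) (auto simp: transpose_apply_other)
        moreover have "c (\<sigma> \<circ> ?t) = c \<sigma>" using less.prems(2) j k by blast
        ultimately show ?thesis by simp
      qed
      hence "sum ?S ?P = (\<Sum>\<sigma>\<in>?P. - (of_int (sign \<sigma>) * c \<sigma> * (h j (\<sigma> k) k (\<sigma> j) * Y (I - {j, k}) \<sigma>)))"
        unfolding sum_permutations_compose_right[OF t, of ?S] by (intro sum.cong) auto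
      \<comment> \<open>The sum is averaged with its image under composition with the transposition,
        whence the division by 2 in the claim.\<close>
      hence "sum ?S ?P + sum ?S ?P = (\<Sum>\<sigma>\<in>?P. ?S \<sigma> - of_int (sign \<sigma>) * c \<sigma> * (h j (\<sigma> k) k (\<sigma> j) * Y (I - {j, k}) \<sigma>))"
        by (simp add: sum_subtractf sum_negf)
      also have "\<dots> = (\<Sum>\<sigma>\<in>?P. of_int (sign \<sigma>) * (c \<sigma> * (h j (\<sigma> j) k (\<sigma> k) - h j (\<sigma> k) k (\<sigma> j))) * Y (I - {j, k}) \<sigma>)"
        by (intro sum.cong) (simp_all add: algebra_simps)
      finally show ?thesis by simp
    qed
    have expand: "(\<Sum>\<sigma>\<in>?P. of_int (sign \<sigma>) * c \<sigma> * Y I \<sigma>) =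
        (\<Sum>k\<in>I - {j}. (\<Sum>\<sigma>\<in>?P. of_int (sign \<sigma>) * (c \<sigma> * (h j (\<sigma> j) k (\<sigma> k) - h j (\<sigma> k) k (\<sigma> j))) * Y (I - {j, k}) \<sigma>) / 2)"
      if Y: "\<And>I \<sigma> \<tau>. (\<And>i. i \<in> I \<Longrightarrow> \<sigma> i = \<tau> i) \<Longrightarrow> Y I \<sigma> = Y I \<tau>"
        and st: "\<And>\<sigma>. Y I \<sigma> = (\<Sum>k\<in>I - {j}. h j (\<sigma> j) k (\<sigma> k) * Y (I - {j, k}) \<sigma>)"
      for Y :: "nat set \<Rightarrow> (nat \<Rightarrow> nat) \<Rightarrow> real" and h :: "nat \<Rightarrow> nat \<Rightarrow> nat \<Rightarrow> nat \<Rightarrow> real"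
    proof -
      have "(\<Sum>\<sigma>\<in>?P. of_int (sign \<sigma>) * c \<sigma> * Y I \<sigma>) =
          (\<Sum>k\<in>I - {j}. \<Sum>\<sigma>\<in>?P. of_int (sign \<sigma>) * c \<sigma> * (h j (\<sigma> j) k (\<sigma> k) * Y (I - {j, k}) \<sigma>))"
        unfolding st sum_distrib_left by (rule sum.swap)
      also have "\<dots> = (\<Sum>k\<in>I - {j}. (\<Sum>\<sigma>\<in>?P. of_int (sign \<sigma>) * (c \<sigma> * (h j (\<sigma> j) k (\<sigma> k) - h j (\<sigma> k) k (\<sigma> j))) * Y (I - {j, k}) \<sigma>) / 2)"
        by (intro sum.cong refl antisym Y)
      finally show ?thesis .
    qed
    have main: "(\<Sum>\<sigma>\<in>?P. of_int (sign \<sigma>) * (c \<sigma> * (g j (\<sigma> j) k (\<sigma> k) - g j (\<sigma> k) k (\<sigma> j))) * X (I - {j, k}) \<sigma>) =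
        (\<Sum>\<sigma>\<in>?P. of_int (sign \<sigma>) * (c \<sigma> * (g' j (\<sigma> j) k (\<sigma> k) - g' j (\<sigma> k) k (\<sigma> j))) * X' (I - {j, k}) \<sigma>)"
      if k: "k \<in> I - {j}" for k
    proof -
      let ?c = "\<lambda>\<sigma>. c \<sigma> * (g j (\<sigma> j) k (\<sigma> k) - g j (\<sigma> k) k (\<sigma> j))"
      have "(\<Sum>\<sigma>\<in>?P. of_int (sign \<sigma>) * ?c \<sigma> * X (I - {j, k}) \<sigma>) =
          (\<Sum>\<sigma>\<in>?P. of_int (sign \<sigma>) * ?c \<sigma> * X' (I - {j, k}) \<sigma>)"
      proof (rule less.hyps)
        show "card (I - {j, k}) < card I" using j fin by (intro psubset_card_mono) auto
        show "I - {j, k} \<subseteq> {0..<m}" using less.prems(1) by blast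
        show "?c (\<sigma> \<circ> Transposition.transpose a b) = ?c \<sigma>"
          if "a \<in> I - {j, k}" "b \<in> I - {j, k}" for \<sigma> a b
          using that less.prems(2)[of a b \<sigma>] by (auto simp: transpose_apply_other)
      qed
      \<comment> \<open>The induction hypothesis has replaced \<open>X\<close> by \<open>X'\<close>
        with weights still built from \<open>g\<close>; now \<open>gauss\<close> exchanges the
        weights. It applies because a permutation keeps all four indices below
        \<open>m\<close>.\<close>
      also have "\<dots> = (\<Sum>\<sigma>\<in>?P. of_int (sign \<sigma>) * (c \<sigma> * (g' j (\<sigma> j) k (\<sigma> k) - g' j (\<sigma> k) k (\<sigma> j))) * X' (I - {j, k}) \<sigma>)"
      proof (intro sum.cong refl)
        fix \<sigma> assume "\<sigma> \<in> ?P"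
        hence "\<sigma> j < m" "\<sigma> k < m" "j < m" "k < m"
          using j k less.prems(1) permutes_in_image[of \<sigma> "{0..<m}"] by force+
        thus "of_int (sign \<sigma>) * ?c \<sigma> * X' (I - {j, k}) \<sigma> =
            of_int (sign \<sigma>) * (c \<sigma> * (g' j (\<sigma> j) k (\<sigma> k) - g' j (\<sigma> k) k (\<sigma> j))) * X' (I - {j, k}) \<sigma>"
          using gauss by simp
      qed
      finally show ?thesis .
    qed
    have "(\<Sum>k\<in>I - {j}. (\<Sum>\<sigma>\<in>?P. of_int (sign \<sigma>) * (c \<sigma> * (g j (\<sigma> j) k (\<sigma> k) - g j (\<sigma> k) k (\<sigma> j))) * X (I - {j, k}) \<sigma>) / 2) =
        (\<Sum>k\<in>I - {j}. (\<Sum>\<sigma>\<in>?P. of_int (sign \<sigma>) * (c \<sigma> * (g' j (\<sigma> j) k (\<sigma> k) - g' j (\<sigma> k) k (\<sigma> j))) * X' (I - {j, k}) \<sigma>) / 2)"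
      by (rule sum.cong[OF refl]) (simp only: main)
    moreover have "(\<Sum>\<sigma>\<in>?P. of_int (sign \<sigma>) * c \<sigma> * X I \<sigma>) =
        (\<Sum>k\<in>I - {j}. (\<Sum>\<sigma>\<in>?P. of_int (sign \<sigma>) * (c \<sigma> * (g j (\<sigma> j) k (\<sigma> k) - g j (\<sigma> k) k (\<sigma> j))) * X (I - {j, k}) \<sigma>) / 2)"
      by (rule expand) (fact dep, fact step[OF fin j])
    moreover have "(\<Sum>\<sigma>\<in>?P. of_int (sign \<sigma>) * c \<sigma> * X' I \<sigma>) =
        (\<Sum>k\<in>I - {j}. (\<Sum>\<sigma>\<in>?P. of_int (sign \<sigma>) * (c \<sigma> * (g' j (\<sigma> j) k (\<sigma> k) - g' j (\<sigma> k) k (\<sigma> j))) * X' (I - {j, k}) \<sigma>) / 2)"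
      by (rule expand) (fact dep', fact step'[OF fin j])
    ultimately show ?thesis by (simp only:)
  qed
qed

section \<open>Comparison of Gaussian expectations of two determinants\<close>

lemma orthonormal_basis_of_inner:
  assumes B: "orthonormal_basis_of N B" and w: "w \<in> N"
  shows "(\<Sum>b\<in>B. (v \<bullet> b) * (w \<bullet> b)) = v \<bullet> w"
proof -
  have fin: "finite B" by (rule orthonormal_basis_ofD[OF B])
  have orth: "b \<bullet> c = (if b = c then 1 else 0)" if "b \<in> B" "c \<in> B" for b c
    using B that by (auto simp: orthonormal_basis_of_def pairwise_def orthogonal_def norm_eq_1)
  have "w \<in> span B" using B w by (simp add: orthonormal_basis_of_def)
  then obtain u where u: "w = (\<Sum>b\<in>B. u b *\<^sub>R b)" unfolding span_finite[OF fin] by blast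
  have "w \<bullet> b = u b" if "b \<in> B" for b
    using that fin by (simp add: u inner_sum_left orth if_distrib[of "(*) _"] cong: if_cong)
  thus ?thesis unfolding u by (simp add: inner_sum_right mult.commute)
qed

lemma det_inner_expand:
  fixes A :: "nat \<Rightarrow> nat \<Rightarrow> 'a::euclidean_space"
  shows "Determinant.det (Matrix.mat m m (\<lambda>(i, j). A i j \<bullet> v)) =
    (\<Sum>\<sigma> | \<sigma> permutes {0..<m}. of_int (sign \<sigma>) * (\<Prod>i=0..<m. A i (\<sigma> i) \<bullet> v))"
  unfolding det_def'[OF mat_carrier]
proof (intro sum.cong refl arg_cong2[where f = "(*)"] prod.cong)
  fix \<sigma> i assume "\<sigma> \<in> {\<sigma>. \<sigma> permutes {0..<m}}" "i \<in> {0..<m}"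
  hence "\<sigma> i < m" "i < m" using permutes_in_image[of \<sigma> "{0..<m}" i] by auto
  thus "Matrix.mat m m (\<lambda>(i, j). A i j \<bullet> v) $$ (i, \<sigma> i) = A i (\<sigma> i) \<bullet> v" by simp
qed

lemma gauss_det:
  fixes A :: "nat \<Rightarrow> nat \<Rightarrow> 'a::euclidean_space"
  assumes "finite B"
  shows "gauss_integrable B (\<lambda>f. Determinant.det (Matrix.mat m m (\<lambda>(i, j). A i j \<bullet> (\<Sum>b\<in>B. f b *\<^sub>R b))))"
    and "gauss_expectation B (\<lambda>f. Determinant.det (Matrix.mat m m (\<lambda>(i, j). A i j \<bullet> (\<Sum>b\<in>B. f b *\<^sub>R b)))) =
      (\<Sum>\<sigma> | \<sigma> permutes {0..<m}. of_int (sign \<sigma>) * gauss_expectation B (\<lambda>f. \<Prod>i=0..<m. \<Sum>b\<in>B. (A i (\<sigma> i) \<bullet> b) * f b))"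
proof -
  have "A i j \<bullet> (\<Sum>b\<in>B. f b *\<^sub>R b) = (\<Sum>b\<in>B. (A i j \<bullet> b) * f b)" for i j f
    by (simp add: inner_sum_right mult.commute)
  thus "gauss_integrable B (\<lambda>f. Determinant.det (Matrix.mat m m (\<lambda>(i, j). A i j \<bullet> (\<Sum>b\<in>B. f b *\<^sub>R b))))"
    "gauss_expectation B (\<lambda>f. Determinant.det (Matrix.mat m m (\<lambda>(i, j). A i j \<bullet> (\<Sum>b\<in>B. f b *\<^sub>R b)))) =
      (\<Sum>\<sigma> | \<sigma> permutes {0..<m}. of_int (sign \<sigma>) * gauss_expectation B (\<lambda>f. \<Prod>i=0..<m. \<Sum>b\<in>B. (A i (\<sigma> i) \<bullet> b) * f b))"
    unfolding det_inner_expand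
    by (simp_all only: gauss_integrable_sum gauss_expectation_sum gauss_linear_prod(1)[OF assms finite_atLeastLessThan])
qed

text \<open>The covariances of the linear forms are the products
  \<open>A i j \<bullet> A k l\<close>, by Parseval in the space that contains the entries. The
  empty product has expectation 1 on both sides, so the dimension leaves no trace in the matching
  sums and spaces of different dimension can be compared.\<close>

lemma gauss_expectation_det_eq:
  fixes A :: "nat \<Rightarrow> nat \<Rightarrow> 'a::euclidean_space" and A' :: "nat \<Rightarrow> nat \<Rightarrow> 'b::euclidean_space"
  assumes B: "orthonormal_basis_of N B" and B': "orthonormal_basis_of N' B'"
    and A: "\<And>i j. i < m \<Longrightarrow> j < m \<Longrightarrow> A i j \<in> N" and A': "\<And>i j. i < m \<Longrightarrow> j < m \<Longrightarrow> A' i j \<in> N'"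
    and gauss: "\<And>i j k l. i < m \<Longrightarrow> j < m \<Longrightarrow> k < m \<Longrightarrow> l < m \<Longrightarrow>
      A i j \<bullet> A k l - A i l \<bullet> A k j = A' i j \<bullet> A' k l - A' i l \<bullet> A' k j"
  shows "gauss_expectation B (\<lambda>f. Determinant.det (Matrix.mat m m (\<lambda>(i, j). A i j \<bullet> (\<Sum>b\<in>B. f b *\<^sub>R b)))) =
    gauss_expectation B' (\<lambda>f. Determinant.det (Matrix.mat m m (\<lambda>(i, j). A' i j \<bullet> (\<Sum>b\<in>B'. f b *\<^sub>R b))))"
proof -
  let ?P = "{\<sigma>. \<sigma> permutes {0..<m}}"
  define X where "X I \<sigma> = gauss_expectation B (\<lambda>f. \<Prod>i\<in>I. \<Sum>b\<in>B. (A i (\<sigma> i) \<bullet> b) * f b)" for I \<sigma>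
  define X' where "X' I \<sigma> = gauss_expectation B' (\<lambda>f. \<Prod>i\<in>I. \<Sum>b\<in>B'. (A' i (\<sigma> i) \<bullet> b) * f b)" for I \<sigma>
  have fin: "finite B" "finite B'" using orthonormal_basis_ofD[OF B] orthonormal_basis_ofD[OF B'] by auto
  have "(\<Sum>\<sigma>\<in>?P. of_int (sign \<sigma>) * 1 * X {0..<m} \<sigma>) = (\<Sum>\<sigma>\<in>?P. of_int (sign \<sigma>) * 1 * X' {0..<m} \<sigma>)"
  proof (rule signed_matching_sum_eq[where
        g = "\<lambda>i j k l. \<Sum>b\<in>B. (A i j \<bullet> b) * (A k l \<bullet> b)" and g' = "\<lambda>i j k l. \<Sum>b\<in>B'. (A' i j \<bullet> b) * (A' k l \<bullet> b)"])
    show "X {} \<sigma> = X' {} \<sigma>" for \<sigma>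
      using gauss_monomial(2)[OF fin(1), of "\<lambda>_. 0"] gauss_monomial(2)[OF fin(2), of "\<lambda>_. 0"]
      by (simp add: X_def X'_def monomial_fun_def[abs_def] gauss_moment_0)
    show "X I \<sigma> = X I \<tau>" if "\<And>i. i \<in> I \<Longrightarrow> \<sigma> i = \<tau> i" for I \<sigma> \<tau>
      unfolding X_def using that by (simp cong: prod.cong)
    show "X' I \<sigma> = X' I \<tau>" if "\<And>i. i \<in> I \<Longrightarrow> \<sigma> i = \<tau> i" for I \<sigma> \<tau>
      unfolding X'_def using that by (simp cong: prod.cong)
    show "X I \<sigma> = (\<Sum>k\<in>I - {j}. (\<Sum>b\<in>B. (A j (\<sigma> j) \<bullet> b) * (A k (\<sigma> k) \<bullet> b)) * X (I - {j, k}) \<sigma>)"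
      if "finite I" "j \<in> I" for I \<sigma> j
      unfolding X_def by (rule gauss_linear_prod(2)[OF fin(1) that])
    show "X' I \<sigma> = (\<Sum>k\<in>I - {j}. (\<Sum>b\<in>B'. (A' j (\<sigma> j) \<bullet> b) * (A' k (\<sigma> k) \<bullet> b)) * X' (I - {j, k}) \<sigma>)"
      if "finite I" "j \<in> I" for I \<sigma> j
      unfolding X'_def by (rule gauss_linear_prod(2)[OF fin(2) that])
  qed (use gauss A A' in \<open>simp_all add: orthonormal_basis_of_inner[OF B] orthonormal_basis_of_inner[OF B']\<close>)
  thus ?thesis unfolding gauss_det(2)[OF fin(1)] gauss_det(2)[OF fin(2)] X_def X'_def by (simp only: mult_1_right)
qed

section \<open>Integration over unit spheres\<close>

text \<open>A product measure is determined by its values on boxes. There \<open>c ^ card B\<close>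
  is distributed as one factor \<open>c\<close> to each coordinate, which compensates the
  one-dimensional scaling.\<close>

lemma nn_integral_PiM_lborel_scale:
  fixes B :: "'i set"
  assumes B: "finite B" and c: "c > 0" and g: "g \<in> borel_measurable (\<Pi>\<^sub>M b\<in>B. (lborel :: real measure))"
  shows "(\<integral>\<^sup>+f. g f \<partial>(\<Pi>\<^sub>M b\<in>B. lborel)) =
    ennreal (c ^ card B) * (\<integral>\<^sup>+f. g (\<lambda>b\<in>B. c * f b) \<partial>(\<Pi>\<^sub>M b\<in>B. lborel))"
proof -
  interpret product_sigma_finite "\<lambda>_ :: 'i. lborel :: real measure" by standard
  let ?M = "\<Pi>\<^sub>M b\<in>B. (lborel :: real measure)"
  let ?s = "\<lambda>f. \<lambda>b\<in>B. c * f b"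
  have s[measurable]: "?s \<in> ?M \<rightarrow>\<^sub>M ?M"
    by (rule measurable_restrict) measurable
  have "scale_measure (ennreal (c ^ card B)) (distr ?M ?M ?s) = ?M"
  proof (rule PiM_eqI[OF B])
    fix A :: "'i \<Rightarrow> real set" assume A: "\<And>i. i \<in> B \<Longrightarrow> A i \<in> sets lborel"
    have pre: "(\<lambda>x. c * x) -` A i \<in> sets lborel" if "i \<in> B" for i
      using measurable_sets[of "\<lambda>x. c * x" borel borel "A i"] A[OF that] by simp
    have one: "ennreal c * emeasure lborel ((\<lambda>x. c * x) -` A i) = emeasure lborel (A i)" if "i \<in> B" for i
    proof -
      have "emeasure lborel (A i) = emeasure (density (distr lborel borel (\<lambda>x. 0 + c * x)) (\<lambda>_. ennreal \<bar>c\<bar>)) (A i)"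
        using lborel_real_affine[of c 0] c by simp
      also have "\<dots> = ennreal c * emeasure lborel ((\<lambda>x. c * x) -` A i)"
        using c A[OF that] by (subst emeasure_density_const) (auto simp: emeasure_distr)
      finally show ?thesis by simp
    qed
    have "?s -` (Pi\<^sub>E B A) \<inter> space ?M = Pi\<^sub>E B (\<lambda>i. (\<lambda>x. c * x) -` A i)"
      by (auto simp: space_PiM PiE_iff extensional_def)
    hence "emeasure (scale_measure (ennreal (c ^ card B)) (distr ?M ?M ?s)) (Pi\<^sub>E B A) =
        ennreal (c ^ card B) * emeasure ?M (Pi\<^sub>E B (\<lambda>i. (\<lambda>x. c * x) -` A i))"
      using A B by (subst emeasure_scale_measure, subst emeasure_distr) (auto intro!: sets_PiM_I_finite)
    also have "\<dots> = (\<Prod>i\<in>B. ennreal c * emeasure lborel ((\<lambda>x. c * x) -` A i))"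
      using c pre by (subst emeasure_PiM[OF B]) (auto simp: prod.distrib ennreal_power)
    also have "\<dots> = (\<Prod>i\<in>B. emeasure lborel (A i))" by (intro prod.cong refl one)
    finally show "emeasure (scale_measure (ennreal (c ^ card B)) (distr ?M ?M ?s)) (Pi\<^sub>E B A) = (\<Prod>i\<in>B. emeasure lborel (A i))" .
  qed simp
  hence "(\<integral>\<^sup>+f. g f \<partial>?M) = (\<integral>\<^sup>+f. g f \<partial>(scale_measure (ennreal (c ^ card B)) (distr ?M ?M ?s)))" by simp
  also have "\<dots> = ennreal (c ^ card B) * (\<integral>\<^sup>+f. g f \<partial>(distr ?M ?M ?s))"
    using g by (intro nn_integral_scale_measure) simp
  also have "(\<integral>\<^sup>+f. g f \<partial>(distr ?M ?M ?s)) = (\<integral>\<^sup>+f. g (?s f) \<partial>?M)"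
    using g by (intro nn_integral_distr s) simp
  finally show ?thesis .
qed

text \<open>Minus the derivative of exp(-t^2/2) on the half-line, chosen so that the tail integral
  from r is the Gaussian factor at radius r.\<close>

definition gauss_radial :: "real \<Rightarrow> ennreal" where
  "gauss_radial t = ennreal (t * exp (- t\<^sup>2 / 2)) * indicator {0..} t"

lemma gauss_radial_measurable [measurable]: "gauss_radial \<in> borel_measurable borel"
  unfolding gauss_radial_def by measurable

lemma gauss_radial_tail:
  assumes r: "r \<ge> 0"
  shows "(\<integral>\<^sup>+t. gauss_radial t * indicator {r..} t \<partial>lborel) = ennreal (exp (- r\<^sup>2 / 2))"
proof -
  have "(\<integral>\<^sup>+t. gauss_radial t * indicator {r..} t \<partial>lborel) =
      (\<integral>\<^sup>+t. ennreal (t * exp (- t\<^sup>2 / 2)) * indicator {r..} t \<partial>lborel)"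
    using r by (intro nn_integral_cong) (auto simp: gauss_radial_def split: split_indicator)
  also have "\<dots> = ennreal (0 - (- exp (- r\<^sup>2 / 2)))"
  proof (rule nn_integral_FTC_atLeast)
    show "((\<lambda>t. - exp (- t\<^sup>2 / 2)) has_real_derivative t * exp (- t\<^sup>2 / 2)) (at t)" for t :: real
      by (auto intro!: derivative_eq_intros)
    show "((\<lambda>t::real. - exp (- t\<^sup>2 / 2)) \<longlongrightarrow> 0) at_top" by real_asymp
  qed (use r in auto)
  finally show ?thesis by simp
qed

lemma has_real_derivative_minus_inverse_power:
  fixes t :: real
  assumes "t > 0"
  shows "((\<lambda>t. - 1 / t ^ m) has_real_derivative real m / t ^ (m + 1)) (at t)"
proof (cases m)
  case (Suc k)
  have "((\<lambda>t. - inverse (t ^ Suc k)) has_real_derivative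
      - (- (real (Suc k) * t ^ k * inverse ((t ^ Suc k) ^ Suc (Suc 0))))) (at t)"
    using assms by (intro DERIV_minus DERIV_inverse_fun DERIV_cong[OF DERIV_pow]) simp_all
  moreover have "- (- (real (Suc k) * t ^ k * inverse ((t ^ Suc k) ^ Suc (Suc 0)))) = real m / t ^ (m + 1)"
    using assms by (simp add: Suc field_simps)
  moreover have "(\<lambda>t :: real. - inverse (t ^ Suc k)) = (\<lambda>t. - 1 / t ^ m)"
    unfolding Suc by (simp add: inverse_eq_divide)
  ultimately show ?thesis by (simp only:)
qed simp

section \<open>Radial integration in a linear subspace\<close>

locale radial_integration =
  fixes N :: "'a::euclidean_space set"
  assumes N: "subspace N"
begin

text \<open>The same choice of orthonormal basis as inside \<open>subspace_lborel\<close>, so that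
  integrals against that measure become coordinate integrals by unfolding.\<close>

definition B :: "'a set" where "B = (SOME B. orthonormal_basis_of N B)"

abbreviation n :: nat where "n \<equiv> dim N"

abbreviation coords :: "('a \<Rightarrow> real) measure" where "coords \<equiv> \<Pi>\<^sub>M b\<in>B. lborel"

abbreviation vec_of :: "('a \<Rightarrow> real) \<Rightarrow> 'a" where "vec_of f \<equiv> \<Sum>b\<in>B. f b *\<^sub>R b"

lemma orthonormal_B: "orthonormal_basis_of N B"
  unfolding B_def by (rule orthonormal_basis_of_some[OF N])

lemmas finite_B = orthonormal_basis_ofD(1)[OF orthonormal_B]
lemmas card_B = orthonormal_basis_ofD(2)[OF orthonormal_B]
lemmas norm_vec_of = orthonormal_basis_ofD(3)[OF orthonormal_B]
lemmas vec_of_in_N = orthonormal_basis_ofD(4)[OF orthonormal_B]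

lemma nn_integral_subspace_lborel:
  assumes "g \<in> borel_measurable borel"
  shows "(\<integral>\<^sup>+x. g x \<partial>subspace_lborel N) = (\<integral>\<^sup>+f. g (vec_of f) \<partial>coords)"
  unfolding subspace_lborel_def Let_def B_def[symmetric]
  using assms by (subst nn_integral_distr[OF subspace_lborel_measurable]) simp_all

lemma scale:
  assumes c: "c > 0" and g[measurable]: "g \<in> borel_measurable borel"
  shows "(\<integral>\<^sup>+f. g (vec_of f) \<partial>coords) = ennreal (c ^ n) * (\<integral>\<^sup>+f. g (c *\<^sub>R vec_of f) \<partial>coords)"
proof -
  have "vec_of (\<lambda>b\<in>B. c * f b) = c *\<^sub>R vec_of f" for f
    by (simp add: scaleR_sum_right)
  thus ?thesis
    using nn_integral_PiM_lborel_scale[OF finite_B c, of "\<lambda>f. g (vec_of f)"]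
      measurable_compose[OF subspace_lborel_measurable g] by (simp add: card_B)
qed

lemma ball_scale:
  fixes g :: "'a \<Rightarrow> ennreal"
  assumes t: "t > 0" and g[measurable]: "g \<in> borel_measurable borel"
    and hom: "\<And>t x. t > 0 \<Longrightarrow> g (t *\<^sub>R x) = ennreal (t ^ m) * g x"
  shows "(\<integral>\<^sup>+f. g (vec_of f) * indicator {..t} (norm (vec_of f)) \<partial>coords) =
    ennreal (t ^ (n + m)) * (\<integral>\<^sup>+f. g (vec_of f) * indicator {..1} (norm (vec_of f)) \<partial>coords)"
proof -
  have [measurable]: "vec_of \<in> borel_measurable coords" by (rule subspace_lborel_measurable)
  have "(\<integral>\<^sup>+f. g (vec_of f) * indicator {..t} (norm (vec_of f)) \<partial>coords) =
      ennreal (t ^ n) * (\<integral>\<^sup>+f. g (t *\<^sub>R vec_of f) * indicator {..t} (norm (t *\<^sub>R vec_of f)) \<partial>coords)"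
    by (rule scale[OF t, of "\<lambda>x. g x * indicator {..t} (norm x)"]) measurable
  also have "(\<integral>\<^sup>+f. g (t *\<^sub>R vec_of f) * indicator {..t} (norm (t *\<^sub>R vec_of f)) \<partial>coords) =
      (\<integral>\<^sup>+f. ennreal (t ^ m) * (g (vec_of f) * indicator {..1} (norm (vec_of f))) \<partial>coords)"
    using t by (intro nn_integral_cong) (auto simp: hom mult.assoc split: split_indicator)
  also have "\<dots> = ennreal (t ^ m) * (\<integral>\<^sup>+f. g (vec_of f) * indicator {..1} (norm (vec_of f)) \<partial>coords)"
    by (rule nn_integral_cmult) measurable
  finally show ?thesis using t by (simp add: power_add ennreal_mult mult.assoc)
qed

text \<open>The radial weight is the tail integral of \<open>\<psi>\<close>. After the exchange of
  integrals the inner one runs over the ball of radius t, and homogeneity together with the scaling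
  of Lebesgue measure reduces it to the unit ball with the factor
  \<open>t ^ (n + m)\<close>.\<close>

lemma layer_cake:
  fixes g :: "'a \<Rightarrow> ennreal" and \<psi> :: "real \<Rightarrow> ennreal"
  assumes g[measurable]: "g \<in> borel_measurable borel"
    and hom: "\<And>t x. t > 0 \<Longrightarrow> g (t *\<^sub>R x) = ennreal (t ^ m) * g x"
    and \<psi>[measurable]: "\<psi> \<in> borel_measurable borel" and \<psi>0: "\<And>t. t \<le> 0 \<Longrightarrow> \<psi> t = 0"
  shows "(\<integral>\<^sup>+f. g (vec_of f) * (\<integral>\<^sup>+t. \<psi> t * indicator {norm (vec_of f)..} t \<partial>lborel) \<partial>coords) =
    (\<integral>\<^sup>+t. \<psi> t * ennreal (t ^ (n + m)) \<partial>lborel) *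
      (\<integral>\<^sup>+f. g (vec_of f) * indicator {..1} (norm (vec_of f)) \<partial>coords)"
proof -
  have [measurable]: "vec_of \<in> borel_measurable coords" by (rule subspace_lborel_measurable)
  interpret product_sigma_finite "\<lambda>_ :: 'a. lborel :: real measure" by standard
  interpret C: sigma_finite_measure coords by (rule sigma_finite[OF finite_B])
  interpret pair_sigma_finite coords "lborel :: real measure" by standard
  have ind: "indicator {norm y..} t = (indicator {..t} (norm y) :: ennreal)" for y :: 'a and t :: real
    by (simp add: indicator_def)
  have [measurable]: "(\<lambda>(f, t). g (vec_of f) * (\<psi> t * indicator {..t} (norm (vec_of f)))) \<in> borel_measurable (coords \<Otimes>\<^sub>M lborel)"
    unfolding indicator_def atMost_iff by measurable
  let ?J = "\<integral>\<^sup>+f. g (vec_of f) * indicator {..1} (norm (vec_of f)) \<partial>coords"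
  have "(\<integral>\<^sup>+f. g (vec_of f) * (\<integral>\<^sup>+t. \<psi> t * indicator {norm (vec_of f)..} t \<partial>lborel) \<partial>coords) =
      (\<integral>\<^sup>+f. \<integral>\<^sup>+t. g (vec_of f) * (\<psi> t * indicator {norm (vec_of f)..} t) \<partial>lborel \<partial>coords)"
    by (intro nn_integral_cong nn_integral_cmult[symmetric]) measurable
  also have "\<dots> = (\<integral>\<^sup>+f. \<integral>\<^sup>+t. g (vec_of f) * (\<psi> t * indicator {..t} (norm (vec_of f))) \<partial>lborel \<partial>coords)"
    by (simp only: ind)
  also have "\<dots> = (\<integral>\<^sup>+t. \<integral>\<^sup>+f. g (vec_of f) * (\<psi> t * indicator {..t} (norm (vec_of f))) \<partial>coords \<partial>lborel)"
    by (rule Fubini'[symmetric]) measurable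
  also have "\<dots> = (\<integral>\<^sup>+t. \<psi> t * ennreal (t ^ (n + m)) * ?J \<partial>lborel)"
  proof (rule nn_integral_cong)
    fix t :: real
    have "(\<integral>\<^sup>+f. g (vec_of f) * (\<psi> t * indicator {..t} (norm (vec_of f))) \<partial>coords) =
        \<psi> t * (\<integral>\<^sup>+f. g (vec_of f) * indicator {..t} (norm (vec_of f)) \<partial>coords)"
      by (subst nn_integral_cmult[symmetric]) (simp_all add: mult_ac)
    also have "\<dots> = \<psi> t * ennreal (t ^ (n + m)) * ?J"
    proof (cases "t > 0")
      case True
      thus ?thesis using ball_scale[OF True g hom] by (simp add: mult.assoc)
    qed (simp add: \<psi>0)
    finally show "(\<integral>\<^sup>+f. g (vec_of f) * (\<psi> t * indicator {..t} (norm (vec_of f))) \<partial>coords) =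
        \<psi> t * ennreal (t ^ (n + m)) * ?J" .
  qed
  also have "\<dots> = (\<integral>\<^sup>+t. \<psi> t * ennreal (t ^ (n + m)) \<partial>lborel) * ?J"
    by (rule nn_integral_multc) measurable
  finally show ?thesis .
qed

lemma gauss_layer_cake:
  fixes g :: "'a \<Rightarrow> ennreal"
  assumes g: "g \<in> borel_measurable borel"
    and hom: "\<And>t x. t > 0 \<Longrightarrow> g (t *\<^sub>R x) = ennreal (t ^ m) * g x"
  shows "(\<integral>\<^sup>+f. g (vec_of f) * ennreal (exp (- (norm (vec_of f))\<^sup>2 / 2)) \<partial>coords) =
    (\<integral>\<^sup>+t. gauss_radial t * ennreal (t ^ (n + m)) \<partial>lborel) *
      (\<integral>\<^sup>+f. g (vec_of f) * indicator {..1} (norm (vec_of f)) \<partial>coords)"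
  unfolding gauss_radial_tail[OF norm_ge_zero, symmetric]
  by (rule layer_cake[OF g hom gauss_radial_measurable]) (auto simp: gauss_radial_def indicator_def not_less)

lemma exp_norm_std_gauss:
  "exp (- (norm (vec_of f))\<^sup>2 / 2) = sqrt (2 * pi) ^ n * std_gauss B f"
proof -
  have "std_gauss B f = (\<Prod>b\<in>B. 1 / sqrt (2 * pi)) * (\<Prod>b\<in>B. exp (- (f b)\<^sup>2 / 2))"
    unfolding std_gauss_def std_normal_density_def by (rule prod.distrib)
  also have "(\<Prod>b\<in>B. exp (- (f b)\<^sup>2 / 2)) = exp (- (norm (vec_of f))\<^sup>2 / 2)"
    by (simp add: exp_sum[OF finite_B, symmetric] norm_vec_of sum_nonneg sum_divide_distrib[symmetric] sum_negf)
  finally show ?thesis by (simp add: card_B power_divide)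
qed

text \<open>Dilation by 2 fixes the origin and multiplies Lebesgue measure by \<open>2 ^ n\<close>,
  so the finite mass z of the origin satisfies z = 2^n z.\<close>

lemma AE_vec_of_nonzero:
  assumes "n \<ge> 1"
  shows "AE f in coords. vec_of f \<noteq> 0"
proof -
  have [measurable]: "vec_of \<in> borel_measurable coords" by (rule subspace_lborel_measurable)
  let ?z = "\<integral>\<^sup>+f. indicator {0} (vec_of f) \<partial>coords"
  have "?z \<le> (\<integral>\<^sup>+f. indicator (N \<inter> cball 0 1) (vec_of f) \<partial>coords)"
    using subspace_0[OF N] by (intro nn_integral_mono) (auto split: split_indicator)
  also have "\<dots> = (\<integral>\<^sup>+x. indicator (N \<inter> cball 0 1) x \<partial>subspace_lborel N)"
    using closed_subspace[OF N] by (intro nn_integral_subspace_lborel[symmetric]) (auto intro!: borel_measurable_indicator borel_closed closed_Int)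
  also have "\<dots> = emeasure (subspace_lborel N) (N \<inter> cball 0 1)"
    using closed_subspace[OF N] by (intro nn_integral_indicator) (auto intro!: borel_closed closed_Int)
  also have "\<dots> < \<infinity>" using emeasure_subspace_lborel_cball[OF N, of 1] by simp
  finally have fin: "?z < \<infinity>" .
  have "?z = ennreal (2 ^ n) * (\<integral>\<^sup>+f. indicator {0} (2 *\<^sub>R vec_of f) \<partial>coords)"
    by (rule scale) auto
  also have "(\<integral>\<^sup>+f. indicator {0} (2 *\<^sub>R vec_of f) \<partial>coords) = ?z"
    by (intro nn_integral_cong) (auto split: split_indicator)
  finally have "?z = ennreal (2 ^ n) * ?z" .
  moreover obtain z where z: "z \<ge> 0" "?z = ennreal z" using fin by (cases "?z") auto
  ultimately have "z = 2 ^ n * z" by (simp add: ennreal_mult[symmetric])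
  moreover have "1 < (2::real) ^ n" using assms by (intro one_less_power) auto
  ultimately have "?z = 0" using z by simp
  hence "AE f in coords. indicator {0} (vec_of f) = (0::ennreal)"
    by (subst (asm) nn_integral_0_iff_AE) auto
  thus ?thesis by (rule AE_mp) (auto simp: indicator_def)
qed

text \<open>The value of \<open>g\<close> at \<open>sgn x\<close> is |x|^(-m) times that at x, and
  for |x| at most 1 the factor |x|^(-m) is 1 plus the integral of m / t^(m+1) from |x| to 1. By the
  layer cake formula the second summand contributes m/n times the ball integral of \<open>g\<close>,
  which makes (n + m)/n in all.\<close>

lemma ball_sgn:
  fixes g :: "'a \<Rightarrow> ennreal"
  assumes n: "n \<ge> 1" and g[measurable]: "g \<in> borel_measurable borel"
    and hom: "\<And>t x. t > 0 \<Longrightarrow> g (t *\<^sub>R x) = ennreal (t ^ m) * g x"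
  shows "of_nat n * (\<integral>\<^sup>+f. g (sgn (vec_of f)) * indicator {..1} (norm (vec_of f)) \<partial>coords) =
    of_nat (n + m) * (\<integral>\<^sup>+f. g (vec_of f) * indicator {..1} (norm (vec_of f)) \<partial>coords)"
proof -
  have [measurable]: "vec_of \<in> borel_measurable coords" by (rule subspace_lborel_measurable)
  let ?J = "\<integral>\<^sup>+f. g (vec_of f) * indicator {..1} (norm (vec_of f)) \<partial>coords"
  define \<psi> where "\<psi> t = ennreal (real m / t ^ (m + 1)) * indicator {0<..1} t" for t :: real
  have [measurable]: "\<psi> \<in> borel_measurable borel" unfolding \<psi>_def by measurable
  have tail: "(\<integral>\<^sup>+t. \<psi> t * indicator {r..} t \<partial>lborel) = ennreal (1 / r ^ m - 1) * indicator {..1} r" if r: "r > 0" for r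
  proof (cases "r \<le> 1")
    case True
    have "(\<integral>\<^sup>+t. \<psi> t * indicator {r..} t \<partial>lborel) = (\<integral>\<^sup>+t. ennreal (real m / t ^ (m + 1)) * indicator {r..1} t \<partial>lborel)"
      using r by (intro nn_integral_cong) (auto simp: \<psi>_def split: split_indicator)
    also have "\<dots> = ennreal (- 1 / 1 ^ m - (- 1 / r ^ m))"
    proof (rule nn_integral_FTC_Icc)
      fix t assume "t \<in> {r..1}"
      hence t: "r \<le> t" "t \<le> 1" by auto
      thus "((\<lambda>t. - 1 / t ^ m) has_real_derivative real m / t ^ (m + 1)) (at t)"
        using r by (intro has_real_derivative_minus_inverse_power) simp
      show "0 \<le> real m / t ^ (m + 1)" using t r by simp
    qed (use True in auto)
    finally show ?thesis using True by simp
  next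
    case False
    hence "(\<lambda>t. \<psi> t * indicator {r..} t) = (\<lambda>_. 0)" by (auto simp: \<psi>_def split: split_indicator)
    thus ?thesis using False by (simp only:) simp
  qed
  have total: "(\<integral>\<^sup>+t. \<psi> t * ennreal (t ^ (n + m)) \<partial>lborel) = ennreal (real m / real n)"
  proof -
    have "(\<integral>\<^sup>+t. \<psi> t * ennreal (t ^ (n + m)) \<partial>lborel) = (\<integral>\<^sup>+t. ennreal (real m * t ^ (n - 1)) * indicator {0..1} t \<partial>lborel)"
    \<comment> \<open>At t = 0 the left integrand vanishes, whereas for n = 1 the right one is m; so
      the origin is excluded.\<close>
    proof (rule nn_integral_cong_AE, rule AE_mp[OF AE_lborel_singleton[of 0]], rule AE_I2, rule impI)
      fix t :: real assume t: "t \<noteq> 0"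
      have "real m / t ^ (m + 1) * t ^ (n + m) = real m * t ^ (n - 1)"
        using t n by (cases n) (simp_all add: power_add)
      thus "\<psi> t * ennreal (t ^ (n + m)) = ennreal (real m * t ^ (n - 1)) * indicator {0..1} t"
        using t by (auto simp: \<psi>_def ennreal_mult[symmetric] split: split_indicator)
    qed
    also have "\<dots> = ennreal (real m / real n * 1 ^ n - real m / real n * 0 ^ n)"
    proof (rule nn_integral_FTC_Icc)
      fix t :: real assume t: "t \<in> {0..1}"
      show "((\<lambda>t. real m / real n * t ^ n) has_real_derivative real m * t ^ (n - 1)) (at t)"
        using n by (intro DERIV_cong[OF DERIV_cmult[OF DERIV_pow]]) (simp del: dim_eq_0)
      show "0 \<le> real m * t ^ (n - 1)" using t by simp
    qed auto
    finally show ?thesis using n by (simp add: power_0_left del: dim_eq_0)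
  qed
  have "(\<integral>\<^sup>+f. g (sgn (vec_of f)) * indicator {..1} (norm (vec_of f)) \<partial>coords) =
      (\<integral>\<^sup>+f. g (vec_of f) * indicator {..1} (norm (vec_of f)) +
        g (vec_of f) * (\<integral>\<^sup>+t. \<psi> t * indicator {norm (vec_of f)..} t \<partial>lborel) \<partial>coords)"
  proof (rule nn_integral_cong_AE, rule AE_mp[OF AE_vec_of_nonzero[OF n]], rule AE_I2, rule impI)
    fix f assume "vec_of f \<noteq> 0"
    hence r: "norm (vec_of f) > 0" (is "?r > 0") by simp
    have "g (sgn (vec_of f)) = ennreal ((1 / ?r) ^ m) * g (vec_of f)"
      using hom[of "1 / ?r" "vec_of f"] r by (simp add: sgn_div_norm inverse_eq_divide)
    moreover have "ennreal ((1 / ?r) ^ m) = 1 + ennreal (1 / ?r ^ m - 1)" if "?r \<le> 1"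
    proof -
      have "1 \<le> 1 / ?r ^ m" using r that by (simp add: power_le_one)
      hence "ennreal (1 + (1 / ?r ^ m - 1)) = 1 + ennreal (1 / ?r ^ m - 1)" by (subst ennreal_plus) auto
      thus ?thesis by (simp add: power_one_over)
    qed
    ultimately show "g (sgn (vec_of f)) * indicator {..1} ?r =
        g (vec_of f) * indicator {..1} ?r + g (vec_of f) * (\<integral>\<^sup>+t. \<psi> t * indicator {?r..} t \<partial>lborel)"
      unfolding tail[OF r] by (auto simp: distrib_left distrib_right mult_ac split: split_indicator)
  qed
  also have "\<dots> = ?J + (\<integral>\<^sup>+f. g (vec_of f) * (\<integral>\<^sup>+t. \<psi> t * indicator {norm (vec_of f)..} t \<partial>lborel) \<partial>coords)"
  proof (rule nn_integral_add)
    have "(\<lambda>r. \<integral>\<^sup>+t. \<psi> t * indicator {r..} t \<partial>lborel) \<in> borel_measurable borel"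
      unfolding indicator_def atLeast_iff by measurable
    thus "(\<lambda>f. g (vec_of f) * (\<integral>\<^sup>+t. \<psi> t * indicator {norm (vec_of f)..} t \<partial>lborel)) \<in> borel_measurable coords"
      by measurable
  qed measurable
  also have "(\<integral>\<^sup>+f. g (vec_of f) * (\<integral>\<^sup>+t. \<psi> t * indicator {norm (vec_of f)..} t \<partial>lborel) \<partial>coords) = ennreal (real m / real n) * ?J"
    unfolding total[symmetric] by (rule layer_cake[OF g hom]) (auto simp: \<psi>_def)
  finally have "(\<integral>\<^sup>+f. g (sgn (vec_of f)) * indicator {..1} (norm (vec_of f)) \<partial>coords) = ?J + ennreal (real m / real n) * ?J" .
  moreover have "of_nat n * (?J + ennreal (real m / real n) * ?J) = of_nat (n + m) * ?J"
  proof -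
    have "of_nat n * (?J + ennreal (real m / real n) * ?J) = of_nat n * ?J + (of_nat n * ennreal (real m / real n)) * ?J"
      by (simp add: distrib_left mult.assoc)
    also have "of_nat n * ennreal (real m / real n) = of_nat m"
      using n by (simp add: ennreal_of_nat_eq_real_of_nat ennreal_mult[symmetric] del: dim_eq_0)
    finally show ?thesis by (simp add: distrib_right)
  qed
  ultimately show ?thesis by simp
qed

text \<open>The cone normalization of the sphere measure supplies the factor \<open>n\<close>, and
  the puncture of the ball at the origin may be dropped as a null set.\<close>

lemma nn_integral_unit_sphere_measure:
  fixes g :: "'a \<Rightarrow> ennreal"
  assumes n: "n \<ge> 1" and g[measurable]: "g \<in> borel_measurable borel"
  shows "(\<integral>\<^sup>+x. g x \<partial>unit_sphere_measure N) =
    of_nat n * (\<integral>\<^sup>+f. g (sgn (vec_of f)) * indicator {..1} (norm (vec_of f)) \<partial>coords)"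
proof -
  have V: "N \<in> sets borel" using closed_subspace[OF N] by (rule borel_closed)
  hence D[measurable]: "N \<inter> cball 0 1 - {0} \<in> sets borel" by (simp add: borel_closed sets.Int sets.Diff)
  have sgn0[measurable]: "(sgn :: 'a \<Rightarrow> 'a) \<in> borel_measurable borel"
    unfolding sgn_div_norm[abs_def] by measurable
  have sgn: "sgn \<in> restrict_space (subspace_lborel N) (N \<inter> cball 0 1 - {0}) \<rightarrow>\<^sub>M restrict_space borel (N \<inter> sphere 0 1)"
  proof (rule measurable_restrict_space2)
    show "sgn \<in> space (restrict_space (subspace_lborel N) (N \<inter> cball 0 1 - {0})) \<rightarrow> N \<inter> sphere 0 1"
      using N by (simp add: space_restrict_space sgn_div_norm subspace_mul)
    show "sgn \<in> borel_measurable (restrict_space (subspace_lborel N) (N \<inter> cball 0 1 - {0}))"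
      using sgn0 by (intro measurable_restrict_space1) (simp cong: measurable_cong_sets)
  qed
  have gm: "g \<in> borel_measurable (restrict_space borel (N \<inter> sphere 0 1))"
    using g by (rule measurable_restrict_space1)
  have "(\<integral>\<^sup>+x. g x \<partial>unit_sphere_measure N) =
      of_nat n * (\<integral>\<^sup>+x. g (sgn x) \<partial>restrict_space (subspace_lborel N) (N \<inter> cball 0 1 - {0}))"
    unfolding unit_sphere_measure_def using gm
    by (subst nn_integral_scale_measure) (simp_all add: nn_integral_distr[OF sgn])
  also have "(\<integral>\<^sup>+x. g (sgn x) \<partial>restrict_space (subspace_lborel N) (N \<inter> cball 0 1 - {0})) =
      (\<integral>\<^sup>+x. g (sgn x) * indicator (N \<inter> cball 0 1 - {0}) x \<partial>subspace_lborel N)"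
    by (rule nn_integral_restrict_space) simp
  also have "\<dots> = (\<integral>\<^sup>+f. g (sgn (vec_of f)) * indicator (N \<inter> cball 0 1 - {0}) (vec_of f) \<partial>coords)"
    by (rule nn_integral_subspace_lborel) measurable
  also have "\<dots> = (\<integral>\<^sup>+f. g (sgn (vec_of f)) * indicator {..1} (norm (vec_of f)) \<partial>coords)"
    by (rule nn_integral_cong_AE, rule AE_mp[OF AE_vec_of_nonzero[OF n]], rule AE_I2)
      (use vec_of_in_N in \<open>auto split: split_indicator\<close>)
  finally show ?thesis .
qed

end

text \<open>The layer cake formula for the constant 1 on the whole space, in degree 0: its left-hand
  side is the total mass of the unnormalized Gaussian, so the radial integral is found without
  evaluating it directly.\<close>

lemma gauss_radial_moment:
  "(\<integral>\<^sup>+t. gauss_radial t * ennreal (t ^ DIM('a::euclidean_space)) \<partial>lborel) *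
      ennreal (unit_ball_vol (DIM('a))) = ennreal (sqrt (2 * pi) ^ DIM('a))"
proof -
  interpret radial_integration "UNIV :: 'a set" by standard simp
  interpret P: product_sigma_finite "\<lambda>_ :: 'a. lborel :: real measure" by standard
  have "(\<integral>\<^sup>+f. 1 * ennreal (exp (- (norm (vec_of f))\<^sup>2 / 2)) \<partial>coords) =
      (\<integral>\<^sup>+t. gauss_radial t * ennreal (t ^ (dim (UNIV :: 'a set) + 0)) \<partial>lborel) *
      (\<integral>\<^sup>+f. 1 * indicator {..1} (norm (vec_of f)) \<partial>coords)"
    by (rule gauss_layer_cake) auto
  moreover have "(\<integral>\<^sup>+f. 1 * indicator {..1} (norm (vec_of f)) \<partial>coords) = ennreal (unit_ball_vol (DIM('a)))"
  proof -
    have "(\<integral>\<^sup>+f. 1 * indicator {..1} (norm (vec_of f)) \<partial>coords) = (\<integral>\<^sup>+f. indicator (UNIV \<inter> cball 0 1) (vec_of f) \<partial>coords)"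
      by (intro nn_integral_cong) (auto split: split_indicator)
    also have "\<dots> = (\<integral>\<^sup>+x. indicator (UNIV \<inter> cball 0 1) x \<partial>subspace_lborel (UNIV :: 'a set))"
      by (intro nn_integral_subspace_lborel[symmetric] borel_measurable_indicator) simp
    also have "\<dots> = emeasure (subspace_lborel (UNIV :: 'a set)) (UNIV \<inter> cball 0 1)"
      by (intro nn_integral_indicator) auto
    finally show ?thesis using emeasure_subspace_lborel_cball[of "UNIV :: 'a set" 1] by simp
  qed
  moreover have "(\<integral>\<^sup>+f. 1 * ennreal (exp (- (norm (vec_of f))\<^sup>2 / 2)) \<partial>coords) = ennreal (sqrt (2 * pi) ^ DIM('a))"
  proof -
    have "(\<integral>\<^sup>+f. 1 * ennreal (exp (- (norm (vec_of f))\<^sup>2 / 2)) \<partial>coords) =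
        (\<integral>\<^sup>+f. ennreal (sqrt (2 * pi) ^ DIM('a)) * (\<Prod>b\<in>B. ennreal (std_normal_density (f b))) \<partial>coords)"
      unfolding exp_norm_std_gauss
      by (intro nn_integral_cong) (simp add: std_gauss_def ennreal_mult prod_nonneg prod_ennreal)
    also have "\<dots> = ennreal (sqrt (2 * pi) ^ DIM('a)) * (\<integral>\<^sup>+f. (\<Prod>b\<in>B. ennreal (std_normal_density (f b))) \<partial>coords)"
      by (rule nn_integral_cmult) measurable
    also have "(\<integral>\<^sup>+f. (\<Prod>b\<in>B. ennreal (std_normal_density (f b))) \<partial>coords) = (\<Prod>b\<in>B. \<integral>\<^sup>+t. ennreal (std_normal_density t) \<partial>lborel)"
      by (rule P.product_nn_integral_prod[OF finite_B]) measurable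
    also have "(\<integral>\<^sup>+t. ennreal (std_normal_density t) \<partial>lborel) = 1"
      using nn_integral_eq_integral[OF integrable_normal_density[of 1 0]] integral_normal_density[of 1 0] by simp
    finally show ?thesis by simp
  qed
  ultimately show ?thesis by simp
qed

text \<open>The sphere integral is n + m times the ball integral of \<open>g\<close>, and the
  Gaussian integral is the same ball integral times a radial integral with exponent n + m.
  Eliminating the ball integral leaves a constant governed by the ambient dimension.\<close>

lemma (in radial_integration) nn_integral_sphere_gauss:
  fixes g :: "'a \<Rightarrow> ennreal"
  assumes n: "n \<ge> 1" and k: "DIM('a) = n + m" and g[measurable]: "g \<in> borel_measurable borel"
    and hom: "\<And>t x. t > 0 \<Longrightarrow> g (t *\<^sub>R x) = ennreal (t ^ m) * g x"
  shows "(\<integral>\<^sup>+x. g x \<partial>unit_sphere_measure N) =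
    ennreal (unit_sphere_vol (DIM('a) - 1) / sqrt (2 * pi) ^ m) *
      (\<integral>\<^sup>+f. ennreal (std_gauss B f) * g (vec_of f) \<partial>coords)"
proof -
  have [measurable]: "vec_of \<in> borel_measurable coords" by (rule subspace_lborel_measurable)
  let ?k = "DIM('a)" and ?s = "sqrt (2 * pi)"
  let ?J = "\<integral>\<^sup>+f. g (vec_of f) * indicator {..1} (norm (vec_of f)) \<partial>coords"
  let ?G = "\<integral>\<^sup>+f. ennreal (std_gauss B f) * g (vec_of f) \<partial>coords"
  let ?c = "\<integral>\<^sup>+t. gauss_radial t * ennreal (t ^ ?k) \<partial>lborel"
  have [measurable]: "std_gauss B \<in> borel_measurable coords" unfolding std_gauss_def by measurable
  have sphere: "(\<integral>\<^sup>+x. g x \<partial>unit_sphere_measure N) = of_nat ?k * ?J"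
    using nn_integral_unit_sphere_measure[OF n g] ball_sgn[OF n g hom] k by simp
  have "ennreal (?s ^ n) * ?G = (\<integral>\<^sup>+f. ennreal (?s ^ n) * (ennreal (std_gauss B f) * g (vec_of f)) \<partial>coords)"
    by (rule nn_integral_cmult[symmetric]) measurable
  also have "\<dots> = (\<integral>\<^sup>+f. g (vec_of f) * ennreal (exp (- (norm (vec_of f))\<^sup>2 / 2)) \<partial>coords)"
    unfolding exp_norm_std_gauss
    by (intro nn_integral_cong) (simp add: ennreal_mult std_gauss_def prod_nonneg mult_ac)
  also have "\<dots> = ?c * ?J" using gauss_layer_cake[OF g hom] k by simp
  finally have G: "ennreal (?s ^ n) * ?G = ?c * ?J" .
  have ubv: "unit_ball_vol (real ?k) > 0" by simp
  have a0: "real ?k / ?s ^ ?k \<ge> 0" and s0: "?s ^ j \<ge> 0" for j by simp_all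
  have e2: "ennreal a * (ennreal u * H) = ennreal (a * u) * H" if "a \<ge> 0" "u \<ge> 0" for a u H
    using that by (simp add: ennreal_mult mult.assoc)
  have e3: "ennreal a * (ennreal u * (ennreal s * H)) = ennreal (a * u * s) * H" if "a \<ge> 0" "u \<ge> 0" "s \<ge> 0" for a u s H
    using that by (simp add: ennreal_mult mult.assoc)
  \<comment> \<open>Rather than dividing by the radial integral \<open>?c\<close> in
    \<open>ennreal\<close>, multiplication by the volume of the unit ball turns it into a known
    power of \<open>sqrt (2 * pi)\<close>.\<close>
  have "ennreal (unit_ball_vol (real ?k)) * (ennreal (?s ^ n) * ?G) = (?c * ennreal (unit_ball_vol (real ?k))) * ?J"
    unfolding G by (simp add: mult_ac)
  also have "\<dots> = ennreal (?s ^ ?k) * ?J" unfolding gauss_radial_moment ..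
  finally have "ennreal (unit_ball_vol (real ?k)) * (ennreal (?s ^ n) * ?G) = ennreal (?s ^ ?k) * ?J" .
  hence "ennreal (real ?k / ?s ^ ?k) * (ennreal (unit_ball_vol (real ?k)) * (ennreal (?s ^ n) * ?G)) =
      ennreal (real ?k / ?s ^ ?k) * (ennreal (?s ^ ?k) * ?J)" by simp
  hence "ennreal (real ?k / ?s ^ ?k * unit_ball_vol (real ?k) * ?s ^ n) * ?G = ennreal (real ?k / ?s ^ ?k * ?s ^ ?k) * ?J"
    by (simp only: e3[OF a0 less_imp_le[OF ubv] s0] e2[OF a0 s0])
  moreover have "real ?k / ?s ^ ?k * ?s ^ ?k = real ?k" by simp
  moreover have "real ?k / ?s ^ ?k * unit_ball_vol (real ?k) * ?s ^ n = unit_sphere_vol (?k - 1) / ?s ^ m"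
  proof -
    have "?k - 1 + 1 = ?k" by simp
    hence "unit_sphere_vol (?k - 1) = real ?k * unit_ball_vol (real ?k)" unfolding unit_sphere_vol_def by (simp only:)
    moreover have "?s ^ ?k = ?s ^ n * ?s ^ m" by (simp add: k power_add)
    ultimately show ?thesis by simp
  qed
  ultimately show ?thesis unfolding sphere by (simp add: ennreal_of_nat_eq_real_of_nat)
qed

text \<open>Since \<open>ennreal\<close> truncates at 0, the formula for nonnegative functions is
  applied to \<open>F\<close> and to its negative, both homogeneous. Gaussian integrability makes
  both integrals finite and thereby gives integrability on the sphere.\<close>

lemma (in radial_integration) integral_sphere_gauss:
  fixes F :: "'a \<Rightarrow> real"
  assumes n: "n \<ge> 1" and k: "DIM('a) = n + m" and F[measurable]: "F \<in> borel_measurable borel"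
    and hom: "\<And>t x. t > 0 \<Longrightarrow> F (t *\<^sub>R x) = t ^ m * F x"
    and int: "gauss_integrable B (\<lambda>f. F (vec_of f))"
  shows "(\<integral>x. F x \<partial>unit_sphere_measure N) =
    unit_sphere_vol (DIM('a) - 1) / sqrt (2 * pi) ^ m * gauss_expectation B (\<lambda>f. F (vec_of f))"
proof -
  let ?K = "unit_sphere_vol (DIM('a) - 1) / sqrt (2 * pi) ^ m"
  have K: "?K \<ge> 0" unfolding unit_sphere_vol_def by (simp add: divide_nonneg_nonneg)
  have nn: "(\<integral>\<^sup>+x. ennreal (H x) \<partial>unit_sphere_measure N) = ennreal ?K * (\<integral>\<^sup>+f. ennreal (std_gauss B f * H (vec_of f)) \<partial>coords)"
    if [measurable]: "H \<in> borel_measurable borel" and h: "\<And>t x. t > 0 \<Longrightarrow> H (t *\<^sub>R x) = t ^ m * H x" for H :: "'a \<Rightarrow> real"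
  proof -
    have "(\<integral>\<^sup>+x. ennreal (H x) \<partial>unit_sphere_measure N) = ennreal ?K * (\<integral>\<^sup>+f. ennreal (std_gauss B f) * ennreal (H (vec_of f)) \<partial>coords)"
      by (rule nn_integral_sphere_gauss[OF n k]) (auto simp: h ennreal_mult')
    also have "(\<integral>\<^sup>+f. ennreal (std_gauss B f) * ennreal (H (vec_of f)) \<partial>coords) = (\<integral>\<^sup>+f. ennreal (std_gauss B f * H (vec_of f)) \<partial>coords)"
      by (intro nn_integral_cong) (simp add: ennreal_mult' std_gauss_def prod_nonneg)
    finally show ?thesis .
  qed
  have pos: "(\<integral>\<^sup>+x. ennreal (F x) \<partial>unit_sphere_measure N) = ennreal ?K * (\<integral>\<^sup>+f. ennreal (std_gauss B f * F (vec_of f)) \<partial>coords)"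
    by (rule nn[OF F]) (rule hom)
  have neg: "(\<integral>\<^sup>+x. ennreal (- F x) \<partial>unit_sphere_measure N) = ennreal ?K * (\<integral>\<^sup>+f. ennreal (- (std_gauss B f * F (vec_of f))) \<partial>coords)"
    using nn[of "\<lambda>x. - F x"] hom by simp
  have fin: "(\<integral>\<^sup>+f. ennreal (std_gauss B f * F (vec_of f)) \<partial>coords) \<noteq> \<infinity>"
    "(\<integral>\<^sup>+f. ennreal (- (std_gauss B f * F (vec_of f))) \<partial>coords) \<noteq> \<infinity>"
    using int unfolding gauss_integrable_def real_integrable_def by auto
  have "F \<in> borel_measurable (restrict_space borel (N \<inter> sphere 0 1))"
    using F by (rule measurable_restrict_space1)
  hence "F \<in> borel_measurable (unit_sphere_measure N)"
    unfolding unit_sphere_measure_def by (simp cong: measurable_cong_sets)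
  hence "integrable (unit_sphere_measure N) F"
    unfolding real_integrable_def pos neg using fin by (auto simp: ennreal_mult_eq_top_iff)
  hence "(\<integral>x. F x \<partial>unit_sphere_measure N) =
      enn2real (ennreal ?K * (\<integral>\<^sup>+f. ennreal (std_gauss B f * F (vec_of f)) \<partial>coords)) -
      enn2real (ennreal ?K * (\<integral>\<^sup>+f. ennreal (- (std_gauss B f * F (vec_of f))) \<partial>coords))"
    unfolding pos[symmetric] neg[symmetric] by (rule real_lebesgue_integral_def)
  also have "\<dots> = ?K * gauss_expectation B (\<lambda>f. F (vec_of f))"
    unfolding gauss_expectation_def real_lebesgue_integral_def[OF int[unfolded gauss_integrable_def]]
    using K by (simp add: enn2real_mult right_diff_distrib)
  finally show ?thesis .
qed

section \<open>Invariance of the curvature\<close>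

lemma det_inner_borel_measurable:
  fixes A :: "nat \<Rightarrow> nat \<Rightarrow> 'a::euclidean_space"
  shows "(\<lambda>\<nu>. Determinant.det (Matrix.mat m m (\<lambda>(i, j). A i j \<bullet> \<nu>))) \<in> borel_measurable borel"
proof -
  have "(\<lambda>\<nu>. \<Sum>\<sigma> | \<sigma> permutes {0..<m}. of_int (sign \<sigma>) * (\<Prod>i=0..<m. A i (\<sigma> i) \<bullet> \<nu>)) \<in> borel_measurable borel"
    by measurable
  thus ?thesis by (simp only: det_inner_expand)
qed

lemma det_inner_scale:
  fixes A :: "nat \<Rightarrow> nat \<Rightarrow> 'a::euclidean_space"
  shows "Determinant.det (Matrix.mat m m (\<lambda>(i, j). A i j \<bullet> (t *\<^sub>R \<nu>))) =
    t ^ m * Determinant.det (Matrix.mat m m (\<lambda>(i, j). A i j \<bullet> \<nu>))"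
proof -
  have "Matrix.mat m m (\<lambda>(i, j). A i j \<bullet> (t *\<^sub>R \<nu>)) = t \<cdot>\<^sub>m Matrix.mat m m (\<lambda>(i, j). A i j \<bullet> \<nu>)"
    by (intro eq_matI) auto
  thus ?thesis by simp
qed

lemma integral_sphere_det:
  fixes N :: "'a::euclidean_space set" and A :: "nat \<Rightarrow> nat \<Rightarrow> 'a"
  assumes sub: "subspace N" and dim: "dim N \<ge> 1" "DIM('a) = dim N + m"
  shows "(\<integral>\<nu>. Determinant.det (Matrix.mat m m (\<lambda>(i, j). A i j \<bullet> \<nu>)) \<partial>unit_sphere_measure N) =
    unit_sphere_vol (DIM('a) - 1) / sqrt (2 * pi) ^ m *
      gauss_expectation (radial_integration.B N) (\<lambda>f. Determinant.det (Matrix.mat m m (\<lambda>(i, j). A i j \<bullet> (\<Sum>b\<in>radial_integration.B N. f b *\<^sub>R b))))"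
proof -
  interpret radial_integration N by standard (rule sub)
  show ?thesis
    by (rule integral_sphere_gauss[OF dim det_inner_borel_measurable])
      (simp_all add: det_inner_scale gauss_det(1)[OF finite_B] del: inner_scaleR_right)
qed

lemma dim_normal_space:
  fixes M :: "'a::euclidean_space set"
  assumes "subspace (tangent_space M p)"
  shows "dim (normal_space M p) + dim (tangent_space M p) = DIM('a)"
proof -
  have "normal_space M p = {y. \<forall>x\<in>tangent_space M p. orthogonal x y}"
    by (auto simp: normal_space_def orthogonal_comp_def)
  thus ?thesis using dim_subspace_orthogonal_to_vectors[of "tangent_space M p" UNIV] assms by simp
qed

context immersed_parametrization
begin

text \<open>The average over the unit normals brings \<open>1 / unit_sphere_vol (n - 1)\<close>, the
  passage to the Gaussian brings the volume of the ambient sphere; the normalization of the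
  invariant cancels both. Of the remaining constants none depends on the codimension.\<close>

lemma generalized_gauss_curvature_gauss:
  assumes n: "DIM('a) = m + n" "n \<ge> 1" and c: "tangent_basis m M (r x) c"
  shows "unit_sphere_vol (n - 1) / unit_sphere_vol (DIM('a) - 1) * generalized_gauss_curvature M (r x) =
    gauss_expectation (radial_integration.B (normal_space M (r x)))
      (\<lambda>f. Determinant.det (Matrix.mat m m (\<lambda>(i, j). second_fundamental_form M (r x) (c i) (c j) \<bullet>
        (\<Sum>b\<in>radial_integration.B (normal_space M (r x)). f b *\<^sub>R b)))) /
    (sqrt (2 * pi) ^ m * Determinant.det (Matrix.mat m m (\<lambda>(i, j). c i \<bullet> c j)))"
proof -
  have dimN: "dim (normal_space M (r x)) = n"
    using dim_normal_space[OF tangent_subspace] tangent_dim n(1) by simp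
  have pos: "unit_sphere_vol d > 0" for d unfolding unit_sphere_vol_def by simp
  have "DIM('a) - m - 1 = n - 1" using n by simp
  hence "generalized_gauss_curvature M (r x) = 1 / unit_sphere_vol (n - 1) *
      (\<integral>\<nu>. Determinant.det (Matrix.mat m m (\<lambda>(i, j). second_fundamental_form M (r x) (c i) (c j) \<bullet> \<nu>)) /
        Determinant.det (Matrix.mat m m (\<lambda>(i, j). c i \<bullet> c j)) \<partial>unit_sphere_measure (normal_space M (r x)))"
    unfolding generalized_gauss_curvature_def tangent_dim directional_gauss_curvature_eq[OF c] by simp
  also have "\<dots> = 1 / unit_sphere_vol (n - 1) * (unit_sphere_vol (DIM('a) - 1) / sqrt (2 * pi) ^ m *
      gauss_expectation (radial_integration.B (normal_space M (r x)))
      (\<lambda>f. Determinant.det (Matrix.mat m m (\<lambda>(i, j). second_fundamental_form M (r x) (c i) (c j) \<bullet>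
        (\<Sum>b\<in>radial_integration.B (normal_space M (r x)). f b *\<^sub>R b)))) /
      Determinant.det (Matrix.mat m m (\<lambda>(i, j). c i \<bullet> c j)))"
    using n dimN by (simp add: integral_sphere_det[OF subspace_normal_space])
  finally show ?thesis using pos[of "n - 1"] pos[of "DIM('a) - 1"] by simp
qed

end

lemma indexed_basis:
  fixes L :: "'a::euclidean_space set"
  assumes "subspace L" "dim L = m"
  obtains h :: "nat \<Rightarrow> 'a" where "inj_on h {..<m}" "independent (h ` {..<m})" "span (h ` {..<m}) = L"
proof -
  obtain C where C: "C \<subseteq> L" "independent C" "L \<subseteq> span C" "card C = dim L" using basis_exists[of L] by blast
  have fin: "finite C" using C(2) by (rule independent_imp_finite)
  obtain h where "bij_betw h {0..<card C} C" using ex_bij_betw_nat_finite[OF fin] by blast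
  hence h: "inj_on h {..<m}" "h ` {..<m} = C" using C(4) assms(2) by (auto simp: bij_betw_def lessThan_atLeast0)
  have "span C = L" using span_minimal[OF C(1) assms(1)] C(3) by blast
  thus thesis using that[of h] h C(2) by simp
qed

theorem mainTheorem2:
  fixes M U :: "'a::euclidean_space set" and M' U' :: "'b::euclidean_space set"
    and s :: "'a \<Rightarrow> (nat \<Rightarrow> 'a) \<Rightarrow> real" and s' :: "'b \<Rightarrow> (nat \<Rightarrow> 'b) \<Rightarrow> real"
    and m n n' :: nat and \<phi> :: "'a \<Rightarrow> 'b" and p :: 'a
  assumes "closed_oriented_submanifold m M s" and "closed_oriented_submanifold m M' s'"
    and "DIM('a) = m + n" and "n \<ge> 1"
    and "DIM('b) = m + n'" and "n' \<ge> 1"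
    and "openin (top_of_set M) U" and "openin (top_of_set M') U'"
    and "riemannian_isometry U U' \<phi>"
    and "p \<in> U"
  shows "unit_sphere_vol (n - 1) / unit_sphere_vol (DIM('a) - 1) * generalized_gauss_curvature M p =
         unit_sphere_vol (n' - 1) / unit_sphere_vol (DIM('b) - 1) *
           generalized_gauss_curvature M' (\<phi> p)"
proof -
  have M: "submanifold m M" and M': "submanifold m M'"
    using assms(1,2) by (simp_all add: closed_oriented_submanifold_def)
  obtain V L :: "'a set" and r :: "'a \<Rightarrow> 'a" and r' :: "'a \<Rightarrow> 'b" and x
    where imm: "isometric_immersions V L r r' M M' m x" and p: "r x = p" "r' x = \<phi> p"
    using isometry_immersions[OF M M' assms(7-10)] by metis
  interpret isometric_immersions V L r r' M M' m x by (rule imm)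
  obtain h :: "nat \<Rightarrow> 'a" where h: "inj_on h {..<m}" "independent (h ` {..<m})" "span (h ` {..<m}) = L"
    using indexed_basis[OF L dimL] by blast
  have hL: "h i \<in> L" if "i < m" for i
  proof -
    have "h i \<in> span (h ` {..<m})" using that by (intro span_base) simp
    thus ?thesis using h(3) by simp
  qed
  \<comment> \<open>One basis of \<open>L\<close> is pushed forward by both differentials, so that
    the two tangent bases correspond and have the same Gram matrix.\<close>
  let ?c = "\<lambda>i. dirderiv (h i) r x" and ?c' = "\<lambda>i. dirderiv (h i) r' x"
  let ?B = "radial_integration.B (normal_space M (r x))" and ?B' = "radial_integration.B (normal_space M' (r' x))"
  have B: "orthonormal_basis_of (normal_space M (r x)) ?B" "orthonormal_basis_of (normal_space M' (r' x)) ?B'"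
    by (intro radial_integration.orthonormal_B radial_integration.intro subspace_normal_space)+
  have "gauss_expectation ?B (\<lambda>f. Determinant.det (Matrix.mat m m
        (\<lambda>(i, j). second_fundamental_form M (r x) (?c i) (?c j) \<bullet> (\<Sum>b\<in>?B. f b *\<^sub>R b)))) =
      gauss_expectation ?B' (\<lambda>f. Determinant.det (Matrix.mat m m
        (\<lambda>(i, j). second_fundamental_form M' (r' x) (?c' i) (?c' j) \<bullet> (\<Sum>b\<in>?B'. f b *\<^sub>R b))))"
  proof (rule gauss_expectation_det_eq[OF B])
    show "second_fundamental_form M (r x) (?c i) (?c j) \<in> normal_space M (r x)" if "i < m" "j < m" for i j
      unfolding second_fundamental_form_eq[OF hL[OF that(1)] hL[OF that(2)]]
      by (rule normal_component_unique(1)[OF tangent_subspace])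
    show "second_fundamental_form M' (r' x) (?c' i) (?c' j) \<in> normal_space M' (r' x)" if "i < m" "j < m" for i j
      unfolding second.second_fundamental_form_eq[OF hL[OF that(1)] hL[OF that(2)]]
      by (rule normal_component_unique(1)[OF second.tangent_subspace])
    show "second_fundamental_form M (r x) (?c i) (?c j) \<bullet> second_fundamental_form M (r x) (?c k) (?c l) -
        second_fundamental_form M (r x) (?c i) (?c l) \<bullet> second_fundamental_form M (r x) (?c k) (?c j) =
        second_fundamental_form M' (r' x) (?c' i) (?c' j) \<bullet> second_fundamental_form M' (r' x) (?c' k) (?c' l) -
        second_fundamental_form M' (r' x) (?c' i) (?c' l) \<bullet> second_fundamental_form M' (r' x) (?c' k) (?c' j)"
      if "i < m" "j < m" "k < m" "l < m" for i j k l
      \<comment> \<open>The two middle indices are exchanged: \<open>gauss_equation\<close> swaps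
        first arguments of the forms, which after commuting the factors is the swap of second
        arguments, that is of column indices, arising from permutations.\<close>
      using gauss_equation[OF hL[OF that(1)] hL[OF that(3)] hL[OF that(2)] hL[OF that(4)]]
      by (simp add: inner_commute)
  qed
  moreover have "Matrix.mat m m (\<lambda>(i, j). ?c i \<bullet> ?c j) = Matrix.mat m m (\<lambda>(i, j). ?c' i \<bullet> ?c' j)"
    using metric_eq[OF x hL hL] by (intro eq_matI) auto
  ultimately show ?thesis
    unfolding p(2)[symmetric] unfolding p(1)[symmetric] generalized_gauss_curvature_gauss[OF assms(3,4) tangent_basis_image[OF h]]
      second.generalized_gauss_curvature_gauss[OF assms(5,6) second.tangent_basis_image[OF h]]
    by (simp only:)
qed

end
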